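(* Let $p$ be a prime, let $K$ be a finite extension of $\mathbb{Q}_p$ contained in $\bar{\mathbb{Q}}_p$, with valuation ring $\mathcal{O}_K$, maximal ideal $\mathcal{P}_K$ and residue field of cardinality $q$. Let $\pi,\pi'$ be uniformising parameters of $\mathcal{O}_K$, let $P,Q\in\mathcal{O}_K[[X]]$ be Lubin-Tate series with respect to $\pi$ and $\pi'$ respectively, and let $\{\omega_i\}_{i>0}$ be a coherent set of roots associated to $Q$. For $m\ge1$ let $$\mathcal{E}^{Q}_{P,m}(X)=\exp_{F_P}\left(\sum_{i=0}^{m-1}\frac{\omega_{m-i}\,(X^{q^i}-X^{q^{i+1}})}{\pi^i}\right).$$ Let $n\ge 1$ be an integer. 1. If $\pi\equiv\pi'\bmod\mathcal{P}_K^{n+1}$, then $\mathcal{E}^{Q}_{P,m}(1)$ is a primitive $m$th Lubin-Tate division point with respect to $P$, for all integers $m$ with $0<m\le n$. 2. If $\pi'=\pi$, then $\{\mathcal{E}^{Q}_{P,i}(1)\}_{i>0}$ is a coherent set of roots associated to $P$.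
   Context: $\bar{\mathbb{Q}}_p$ is a fixed algebraic closure of $\mathbb{Q}_p$, $\mathbb{C}_p$ its completion, and $v_p$ the valuation on $\mathbb{C}_p$ with $v_p(p)=1$. Lubin-Tate series: $P\in\mathcal{O}_K[[X]]$ is a Lubin-Tate series with respect to the uniformising parameter $\pi$ if $P(X)\equiv \pi X \bmod X^2\mathcal{O}_K[[X]]$ and $P(X)\equiv X^q\bmod \pi\mathcal{O}_K[[X]]$. $F_P(X,Y)\in\mathcal{O}_K[[X,Y]]$ is the unique one-dimensional commutative formal group with $P(F_P(X,Y))=F_P(P(X),P(Y))$, and $\exp_{F_P}\in XK[[X]]$ is the unique power series with $\exp_{F_P}(X)\equiv X\bmod X^2K[[X]]$ and $\exp_{F_P}(X+Y)=F_P(\exp_{F_P}(X),\exp_{F_P}(Y))$. Coherent set of roots associated to a Lubin-Tate series $Q$: a sequence $\{\omega_i\}_{i>0}$ of elements of $\bar{\mathbb{Q}}_p$ with $v_p(\omega_i)>0$, such that $\omega_1\neq0$, $Q(\omega_1)=0$ and $Q(\omega_{i+1})=\omega_i$ for all $i\ge1$. $\mathcal{E}^{Q}_{P,m}(1)$ denotes the value at $X=1$ of the power series $\mathcal{E}^{Q}_{P,m}(X)$ expanded as a power series in $X$; under the hypothesis $\pi\equiv\pi'\bmod\mathcal{P}_K^{m+1}$ this power series has coefficients in $\mathcal{O}_K[\omega_m]$ and converges on $\{x\in\mathbb{C}_p:v_p(x)>c\}$ for some $c<0$. An element $\omega$ with $v_p(\omega)>0$ is a primitive $m$th Lubin-Tate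 division point with respect to $P$ if $P^{(m)}(\omega)=0$ and $P^{(m-1)}(\omega)\neq0$, where $P^{(i)}$ denotes the $i$-fold composition of $P$ with itself and $P^{(0)}(X)=X$. *)

theory Defs
  imports "HOL-Analysis.Elementary_Metric_Spaces" "HOL-Library.Extended_Real"
    "HOL-Computational_Algebra.Computational_Algebra"
begin

unbundle fps_syntax

section \<open>The field \<open>\<complex>\<^sub>p\<close>\<close>

text \<open>
  There is no library construction of \<open>\<complex>\<^sub>p\<close>.  It is represented by an arbitrary
  complete metric field whose metric comes from a valuation \<open>v\<close> with \<open>v p = 1\<close>, in which the
  closure of \<open>\<rat>\<close> serves as the completion \<open>\<rat>\<^sub>p\<close> of \<open>\<rat>\<close>, the elements algebraic over it as
  the fixed algebraic closure of \<open>\<rat>\<^sub>p\<close>, and in which that algebraic closure is dense.  These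
  conditions determine the valued field up to isometric isomorphism.
\<close>

definition Qp :: "'a::{field_char_0, topological_space} set" where
  "Qp = closure \<rat>"

definition Qp_bar :: "'a::{field_char_0, topological_space} set" where
  "Qp_bar = {x. \<exists>f. f \<noteq> 0 \<and> (\<forall>i. coeff f i \<in> Qp) \<and> poly f x = 0}"

locale padic_complex_field =
  fixes p :: nat and v :: "'a::{field_char_0, complete_space} \<Rightarrow> ereal"
  assumes prime_p: "prime p"
    and v_eq_infinity_iff: "v x = \<infinity> \<longleftrightarrow> x = 0"
    and v_not_minus_infinity: "v x \<noteq> -\<infinity>"
    and v_mult: "v (x * y) = v x + v y"
    and v_add: "min (v x) (v y) \<le> v (x + y)"
    and v_p: "v (of_nat p) = 1"
    and dist_eq: "dist x y = (if x = y then 0 else real p powr (- real_of_ereal (v (x - y))))"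
    and Qp_bar_alg_closed:
      "degree (f :: 'a poly) > 0 \<Longrightarrow> (\<forall>i. coeff f i \<in> Qp_bar) \<Longrightarrow> \<exists>z\<in>Qp_bar. poly f z = 0"
    and Qp_bar_dense: "closure (Qp_bar :: 'a set) = UNIV"

section \<open>Finite extensions of \<open>\<rat>\<^sub>p\<close>\<close>

definition finite_extension_Qp :: "'a::{field_char_0, topological_space} set \<Rightarrow> bool" where
  "finite_extension_Qp K \<longleftrightarrow>
     Qp \<subseteq> K \<and> K \<subseteq> Qp_bar \<and>
     (\<forall>x\<in>K. \<forall>y\<in>K. x + y \<in> K \<and> x * y \<in> K) \<and> (\<forall>x\<in>K. - x \<in> K \<and> inverse x \<in> K) \<and>
     (\<exists>B. finite B \<and> B \<subseteq> K \<and> (\<forall>x\<in>K. \<exists>c. (\<forall>b\<in>B. c b \<in> Qp) \<and> x = (\<Sum>b\<in>B. c b * b)))"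

definition val_ring :: "('a::field \<Rightarrow> ereal) \<Rightarrow> 'a set \<Rightarrow> 'a set" where
  "val_ring v K = {x \<in> K. v x \<ge> 0}"

definition max_ideal :: "('a::field \<Rightarrow> ereal) \<Rightarrow> 'a set \<Rightarrow> 'a set" where
  "max_ideal v K = {x \<in> K. v x > 0}"

primrec max_ideal_power :: "('a::field \<Rightarrow> ereal) \<Rightarrow> 'a set \<Rightarrow> nat \<Rightarrow> 'a set" where
  "max_ideal_power v K 0 = val_ring v K"
| "max_ideal_power v K (Suc n) =
     {(\<Sum>j<k. a j * b j) | (k :: nat) a b.
        \<forall>j<k. a j \<in> max_ideal v K \<and> b j \<in> max_ideal_power v K n}"

definition residue_card :: "('a::field \<Rightarrow> ereal) \<Rightarrow> 'a set \<Rightarrow> nat" where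
  "residue_card v K =
     card (val_ring v K //
       {(x, y). x \<in> val_ring v K \<and> y \<in> val_ring v K \<and> x - y \<in> max_ideal v K})"

definition uniformiser :: "('a::field \<Rightarrow> ereal) \<Rightarrow> 'a set \<Rightarrow> 'a \<Rightarrow> bool" where
  "uniformiser v K \<pi> \<longleftrightarrow> max_ideal v K = (\<lambda>x. \<pi> * x) ` val_ring v K"

section \<open>Lubin-Tate series and coherent sets of roots\<close>

definition fps_over :: "'a::zero set \<Rightarrow> 'a fps set" where
  "fps_over R = {f. \<forall>i. f $ i \<in> R}"

definition lubin_tate_series ::
    "('a::field \<Rightarrow> ereal) \<Rightarrow> 'a set \<Rightarrow> 'a \<Rightarrow> 'a fps \<Rightarrow> bool" where
  "lubin_tate_series v K \<pi> P \<longleftrightarrow>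
     P \<in> fps_over (val_ring v K) \<and>
     (\<exists>G\<in>fps_over (val_ring v K). P - fps_const \<pi> * fps_X = fps_X ^ 2 * G) \<and>
     (\<exists>G\<in>fps_over (val_ring v K). P - fps_X ^ residue_card v K = fps_const \<pi> * G)"

text \<open>The library's \<open>eval_fps\<close> is restricted to real normed algebras.\<close>

definition fps_value :: "'a::{field_char_0, topological_space} fps \<Rightarrow> 'a \<Rightarrow> 'a" where
  "fps_value f x = (\<Sum>k. f $ k * x ^ k)"

definition coherent_roots ::
    "('a::{field_char_0, topological_space} \<Rightarrow> ereal) \<Rightarrow> 'a fps \<Rightarrow> (nat \<Rightarrow> 'a) \<Rightarrow> bool" where
  "coherent_roots v Q \<omega> \<longleftrightarrow>
     (\<forall>i\<ge>1. \<omega> i \<in> Qp_bar \<and> v (\<omega> i) > 0) \<and>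
     \<omega> 1 \<noteq> 0 \<and> fps_value Q (\<omega> 1) = 0 \<and>
     (\<forall>i\<ge>1. fps_value Q (\<omega> (i + 1)) = \<omega> i)"

definition fps_iterate :: "'a::field fps \<Rightarrow> nat \<Rightarrow> 'a fps" where
  "fps_iterate P i = ((\<lambda>G. P oo G) ^^ i) fps_X"

definition primitive_division_point ::
    "('a::{field_char_0, topological_space} \<Rightarrow> ereal) \<Rightarrow> 'a fps \<Rightarrow> nat \<Rightarrow> 'a \<Rightarrow> bool" where
  "primitive_division_point v P m \<omega> \<longleftrightarrow>
     v \<omega> > 0 \<and> fps_value (fps_iterate P m) \<omega> = 0 \<and> fps_value (fps_iterate P (m - 1)) \<omega> \<noteq> 0"

section \<open>Formal groups\<close>

text \<open>
  A series in \<open>X, Y\<close> is an element \<open>F\<close> of \<open>'a fps fps\<close>, with \<open>F $ i $ j\<close> the coefficient of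
  \<open>X\<^sup>i Y\<^sup>j\<close>.  All identities between series are stated in three variables \<open>X, Y, Z\<close>, in
  \<open>'a fps fps fps\<close>, with \<open>A $ i $ j $ k\<close> the coefficient of \<open>X\<^sup>i Y\<^sup>j Z\<^sup>k\<close>.  The operation
  \<open>oo\<close> on nested series only looks at the constant term in the outermost variable, so it is not
  the substitution needed here.  In the two substitutions below, the substituted series must
  have zero constant term; then a product of more than \<open>i + j + k\<close> of them does not contribute
  to the coefficient of \<open>X\<^sup>i Y\<^sup>j Z\<^sup>k\<close>, and the sums may be cut off there.
\<close>

definition subst1 :: "'a::field fps \<Rightarrow> 'a fps fps fps \<Rightarrow> 'a fps fps fps" where
  "subst1 f A = Abs_fps (\<lambda>i. Abs_fps (\<lambda>j. Abs_fps (\<lambda>k.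
     \<Sum>a\<le>i + j + k. f $ a * (A ^ a) $ i $ j $ k)))"

definition subst2 ::
    "'a::field fps fps \<Rightarrow> 'a fps fps fps \<Rightarrow> 'a fps fps fps \<Rightarrow> 'a fps fps fps" where
  "subst2 F A B = Abs_fps (\<lambda>i. Abs_fps (\<lambda>j. Abs_fps (\<lambda>k.
     \<Sum>a\<le>i + j + k. \<Sum>b\<le>i + j + k. F $ a $ b * (A ^ a * B ^ b) $ i $ j $ k)))"

abbreviation var_X :: "'a::field fps fps fps" where
  "var_X \<equiv> fps_X"

abbreviation var_Y :: "'a::field fps fps fps" where
  "var_Y \<equiv> fps_const fps_X"

abbreviation var_Z :: "'a::field fps fps fps" where
  "var_Z \<equiv> fps_const (fps_const fps_X)"

definition formal_group :: "('a::field \<Rightarrow> ereal) \<Rightarrow> 'a set \<Rightarrow> 'a fps fps \<Rightarrow> bool" where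
  "formal_group v K F \<longleftrightarrow>
     (\<forall>i j. F $ i $ j \<in> val_ring v K) \<and>
     F $ 0 $ 0 = 0 \<and> F $ 1 $ 0 = 1 \<and> F $ 0 $ 1 = 1 \<and>
     subst2 F var_X (subst2 F var_Y var_Z) = subst2 F (subst2 F var_X var_Y) var_Z \<and>
     subst2 F var_X var_Y = subst2 F var_Y var_X"

definition lubin_tate_formal_group ::
    "('a::field \<Rightarrow> ereal) \<Rightarrow> 'a set \<Rightarrow> 'a fps \<Rightarrow> 'a fps fps \<Rightarrow> bool" where
  "lubin_tate_formal_group v K P F \<longleftrightarrow>
     formal_group v K F \<and>
     subst1 P (subst2 F var_X var_Y) = subst2 F (subst1 P var_X) (subst1 P var_Y)"

definition formal_group_exp :: "'a::field set \<Rightarrow> 'a fps fps \<Rightarrow> 'a fps \<Rightarrow> bool" where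
  "formal_group_exp K F e \<longleftrightarrow>
     e \<in> fps_over K \<and> e $ 0 = 0 \<and> e $ 1 = 1 \<and>
     subst1 e (var_X + var_Y) = subst2 F (subst1 e var_X) (subst1 e var_Y)"

text \<open>
  The series \<open>\<E>\<close>, where \<open>e\<close> is the exponential of the formal group of \<open>P\<close>, \<open>\<pi>\<close> the uniformiser
  of \<open>P\<close>, \<open>q\<close> the residue cardinality and \<open>\<omega>\<close> the coherent set of roots of \<open>Q\<close>.
\<close>

definition dwork_series ::
    "'a::field fps \<Rightarrow> 'a \<Rightarrow> nat \<Rightarrow> (nat \<Rightarrow> 'a) \<Rightarrow> nat \<Rightarrow> 'a fps" where
  "dwork_series e \<pi> q \<omega> m =
     e oo (\<Sum>i<m. fps_const (\<omega> (m - i) / \<pi> ^ i) * (fps_X ^ (q ^ i) - fps_X ^ (q ^ (i + 1))))"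

end

theory Submission
  imports Defs "HOL-Algebra.Sylow" "HOL-Algebra.Multiplicative_Group"
begin

text \<open>
  Suppose first that \<open>\<pi>' = \<pi>\<close>, write \<open>Q\<^sup>i\<close> for the \<open>i\<close>-th iterate of \<open>Q\<close>, and replace
  \<open>\<omega>\<^sub>m\<^sub>-\<^sub>i\<close> in the exponent of \<open>\<E>\<^sub>m\<close> by \<open>Q\<^sup>i(T)\<close>. This gives
  \<open>S(X,T) = \<Sum>\<^sub>i Q\<^sup>i(T)/\<pi>\<^sup>i (X\<^bsup>q^i\<^esup> - X\<^bsup>q^(i+1)\<^esup>)\<close>, which specialises to the exponent of
  \<open>\<E>\<^sub>m\<close> at \<open>T = \<omega>\<^sub>m\<close> and satisfies \<open>S(X,T) - S(X\<^sup>q,Q(T))/\<pi> = T(X - X\<^sup>q)\<close>. By the functional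
  equation lemma for the logarithm of the formal group, \<open>E = exp\<^sub>F(S)\<close> has integral coefficients.

  Since \<open>Q\<^sup>i/\<pi>\<^sup>i\<close> converges coefficientwise to the logarithm \<open>\<Lambda>\<close> attached to \<open>Q\<close>, the
  coefficient of each \<open>T\<^sup>k\<close> in \<open>S\<close>, hence in \<open>E\<close>, is a series in \<open>X\<close> whose coefficients tend
  to \<open>0\<close>, and the sum telescopes: \<open>S(1,T) = \<Lambda>(T)\<close>. So \<open>E(1,T) = exp\<^sub>F(\<Lambda>(T))\<close> is an integral
  series \<open>T + \<dots>\<close> that intertwines \<open>Q\<close> and \<open>P\<close>, and \<open>\<E>\<^sub>m(1)\<close> is its value at \<open>\<omega>\<^sub>m\<close>. It therefore
  carries the roots of \<open>Q\<close> to those of \<open>P\<close>.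

  If only \<open>\<pi> \<equiv> \<pi>'\<close> modulo \<open>\<P>\<^bsup>n+1\<^esup>\<close>, replace \<open>Q\<close> by \<open>Q + (\<pi> - \<pi>')/\<pi>'\<^sup>m Q\<^sup>m\<close>, which is a
  Lubin-Tate series for \<open>\<pi>\<close> with the same values at \<open>\<omega>\<^sub>1, \<dots>, \<omega>\<^sub>m\<close>.

  Series in \<open>X\<close> and \<open>T\<close> are elements of \<open>'a fps fps\<close> with \<open>X\<close> the outer and \<open>T\<close> the inner
  variable.
\<close>

section \<open>Ultrametric fields\<close>

text \<open>The functional equation lemma needs a ring endomorphism lifting the q-power map modulo
  \<open>\<pi>\<close>. No automorphism over K takes \<open>\<omega>\<^sub>m\<close> to
  \<open>\<omega>\<^sub>m\<^sub>-\<^sub>1\<close>, because their valuations differ. On power series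
  in T over the valuation ring, however, substituting Q(T) for T is such a lift, since Q is
  congruent to T^q. This is why the root is replaced by a variable. The exponent of the Dwork series
  is 0 at X = 1, and exp_F converges only on a small disc, so X = 1 may be inserted only after
  expansion. Integrality of E bounds the double series by powers of \<open>\<omega>\<^sub>m\<close>,
  and the decay of each coefficient of T^k along X makes it summable in either order; the exchange
  of the two summations is what identifies the value with E(1,T) at \<open>\<omega>\<^sub>m\<close>.
  The formal group enters through the single identity P(exp_F(X)) = exp_F(\<open>\<pi>\<close> X),
  obtained from a differential equation. That the new roots are algebraic over \<open>Qp\<close>
  rests on the local compactness of finite extensions: it makes the valuation ring closed, so E(1,T)
  has coefficients in it, and makes the field generated by a root closed as well.\<close>

locale ultrametric_field =
  fixes nrm :: "'a::{field_char_0, complete_space} \<Rightarrow> real"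
  assumes dist_nrm: "dist x y = nrm (x - y)"
    and nrm_mult: "nrm (x * y) = nrm x * nrm y"
    and nrm_add: "nrm (x + y) \<le> max (nrm x) (nrm y)"
begin

lemma nrm_ge_0 [simp]: "nrm x \<ge> 0"
  by (metis dist_nrm diff_zero zero_le_dist)

lemma nrm_eq_0 [simp]: "nrm x = 0 \<longleftrightarrow> x = 0"
  by (metis dist_nrm diff_zero dist_eq_0_iff)

lemma nrm_0 [simp]: "nrm 0 = 0"
  by simp

lemma nrm_1 [simp]: "nrm 1 = 1"
  using nrm_mult[of 1 1] nrm_eq_0[of 1] by (simp del: nrm_eq_0)

lemma nrm_minus [simp]: "nrm (- x) = nrm x"
  by (metis dist_nrm diff_0 dist_commute diff_zero)

lemma nrm_diff_commute: "nrm (x - y) = nrm (y - x)"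
  by (metis nrm_minus minus_diff_eq)

lemma nrm_diff: "nrm (x - y) \<le> max (nrm x) (nrm y)"
  using nrm_add[of x "- y"] by simp

lemma nrm_triangle: "nrm (x - z) \<le> max (nrm (x - y)) (nrm (y - z))"
  using nrm_add[of "x - y" "y - z"] by simp

lemma nrm_power: "nrm (x ^ n) = nrm x ^ n"
  by (induction n) (simp_all add: nrm_mult)

lemma nrm_inverse: "nrm (inverse x) = inverse (nrm x)"
proof (cases "x = 0")
  case False
  then have "nrm x * nrm (inverse x) = 1"
    by (simp flip: nrm_mult)
  then show ?thesis
    by (simp only: inverse_unique)
qed simp

lemma nrm_divide: "nrm (x / y) = nrm x / nrm y"
  by (simp add: divide_inverse nrm_mult nrm_inverse)

lemma nrm_add_le: "nrm x \<le> C \<Longrightarrow> nrm y \<le> C \<Longrightarrow> nrm (x + y) \<le> C"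
  using nrm_add[of x y] by linarith

lemma nrm_diff_le: "nrm x \<le> C \<Longrightarrow> nrm y \<le> C \<Longrightarrow> nrm (x - y) \<le> C"
  using nrm_diff[of x y] by linarith

lemma nrm_triangle_le: "nrm (x - y) \<le> C \<Longrightarrow> nrm (y - z) \<le> C \<Longrightarrow> nrm (x - z) \<le> C"
  using nrm_triangle[of x z y] by linarith

lemma nrm_triangle_less: "nrm (x - y) < C \<Longrightarrow> nrm (y - z) < C \<Longrightarrow> nrm (x - z) < C"
  using nrm_triangle[of x z y] by linarith

lemma nrm_add_less: "nrm x < C \<Longrightarrow> nrm y < C \<Longrightarrow> nrm (x + y) < C"
  using nrm_add[of x y] by linarith

lemma nrm_sum_le: "(\<And>i. i \<in> I \<Longrightarrow> nrm (f i) \<le> C) \<Longrightarrow> C \<ge> 0 \<Longrightarrow> nrm (sum f I) \<le> C"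
  by (induction I rule: infinite_finite_induct) (auto intro: nrm_add_le)

text \<open>Since x is the difference of x + y and y, the strong triangle inequality also bounds
  \<open>nrm x\<close>, and y is too small to attain that bound.\<close>

lemma nrm_add_eq: "nrm y < nrm x \<Longrightarrow> nrm (x + y) = nrm x"
  using nrm_add[of x y] nrm_diff[of "x + y" y] by simp

section \<open>Limits and convergent series in terms of the norm\<close>

lemma tendsto_nrm_iff: "(f \<longlongrightarrow> l) F \<longleftrightarrow> ((\<lambda>n. nrm (f n - l)) \<longlongrightarrow> 0) F"
  unfolding tendsto_dist_iff[of f l] dist_nrm ..

lemma tendsto_0_iff: "(f \<longlongrightarrow> 0) F \<longleftrightarrow> ((\<lambda>n. nrm (f n)) \<longlongrightarrow> 0) F"
  using tendsto_nrm_iff[of f 0] by simp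

lemma LIMSEQ_nrm_iff: "f \<longlonglongrightarrow> l \<longleftrightarrow> (\<forall>\<epsilon>>0. \<exists>N. \<forall>n\<ge>N. nrm (f n - l) < \<epsilon>)"
  by (simp add: lim_sequentially dist_nrm)

lemma Cauchy_nrm_iff: "Cauchy f \<longleftrightarrow> (\<forall>\<epsilon>>0. \<exists>N. \<forall>m\<ge>N. \<forall>n\<ge>N. nrm (f m - f n) < \<epsilon>)"
  by (simp add: Cauchy_def dist_nrm)

text \<open>The sort of \<open>'a\<close> relates metric and field operations in no way, so the
  limit laws are derived from the axioms of the norm.\<close>

lemma ultra_tendsto_add:
  fixes f g :: "'b \<Rightarrow> 'a"
  assumes "(f \<longlongrightarrow> a) F" "(g \<longlongrightarrow> b) F"
  shows "((\<lambda>n. f n + g n) \<longlongrightarrow> a + b) F"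
  unfolding tendsto_nrm_iff
proof (rule tendsto_sandwich[where f = "\<lambda>_. 0"])
  show "\<forall>\<^sub>F n in F. nrm (f n + g n - (a + b)) \<le> max (nrm (f n - a)) (nrm (g n - b))"
    using nrm_add by (simp add: add_diff_add)
  show "((\<lambda>n. max (nrm (f n - a)) (nrm (g n - b))) \<longlongrightarrow> 0) F"
    using tendsto_max[OF assms[unfolded tendsto_nrm_iff]] by simp
qed simp_all

lemma ultra_tendsto_mult_0:
  assumes "(f \<longlongrightarrow> 0) F" "\<And>n. nrm (g n) \<le> C"
  shows "((\<lambda>n. g n * f n) \<longlongrightarrow> 0) F"
  unfolding tendsto_0_iff
proof (rule tendsto_sandwich[where f = "\<lambda>_. 0"])
  show "\<forall>\<^sub>F n in F. nrm (g n * f n) \<le> C * nrm (f n)"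
    using assms(2) by (simp add: nrm_mult mult_right_mono)
  show "((\<lambda>n. C * nrm (f n)) \<longlongrightarrow> 0) F"
    using tendsto_mult_right_zero[OF assms(1)[unfolded tendsto_0_iff]] by simp
qed simp_all

lemma ultra_tendsto_mult:
  fixes f g :: "'b \<Rightarrow> 'a"
  assumes "(f \<longlongrightarrow> a) F" "(g \<longlongrightarrow> b) F"
  shows "((\<lambda>n. f n * g n) \<longlongrightarrow> a * b) F"
  unfolding tendsto_nrm_iff
proof (rule tendsto_sandwich[where f = "\<lambda>_. 0"])
  have f: "((\<lambda>n. nrm (f n - a)) \<longlongrightarrow> 0) F" and g: "((\<lambda>n. nrm (g n - b)) \<longlongrightarrow> 0) F"
    using assms by (simp_all add: tendsto_nrm_iff)
  show "((\<lambda>n. max (nrm (f n - a) * nrm (g n - b)) (max (nrm (f n - a) * nrm b) (nrm a * nrm (g n - b)))) \<longlongrightarrow> 0) F"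
    using tendsto_max[OF tendsto_mult[OF f g]
        tendsto_max[OF tendsto_mult_left_zero[OF f, of "nrm b"] tendsto_mult_right_zero[OF g, of "nrm a"]]]
    by simp
  have "nrm (f n * g n - a * b) \<le> max (nrm (f n - a) * nrm (g n - b)) (max (nrm (f n - a) * nrm b) (nrm a * nrm (g n - b)))" for n
  proof -
    have "f n * g n - a * b = (f n - a) * (g n - b) + ((f n - a) * b + a * (g n - b))"
      by (simp add: algebra_simps)
    then show ?thesis
      using nrm_add[of "(f n - a) * (g n - b)" "(f n - a) * b + a * (g n - b)"]
        nrm_add[of "(f n - a) * b" "a * (g n - b)"]
      by (simp add: nrm_mult)
  qed
  then show "\<forall>\<^sub>F n in F. nrm (f n * g n - a * b) \<le> max (nrm (f n - a) * nrm (g n - b)) (max (nrm (f n - a) * nrm b) (nrm a * nrm (g n - b)))"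
    by simp
qed simp_all

lemma ultra_tendsto_cmult:
  fixes f :: "'b \<Rightarrow> 'a"
  assumes "(f \<longlongrightarrow> a) F"
  shows "((\<lambda>n. c * f n) \<longlongrightarrow> c * a) F"
  by (rule ultra_tendsto_mult[OF tendsto_const assms])

lemma ultra_tendsto_diff:
  fixes f g :: "'b \<Rightarrow> 'a"
  assumes "(f \<longlongrightarrow> a) F" "(g \<longlongrightarrow> b) F"
  shows "((\<lambda>n. f n - g n) \<longlongrightarrow> a - b) F"
  using ultra_tendsto_add[OF assms(1) ultra_tendsto_cmult[OF assms(2), of "-1"]] by simp

lemma ultra_tendsto_sum:
  fixes f :: "'i \<Rightarrow> 'b \<Rightarrow> 'a"
  assumes "\<And>i. i \<in> I \<Longrightarrow> (f i \<longlongrightarrow> a i) F"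
  shows "((\<lambda>n. \<Sum>i\<in>I. f i n) \<longlongrightarrow> (\<Sum>i\<in>I. a i)) F"
  using assms by (induction I rule: infinite_finite_induct) (auto intro!: ultra_tendsto_add)

lemma ultra_tendsto_nrm_le:
  assumes "f \<longlonglongrightarrow> a" "\<forall>\<^sub>F n in sequentially. nrm (f n) \<le> C"
  shows "nrm a \<le> C"
proof (rule field_le_epsilon)
  fix \<epsilon> :: real assume "\<epsilon> > 0"
  with assms(1) have "\<forall>\<^sub>F n in sequentially. nrm (f n - a) < \<epsilon>"
    by (simp add: tendsto_iff dist_nrm)
  with assms(2) have "\<forall>\<^sub>F n in sequentially. nrm (f n) \<le> C \<and> nrm (f n - a) < \<epsilon>"
    by (rule eventually_conj)
  then obtain n where n: "nrm (f n) \<le> C" "nrm (f n - a) < \<epsilon>"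
    using eventually_happens'[OF sequentially_bot] by blast
  have "nrm a \<le> max (nrm (f n)) (nrm (f n - a))"
    using nrm_diff[of "f n" "f n - a"] by simp
  with n \<open>\<epsilon> > 0\<close> nrm_ge_0[of "f n"] show "nrm a \<le> C + \<epsilon>"
    by linarith
qed

text \<open>The difference of two distant terms is a sum of consecutive differences, hence no larger
  than the largest of them. So a series converges as soon as its terms tend to 0.\<close>

lemma ultra_Cauchy:
  fixes f :: "nat \<Rightarrow> 'a"
  assumes "(\<lambda>n. f (Suc n) - f n) \<longlonglongrightarrow> 0"
  shows "Cauchy f"
  unfolding Cauchy_nrm_iff
proof (intro allI impI)
  fix \<epsilon> :: real assume "\<epsilon> > 0"
  with assms obtain N where N: "\<And>n. n \<ge> N \<Longrightarrow> nrm (f (Suc n) - f n) < \<epsilon> / 2"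
    unfolding LIMSEQ_nrm_iff by (metis diff_zero half_gt_zero)
  have *: "nrm (f (N + k) - f N) \<le> \<epsilon> / 2" for k
  proof (induction k)
    case (Suc k)
    then show ?case
      using nrm_triangle[of "f (N + Suc k)" "f N" "f (N + k)"] N[of "N + k"] by simp
  qed (use \<open>\<epsilon> > 0\<close> in simp)
  show "\<exists>N. \<forall>m\<ge>N. \<forall>n\<ge>N. nrm (f m - f n) < \<epsilon>"
  proof (intro exI[of _ N] allI impI)
    fix m n assume "m \<ge> N" "n \<ge> N"
    with *[of "m - N"] *[of "n - N"] have "nrm (f m - f N) \<le> \<epsilon> / 2" "nrm (f N - f n) \<le> \<epsilon> / 2"
      by (simp_all add: nrm_diff_commute)
    with nrm_triangle[of "f m" "f n" "f N"] \<open>\<epsilon> > 0\<close> show "nrm (f m - f n) < \<epsilon>"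
      by linarith
  qed
qed

lemma ultra_sums:
  fixes u :: "nat \<Rightarrow> 'a"
  assumes "u \<longlonglongrightarrow> 0"
  shows "u sums suminf u"
proof -
  have "Cauchy (\<lambda>n. sum u {..<n})"
    using assms by (intro ultra_Cauchy) simp
  then obtain s where "u sums s"
    unfolding sums_def using Cauchy_convergent convergentD by blast
  then show ?thesis
    by (simp add: sums_iff)
qed

lemma suminf_nrm_le:
  assumes "u \<longlonglongrightarrow> 0" "\<And>k. nrm (u k) \<le> C"
  shows "nrm (suminf u) \<le> C"
  using ultra_sums[OF assms(1)] unfolding sums_def
proof (rule ultra_tendsto_nrm_le)
  have "C \<ge> 0"
    using assms(2)[of 0] nrm_ge_0 order_trans by blast
  then show "\<forall>\<^sub>F n in sequentially. nrm (sum u {..<n}) \<le> C"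
    using assms(2) by (simp add: nrm_sum_le)
qed

lemma suminf_minus_sum_nrm_le:
  assumes "u \<longlonglongrightarrow> 0" "\<And>k. k \<ge> N \<Longrightarrow> nrm (u k) \<le> C" "C \<ge> 0"
  shows "nrm (suminf u - sum u {..<N}) \<le> C"
proof (rule ultra_tendsto_nrm_le)
  show "(\<lambda>n. sum u {..<n} - sum u {..<N}) \<longlonglongrightarrow> suminf u - sum u {..<N}"
    using ultra_sums[OF assms(1)] unfolding sums_def
    by (rule ultra_tendsto_diff) simp
  have "nrm (sum u {..<n} - sum u {..<N}) \<le> C" if "n \<ge> N" for n
  proof -
    have "sum u {..<n} - sum u {..<N} = sum u {N..<n}"
      using sum_diff_nat_ivl[of 0 N n u] that by (simp add: atLeast0LessThan)
    then show ?thesis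
      using assms by (auto intro!: nrm_sum_le)
  qed
  then show "\<forall>\<^sub>F n in sequentially. nrm (sum u {..<n} - sum u {..<N}) \<le> C"
    by (auto simp: eventually_sequentially)
qed

lemma ultra_sums_sum:
  fixes f :: "'i \<Rightarrow> nat \<Rightarrow> 'a"
  assumes "\<And>i. i \<in> I \<Longrightarrow> f i sums a i"
  shows "(\<lambda>j. \<Sum>i\<in>I. f i j) sums (\<Sum>i\<in>I. a i)"
  using ultra_tendsto_sum[of I "\<lambda>i n. sum (f i) {..<n}" a sequentially] assms
  by (simp add: sums_def sum.swap[of _ I])

lemma ultra_sums_cmult: "f sums a \<Longrightarrow> (\<lambda>j. b * f j) sums (b * a :: 'a)"
  using ultra_tendsto_cmult[of "\<lambda>n. sum f {..<n}" a sequentially b] by (simp add: sums_def sum_distrib_left)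

text \<open>Outside a finite square all entries are small. This takes the place of absolute
  summability in the exchange of two summations.\<close>

definition doubly_null :: "(nat \<Rightarrow> nat \<Rightarrow> 'a) \<Rightarrow> bool" where
  "doubly_null u \<longleftrightarrow> (\<forall>\<epsilon>>0. \<exists>N. \<forall>j k. j \<ge> N \<or> k \<ge> N \<longrightarrow> nrm (u j k) \<le> \<epsilon>)"

lemma doubly_null_swap: "doubly_null u \<Longrightarrow> doubly_null (\<lambda>j k. u k j)"
  unfolding doubly_null_def by meson

lemma LIMSEQ_0_leI:
  assumes "\<And>\<epsilon>. \<epsilon> > 0 \<Longrightarrow> \<exists>N. \<forall>n\<ge>N. nrm (f n) \<le> \<epsilon>"
  shows "f \<longlonglongrightarrow> 0"
  unfolding LIMSEQ_nrm_iff
proof (intro allI impI)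
  fix \<epsilon> :: real assume "\<epsilon> > 0"
  with assms[of "\<epsilon> / 2"] obtain N where "\<forall>n\<ge>N. nrm (f n) \<le> \<epsilon> / 2" by auto
  with \<open>\<epsilon> > 0\<close> show "\<exists>N. \<forall>n\<ge>N. nrm (f n - 0) < \<epsilon>"
    by (intro exI[of _ N]) fastforce
qed

lemma LIMSEQ_0_leD: "f \<longlonglongrightarrow> 0 \<Longrightarrow> \<epsilon> > 0 \<Longrightarrow> \<exists>N. \<forall>n\<ge>N. nrm (f n) \<le> \<epsilon>"
  unfolding LIMSEQ_nrm_iff by (metis diff_zero less_imp_le)

lemma doubly_null_row: "doubly_null u \<Longrightarrow> u j \<longlonglongrightarrow> 0"
  by (rule LIMSEQ_0_leI) (metis doubly_null_def)

lemma doubly_null_suminf: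
  assumes "doubly_null u"
  shows "(\<lambda>j. suminf (u j)) \<longlonglongrightarrow> 0"
proof (rule LIMSEQ_0_leI)
  fix \<epsilon> :: real assume "\<epsilon> > 0"
  with assms obtain N where "\<forall>j k. j \<ge> N \<or> k \<ge> N \<longrightarrow> nrm (u j k) \<le> \<epsilon>"
    unfolding doubly_null_def by blast
  then show "\<exists>N. \<forall>n\<ge>N. nrm (suminf (u n)) \<le> \<epsilon>"
    using suminf_nrm_le[OF doubly_null_row[OF assms]] by blast
qed

lemma suminf_suminf_approx:
  assumes "doubly_null u" "\<forall>j k. j \<ge> N \<or> k \<ge> N \<longrightarrow> nrm (u j k) \<le> \<epsilon>" "\<epsilon> \<ge> 0"
  shows "nrm ((\<Sum>j. suminf (u j)) - (\<Sum>j<N. \<Sum>k<N. u j k)) \<le> \<epsilon>"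
proof -
  have "nrm ((\<Sum>j. suminf (u j)) - (\<Sum>j<N. suminf (u j))) \<le> \<epsilon>"
    using doubly_null_suminf[OF assms(1)] suminf_nrm_le[OF doubly_null_row[OF assms(1)]] assms(2,3)
    by (intro suminf_minus_sum_nrm_le) auto
  moreover have "nrm ((\<Sum>j<N. suminf (u j)) - (\<Sum>j<N. \<Sum>k<N. u j k)) \<le> \<epsilon>"
    unfolding sum_subtractf[symmetric]
    using assms doubly_null_row[OF assms(1)] by (intro nrm_sum_le suminf_minus_sum_nrm_le) auto
  ultimately show ?thesis
    by (rule nrm_triangle_le)
qed

text \<open>Both iterated sums lie within \<open>\<epsilon>\<close> of the sum over the same finite
  square.\<close>

lemma suminf_swap:
  assumes "doubly_null u"
  shows "(\<Sum>j. \<Sum>k. u j k) = (\<Sum>k. \<Sum>j. u j k)"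
proof -
  have "nrm ((\<Sum>j. \<Sum>k. u j k) - (\<Sum>k. \<Sum>j. u j k)) \<le> \<epsilon>" if "\<epsilon> > 0" for \<epsilon> :: real
  proof -
    from that assms obtain N where N: "\<forall>j k. j \<ge> N \<or> k \<ge> N \<longrightarrow> nrm (u j k) \<le> \<epsilon>"
      unfolding doubly_null_def by blast
    have "nrm ((\<Sum>j. \<Sum>k. u j k) - (\<Sum>j<N. \<Sum>k<N. u j k)) \<le> \<epsilon>"
      using suminf_suminf_approx[OF assms N] that by simp
    moreover have "nrm ((\<Sum>j<N. \<Sum>k<N. u j k) - (\<Sum>k. \<Sum>j. u j k)) \<le> \<epsilon>"
      using suminf_suminf_approx[OF doubly_null_swap[OF assms], of N \<epsilon>] N that
        sum.swap[of "\<lambda>j k. u j k" "{..<N}" "{..<N}"]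
      by (simp add: nrm_diff_commute)
    ultimately show ?thesis
      by (rule nrm_triangle_le)
  qed
  then have "nrm ((\<Sum>j. \<Sum>k. u j k) - (\<Sum>k. \<Sum>j. u j k)) \<le> 0"
    by (rule field_le_epsilon) simp
  then show ?thesis
    by (metis nrm_eq_0 nrm_ge_0 antisym right_minus_eq)
qed

text \<open>The indices i and n - i add up to n, so for large n one of the two factors is small,
  while the other is bounded because a null sequence is bounded.\<close>

lemma null_Cauchy_product_doubly_null:
  assumes "f \<longlonglongrightarrow> 0" "g \<longlonglongrightarrow> 0"
  shows "doubly_null (\<lambda>i n. if i \<le> n then f i * g (n - i) else 0)"
  unfolding doubly_null_def
proof (intro allI impI)
  fix \<epsilon> :: real assume e: "\<epsilon> > 0"
  have bdd: "\<exists>C>0. \<forall>n. nrm (h n) \<le> C" if h: "h \<longlonglongrightarrow> 0" for h :: "nat \<Rightarrow> 'a"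
  proof -
    obtain N where N: "\<forall>n\<ge>N. nrm (h n) \<le> 1"
      using LIMSEQ_0_leD[OF h, of 1] by auto
    have "nrm (h n) \<le> 1 + (\<Sum>k<N. nrm (h k))" for n
    proof (cases "n < N")
      case True
      then have "nrm (h n) \<le> (\<Sum>k<N. nrm (h k))"
        by (simp add: member_le_sum[where f = "\<lambda>k. nrm (h k)"])
      then show ?thesis by simp
    next
      case False
      with N have "nrm (h n) \<le> 1" by simp
      moreover have "0 \<le> (\<Sum>k<N. nrm (h k))" by (intro sum_nonneg) auto
      ultimately show ?thesis by linarith
    qed
    moreover have "1 + (\<Sum>k<N. nrm (h k)) > 0" by (intro add_pos_nonneg sum_nonneg) auto
    ultimately show "\<exists>C>0. \<forall>n. nrm (h n) \<le> C"
      by (intro exI[of _ "1 + (\<Sum>k<N. nrm (h k))"]) simp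
  qed
  obtain C where C: "C > 0" "\<And>n. nrm (f n) \<le> C"
    using bdd[OF assms(1)] by blast
  obtain D where D: "D > 0" "\<And>n. nrm (g n) \<le> D"
    using bdd[OF assms(2)] by blast
  obtain M where M: "\<And>n. n \<ge> M \<Longrightarrow> nrm (f n) \<le> \<epsilon> / D"
    using LIMSEQ_0_leD[OF assms(1) divide_pos_pos[OF e D(1)]] by blast
  obtain N where N: "\<And>n. n \<ge> N \<Longrightarrow> nrm (g n) \<le> \<epsilon> / C"
    using LIMSEQ_0_leD[OF assms(2) divide_pos_pos[OF e C(1)]] by blast
  have "nrm (f i) * nrm (g j) \<le> \<epsilon>" if "i \<ge> M \<or> j \<ge> N" for i j
  proof (cases "i \<ge> M")
    case True
    then have "nrm (f i) * nrm (g j) \<le> \<epsilon> / D * D"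
      using M D e by (intro mult_mono) auto
    then show ?thesis using D by simp
  next
    case False
    then have "nrm (f i) * nrm (g j) \<le> C * (\<epsilon> / C)"
      using N C e that by (intro mult_mono) (auto intro: less_imp_le)
    then show ?thesis using C by simp
  qed
  moreover have "M \<le> j \<or> N \<le> k - j" if "j \<le> k" "M + N \<le> k" for j k
    using that by linarith
  ultimately show "\<exists>N. \<forall>j k. N \<le> j \<or> N \<le> k \<longrightarrow> nrm (if j \<le> k then f j * g (k - j) else 0) \<le> \<epsilon>"
    using e by (intro exI[of _ "M + N"]) (auto simp: nrm_mult)
qed

text \<open>In the triangular array \<open>u\<close>, the sums over i are the coefficients of the
  Cauchy product and the sums over n are \<open>f i * suminf g\<close>; the exchange of summations
  compares them.\<close>

lemma null_Cauchy_product: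
  fixes f g :: "nat \<Rightarrow> 'a"
  assumes f: "f \<longlonglongrightarrow> 0" and g: "g \<longlonglongrightarrow> 0"
  shows "(\<lambda>n. \<Sum>i\<le>n. f i * g (n - i)) \<longlonglongrightarrow> 0"
    and "(\<Sum>n. \<Sum>i\<le>n. f i * g (n - i)) = suminf f * suminf g"
proof -
  define u where "u = (\<lambda>i n. if i \<le> n then f i * g (n - i) else 0)"
  have u: "doubly_null u"
    unfolding u_def by (rule null_Cauchy_product_doubly_null[OF f g])
  have col: "(\<Sum>i. u i n) = (\<Sum>i\<le>n. f i * g (n - i))" for n
    using suminf_finite[of "{..n}" "\<lambda>i. u i n"] by (auto simp: u_def)
  have row: "suminf (u i) = f i * suminf g" for i
  proof -
    have "(\<lambda>n. sum (u i) {..<n + i}) \<longlonglongrightarrow> f i * suminf g"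
    proof -
      have "sum (u i) {..<n + i} = f i * sum g {..<n}" for n
      proof -
        have "sum (u i) {..<n + i} = sum (u i) {i..<n + i}"
          by (rule sum.mono_neutral_right) (auto simp: u_def)
        also have "\<dots> = (\<Sum>k<n. u i (k + i))"
          using sum.shift_bounds_nat_ivl[of "u i" 0 i n] by (simp add: atLeast0LessThan)
        finally show ?thesis by (simp add: u_def sum_distrib_left)
      qed
      then show ?thesis
        using ultra_tendsto_cmult[OF ultra_sums[OF g, unfolded sums_def], of "f i"] by simp
    qed
    then have "u i sums (f i * suminf g)"
      unfolding sums_def by (rule LIMSEQ_offset)
    then show ?thesis by (simp add: sums_iff)
  qed
  have fs: "(\<lambda>i. f i * suminf g) sums (suminf f * suminf g)"
    using ultra_tendsto_cmult[OF ultra_sums[OF f, unfolded sums_def], of "suminf g"]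
    by (simp add: sums_def sum_distrib_left mult.commute)
  show "(\<lambda>n. \<Sum>i\<le>n. f i * g (n - i)) \<longlonglongrightarrow> 0"
    using doubly_null_suminf[OF doubly_null_swap[OF u]] by (simp only: col)
  show "(\<Sum>n. \<Sum>i\<le>n. f i * g (n - i)) = suminf f * suminf g"
    using suminf_swap[OF u] sums_unique[OF fs] by (simp only: col row)
qed

end

section \<open>Congruences modulo a principal ideal of a subring\<close>

definition is_subring :: "'b::comm_ring_1 set \<Rightarrow> bool" where
  "is_subring A \<longleftrightarrow> 1 \<in> A \<and> (\<forall>x\<in>A. \<forall>y\<in>A. x - y \<in> A \<and> x * y \<in> A)"

definition multiples :: "'b::comm_ring_1 \<Rightarrow> 'b set \<Rightarrow> 'b set" where
  "multiples c A = (*) c ` A"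

context
  fixes A :: "'b::comm_ring_1 set"
  assumes A: "is_subring A"
begin

lemma subring_1 [simp]: "1 \<in> A"
  and subring_diff: "x \<in> A \<Longrightarrow> y \<in> A \<Longrightarrow> x - y \<in> A"
  and subring_mult: "x \<in> A \<Longrightarrow> y \<in> A \<Longrightarrow> x * y \<in> A"
  using A by (auto simp: is_subring_def)

lemma subring_0 [simp]: "0 \<in> A"
  using subring_diff[of 1 1] by simp

lemma subring_minus: "x \<in> A \<Longrightarrow> - x \<in> A"
  using subring_diff[of 0 x] by simp

lemma subring_add: "x \<in> A \<Longrightarrow> y \<in> A \<Longrightarrow> x + y \<in> A"
  using subring_diff[of x "- y"] by (simp add: subring_minus)

lemma subring_sum: "(\<And>i. i \<in> I \<Longrightarrow> f i \<in> A) \<Longrightarrow> sum f I \<in> A"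
  by (induction I rule: infinite_finite_induct) (auto intro: subring_add)

lemma subring_power: "x \<in> A \<Longrightarrow> x ^ n \<in> A"
  by (induction n) (auto intro: subring_mult)

lemma subring_of_nat: "of_nat n \<in> A"
  by (induction n) (auto intro: subring_add)

lemma is_subring_fps_over: "is_subring (fps_over A)"
  unfolding is_subring_def fps_over_def
  by (auto simp: fps_mult_nth intro!: subring_diff subring_sum subring_mult)

lemma multiples_0 [simp]: "0 \<in> multiples c A"
  by (auto simp: multiples_def intro!: image_eqI[of _ _ 0])

lemma multiples_self [simp]: "c \<in> multiples c A"
  by (auto simp: multiples_def intro!: image_eqI[of _ _ 1])

lemma multiples_diff: "x \<in> multiples c A \<Longrightarrow> y \<in> multiples c A \<Longrightarrow> x - y \<in> multiples c A"
  unfolding multiples_def by (auto simp flip: right_diff_distrib intro: subring_diff)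

lemma multiples_minus: "x \<in> multiples c A \<Longrightarrow> - x \<in> multiples c A"
  using multiples_diff[of 0 c x] by simp

lemma multiples_add: "x \<in> multiples c A \<Longrightarrow> y \<in> multiples c A \<Longrightarrow> x + y \<in> multiples c A"
  using multiples_diff[of x c "- y"] multiples_minus[of y c] by simp

lemma multiples_mult: "x \<in> multiples c A \<Longrightarrow> y \<in> A \<Longrightarrow> x * y \<in> multiples c A"
  by (auto simp: multiples_def mult.assoc intro: subring_mult)

lemma multiples_mult': "y \<in> A \<Longrightarrow> x \<in> multiples c A \<Longrightarrow> y * x \<in> multiples c A"
  using multiples_mult by (simp add: mult.commute)

lemma multiples_sum: "(\<And>i. i \<in> I \<Longrightarrow> f i \<in> multiples c A) \<Longrightarrow> sum f I \<in> multiples c A"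
  by (induction I rule: infinite_finite_induct) (auto intro: multiples_add)

lemma multiples_mult_mult:
  "x \<in> multiples c A \<Longrightarrow> y \<in> multiples d A \<Longrightarrow> x * y \<in> multiples (c * d) A"
proof -
  assume "x \<in> multiples c A" "y \<in> multiples d A"
  then obtain a b where "x = c * a" "y = d * b" "a \<in> A" "b \<in> A"
    by (auto simp: multiples_def)
  then show ?thesis
    by (auto simp: multiples_def mult_ac intro!: image_eqI[of _ _ "a * b"] subring_mult)
qed

lemma multiples_mono: "d \<in> multiples c A \<Longrightarrow> x \<in> multiples d A \<Longrightarrow> x \<in> multiples c A"
  unfolding multiples_def by (auto simp: mult.assoc intro: subring_mult)

lemma power_in_multiples: "c \<in> A \<Longrightarrow> n > 0 \<Longrightarrow> c ^ n \<in> multiples c A"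
  by (cases n) (auto simp: multiples_def intro: subring_power)

lemma multiples_power_diff:
  assumes "x \<in> A" "y \<in> A" "x - y \<in> multiples c A"
  shows "x ^ n - y ^ n \<in> multiples c A"
  unfolding power_diff_sumr2
  using assms by (intro multiples_mult subring_sum subring_mult subring_power)

text \<open>The cofactor z of x - y in x^q - y^q is congruent modulo c to q y^(q-1), hence to 0, so
  taking q-th powers gains one factor c.\<close>

lemma power_diff_in_multiples_Suc:
  assumes xy: "x \<in> A" "y \<in> A" "x - y \<in> multiples (c ^ Suc s) A"
    and c: "c \<in> A" "of_nat q \<in> multiples c A" "q > 0"
  shows "x ^ q - y ^ q \<in> multiples (c ^ Suc (Suc s)) A"
proof -
  obtain m where m: "q = Suc m"
    using c(3) by (cases q) auto
  define z where "z = (\<Sum>k<Suc m. x ^ k * y ^ (m - k))"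
  have "x - y \<in> multiples c A"
    using xy c power_in_multiples[of c "Suc s"] multiples_mono by blast
  then have "x ^ k - y ^ k \<in> multiples c A" for k
    using xy multiples_power_diff by blast
  then have "(x ^ k - y ^ k) * y ^ (m - k) \<in> multiples c A" for k
    using xy by (intro multiples_mult subring_power)
  then have "(\<Sum>k<Suc m. (x ^ k - y ^ k) * y ^ (m - k)) \<in> multiples c A"
    by (intro multiples_sum)
  also have "(\<Sum>k<Suc m. (x ^ k - y ^ k) * y ^ (m - k)) = z - (\<Sum>k<Suc m. y ^ m)"
    unfolding z_def sum_subtractf[symmetric]
    by (rule sum.cong) (auto simp: algebra_simps simp flip: power_add)
  also have "(\<Sum>k<Suc m. y ^ m) = of_nat q * y ^ m"
    by (simp add: m)
  finally have "z - of_nat q * y ^ m \<in> multiples c A" .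
  moreover have "of_nat q * y ^ m \<in> multiples c A"
    using c xy by (intro multiples_mult subring_power)
  ultimately have z: "z \<in> multiples c A"
    using multiples_add by fastforce
  have "x ^ q - y ^ q = (x - y) * z"
    unfolding m z_def by (rule diff_power_eq_sum)
  with multiples_mult_mult[OF xy(3) z] show ?thesis
    by (simp add: mult_ac)
qed

text \<open>One factor c is gained for each q-th power. The exponent s + 1 exceeds by one the
  denominator c^s that the k-th coefficient of a logarithm can have when q^s is the exact power of q
  dividing k.\<close>

lemma power_diff_in_multiples:
  assumes xy: "x \<in> A" "y \<in> A" "x - y \<in> multiples c A"
    and c: "c \<in> A" "of_nat q \<in> multiples c A" "q > 0"
    and dvd: "q ^ s dvd k"
  shows "x ^ k - y ^ k \<in> multiples (c ^ Suc s) A"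
proof -
  have *: "x ^ (q ^ s) - y ^ (q ^ s) \<in> multiples (c ^ Suc s) A"
  proof (induction s)
    case (Suc s)
    then show ?case
      using power_diff_in_multiples_Suc[OF _ _ Suc c] xy
      by (simp add: subring_power power_mult mult.commute[of q])
  qed (use xy in simp)
  from dvd obtain l where "k = q ^ s * l" by auto
  then show ?thesis
    using multiples_power_diff[OF _ _ *, of l] xy by (simp add: subring_power power_mult)
qed

section \<open>Congruences for powers with exponent p^r\<close>

lemma frobenius_add_prime:
  assumes "prime p" "of_nat p \<in> multiples c A" "x \<in> A" "y \<in> A"
  shows "(x + y) ^ p - (x ^ p + y ^ p) \<in> multiples c A"
proof -
  have p: "p > 1"
    using assms(1) prime_gt_1_nat by blast
  have "(x + y) ^ p = (\<Sum>k\<le>p. of_nat (p choose k) * x ^ k * y ^ (p - k))"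
    by (rule binomial_ring)
  also have "{..p} = insert 0 (insert p {1..<p})"
    using p by auto
  also have "(\<Sum>k\<in>\<dots>. of_nat (p choose k) * x ^ k * y ^ (p - k)) =
      x ^ p + y ^ p + (\<Sum>k=1..<p. of_nat (p choose k) * x ^ k * y ^ (p - k))"
    using p by simp
  finally have "(x + y) ^ p - (x ^ p + y ^ p) = (\<Sum>k=1..<p. of_nat (p choose k) * x ^ k * y ^ (p - k))"
    by simp
  also have "\<dots> \<in> multiples c A"
  proof (intro multiples_sum multiples_mult subring_power assms)
    fix k assume "k \<in> {1..<p}"
    then have "p dvd (p choose k)"
      using assms(1) by (intro dvd_choose_prime) auto
    then obtain l where "(p choose k) = p * l" by auto
    then show "of_nat (p choose k) \<in> multiples c A"
      using assms by (simp add: multiples_mult subring_of_nat)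
  qed
  finally show ?thesis .
qed

lemma frobenius_add:
  assumes "prime p" "of_nat p \<in> multiples c A" "c \<in> A" "x \<in> A" "y \<in> A"
  shows "(x + y) ^ (p ^ r) - (x ^ (p ^ r) + y ^ (p ^ r)) \<in> multiples c A"
proof (induction r)
  case (Suc r)
  let ?q = "p ^ r"
  have "((x + y) ^ ?q) ^ p - (x ^ ?q + y ^ ?q) ^ p \<in> multiples c A"
    by (intro multiples_power_diff Suc subring_power subring_add assms)
  moreover have "(x ^ ?q + y ^ ?q) ^ p - ((x ^ ?q) ^ p + (y ^ ?q) ^ p) \<in> multiples c A"
    using assms by (intro frobenius_add_prime subring_power) auto
  ultimately have "(((x + y) ^ ?q) ^ p - (x ^ ?q + y ^ ?q) ^ p) +
      ((x ^ ?q + y ^ ?q) ^ p - ((x ^ ?q) ^ p + (y ^ ?q) ^ p)) \<in> multiples c A"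
    by (rule multiples_add)
  moreover have "a - b + (b - d) = a - d" for a b d :: 'b
    by simp
  ultimately show ?case
    by (simp only: power_Suc2 power_mult)
qed simp

lemma frobenius_sum:
  assumes "prime p" "of_nat p \<in> multiples c A" "c \<in> A" "\<And>i. i \<in> I \<Longrightarrow> f i \<in> A"
  shows "sum f I ^ (p ^ r) - (\<Sum>i\<in>I. f i ^ (p ^ r)) \<in> multiples c A"
  using assms(4)
proof (induction I rule: infinite_finite_induct)
  case (insert i I)
  have "(f i + sum f I) ^ (p ^ r) - (f i ^ (p ^ r) + sum f I ^ (p ^ r)) \<in> multiples c A"
    using insert.prems by (intro frobenius_add assms(1-3) subring_sum) auto
  moreover have "sum f I ^ (p ^ r) - (\<Sum>i\<in>I. f i ^ (p ^ r)) \<in> multiples c A"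
    using insert by auto
  ultimately show ?case
    using insert.hyps multiples_add by (fastforce simp: algebra_simps)
qed (use assms(1) prime_gt_0_nat in \<open>auto simp: power_0_left\<close>)

end

lemma fps_overI: "(\<And>n. f $ n \<in> A) \<Longrightarrow> f \<in> fps_over A"
  and fps_overD: "f \<in> fps_over A \<Longrightarrow> f $ n \<in> A"
  by (auto simp: fps_over_def)

lemma multiples_fps_over_iff:
  "f \<in> multiples (fps_const c) (fps_over A) \<longleftrightarrow> (\<forall>n. f $ n \<in> multiples c A)"
proof
  assume "\<forall>n. f $ n \<in> multiples c A"
  then obtain g where g: "\<And>n. g n \<in> A \<and> f $ n = c * g n"
    unfolding multiples_def image_iff by metis
  then have "f = fps_const c * Abs_fps g" "Abs_fps g \<in> fps_over A"
    by (auto simp: fps_eq_iff fps_over_def)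
  then show "f \<in> multiples (fps_const c) (fps_over A)"
    by (auto simp: multiples_def)
qed (auto simp: multiples_def fps_over_def)

lemma fps_over_compose:
  assumes "is_subring A" "f \<in> fps_over A" "g \<in> fps_over A"
  shows "f oo g \<in> fps_over A"
  using assms subring_power[OF is_subring_fps_over[OF assms(1)] assms(3)]
  by (intro fps_overI) (auto simp: fps_compose_nth fps_over_def intro!: subring_sum subring_mult)

lemma fps_mult_nth_cong:
  assumes "\<And>k. k \<le> n \<Longrightarrow> f $ k = f' $ k" "\<And>k. k \<le> n \<Longrightarrow> g $ k = g' $ k"
  shows "(f * g) $ n = (f' * g') $ n"
  unfolding fps_mult_nth by (rule sum.cong) (auto simp: assms)

lemma fps_power_nth_cong:
  fixes f g :: "'b::comm_ring_1 fps"
  assumes "\<And>k. k \<le> n \<Longrightarrow> f $ k = g $ k"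
  shows "(f ^ m) $ n = (g ^ m) $ n"
  using assms
proof (induction m arbitrary: n)
  case (Suc m)
  then show ?case
    unfolding power_Suc by (intro fps_mult_nth_cong) auto
qed simp

definition fps_map :: "('b \<Rightarrow> 'c) \<Rightarrow> 'b fps \<Rightarrow> 'c fps" where
  "fps_map \<sigma> f = Abs_fps (\<lambda>n. \<sigma> (f $ n))"

lemma fps_map_nth [simp]: "fps_map \<sigma> f $ n = \<sigma> (f $ n)"
  by (simp add: fps_map_def)

lemma fps_compose_X_power_nth:
  fixes f :: "'b::comm_ring_1 fps"
  assumes "q > 0"
  shows "(f oo fps_X ^ q) $ n = (if q dvd n then f $ (n div q) else 0)"
proof -
  have "(f oo fps_X ^ q) $ n = (\<Sum>i=0..n. if i * q = n then f $ i else 0)"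
    unfolding fps_compose_nth
    by (rule sum.cong) (auto simp: mult.commute simp flip: power_mult)
  also have "\<dots> = (if q dvd n then f $ (n div q) else 0)"
  proof (cases "q dvd n")
    case True
    then have "i * q = n \<longleftrightarrow> i = n div q" for i
      using assms by auto
    then show ?thesis
      using True by simp
  qed (auto intro!: sum.neutral)
  finally show ?thesis .
qed

text \<open>A lift of the q-power map on A extends to series by sending the variable to its q-th
  power. For a fixed coefficient the series may be truncated to a polynomial, whose q-th power is
  congruent to the sum of the q-th powers of its monomials. It is used once over R with the
  identity, and once over series in T with the substitution of Q.\<close>

lemma fps_frobenius:
  assumes A: "is_subring A"
    and p: "prime p" "of_nat p \<in> multiples c A" "c \<in> A"
    and \<sigma>: "\<And>a. a \<in> A \<Longrightarrow> a ^ (p ^ r) - \<sigma> a \<in> multiples c A"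
    and f: "f \<in> fps_over A"
  shows "f ^ (p ^ r) - (fps_map \<sigma> f oo fps_X ^ (p ^ r)) \<in> multiples (fps_const c) (fps_over A)"
  unfolding multiples_fps_over_iff
proof
  fix n
  let ?q = "p ^ r" and ?B = "fps_over A"
  have q: "?q > 0"
    using p(1) prime_gt_0_nat by simp
  define g where "g = (\<Sum>k\<le>n. fps_const (f $ k) * fps_X ^ k)"
  have g_nth: "g $ k = f $ k" if "k \<le> n" for k
    using that by (simp add: g_def fps_sum_nth if_distrib cong: if_cong)
  have X: "fps_X \<in> ?B"
    using subring_1[OF A] subring_0[OF A] by (auto simp: fps_over_def fps_X_def)
  have const: "a \<in> A \<Longrightarrow> fps_const a \<in> ?B" for a
    using subring_0[OF A] by (auto simp: fps_over_def fps_const_def)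
  have "of_nat p \<in> multiples (fps_const c) ?B"
    using p(2) multiples_0[OF A] by (simp add: multiples_fps_over_iff flip: fps_of_nat)
  then have "g ^ ?q - (\<Sum>k\<le>n. (fps_const (f $ k) * fps_X ^ k) ^ ?q) \<in> multiples (fps_const c) ?B"
    unfolding g_def
    by (intro frobenius_sum is_subring_fps_over subring_mult[OF is_subring_fps_over]
        subring_power[OF is_subring_fps_over] A p X const)
      (use f in \<open>auto simp: fps_over_def\<close>)
  then have 1: "(g ^ ?q) $ n - (\<Sum>k\<le>n. (fps_const (f $ k) * fps_X ^ k) ^ ?q) $ n \<in> multiples c A"
    unfolding multiples_fps_over_iff by simp
  have "(\<Sum>k\<le>n. (fps_const (f $ k) * fps_X ^ k) ^ ?q) $ n =
        (\<Sum>k\<le>n. (f $ k) ^ ?q * (if n = k * ?q then 1 else 0))"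
    by (simp add: fps_sum_nth power_mult_distrib flip: power_mult)
  also have "\<dots> = (if ?q dvd n then (f $ (n div ?q)) ^ ?q else 0)"
  proof (cases "?q dvd n")
    case True
    then have "n = i * ?q \<longleftrightarrow> i = n div ?q" for i
      using q by auto
    then show ?thesis
      using True by (simp add: if_distrib cong: if_cong)
  qed (auto intro!: sum.neutral)
  finally have 2: "(f ^ ?q) $ n - (if ?q dvd n then (f $ (n div ?q)) ^ ?q else 0) \<in> multiples c A"
    using 1 fps_power_nth_cong[OF g_nth, of n ?q] by simp
  show "(f ^ ?q - (fps_map \<sigma> f oo fps_X ^ ?q)) $ n \<in> multiples c A"
  proof (cases "?q dvd n")
    case True
    have "(f $ (n div ?q)) ^ ?q - \<sigma> (f $ (n div ?q)) \<in> multiples c A"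
      using f \<sigma> by (auto simp: fps_over_def)
    from multiples_add[OF A 2[unfolded if_P[OF True]] this] show ?thesis
      using True q by (simp add: fps_compose_X_power_nth)
  next
    case False
    then show ?thesis
      using 2 q by (simp add: fps_compose_X_power_nth)
  qed
qed

section \<open>Values of power series\<close>

context ultrametric_field
begin

text \<open>Over an ultrametric field this is equivalent to convergence of the series at x. Values
  are additive and multiplicative on such series, even where x lies outside the open unit
  disc.\<close>

definition null_at :: "'a \<Rightarrow> 'a fps \<Rightarrow> bool" where
  "null_at x f \<longleftrightarrow> (\<lambda>k. f $ k * x ^ k) \<longlonglongrightarrow> 0"

definition integers :: "'a set" where
  "integers = {x. nrm x \<le> 1}"

lemma is_subring_integers: "is_subring integers"
  by (auto simp: is_subring_def integers_def nrm_mult intro: nrm_diff_le mult_le_one)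

lemma finite_support_null_at:
  assumes "\<And>k. k > N \<Longrightarrow> f $ k = 0"
  shows "null_at x f" and "fps_value f x = (\<Sum>k\<le>N. f $ k * x ^ k)"
proof -
  have "\<forall>\<^sub>F k in sequentially. f $ k * x ^ k = 0"
    using assms by (auto simp: eventually_sequentially intro!: exI[of _ "Suc N"])
  then show "null_at x f"
    unfolding null_at_def by (rule tendsto_eventually)
  show "fps_value f x = (\<Sum>k\<le>N. f $ k * x ^ k)"
    unfolding fps_value_def by (rule suminf_finite) (auto simp: assms not_le)
qed

lemma null_at_const [simp]: "null_at x (fps_const c)"
  and fps_value_const [simp]: "fps_value (fps_const c) x = c"
  using finite_support_null_at[of 0 "fps_const c" x] by simp_all

lemma null_at_1 [simp]: "null_at x 1"
  and fps_value_1 [simp]: "fps_value 1 x = 1"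
  using null_at_const[of x 1] fps_value_const[of 1 x] by simp_all

lemma null_at_0 [simp]: "null_at x 0"
  and fps_value_0 [simp]: "fps_value 0 x = 0"
  using null_at_const[of x 0] fps_value_const[of 0 x] by simp_all

lemma fps_value_X [simp]: "fps_value fps_X x = (x :: 'a)"
  using finite_support_null_at(2)[of 1 fps_X x] by (simp add: fps_X_def)

lemma null_at_add: "null_at x f \<Longrightarrow> null_at x g \<Longrightarrow> null_at x (f + g)"
  using ultra_tendsto_add[of "\<lambda>k. f $ k * x ^ k" 0 sequentially "\<lambda>k. g $ k * x ^ k" 0]
  by (simp add: null_at_def distrib_right)

lemma fps_value_sums: "null_at x f \<Longrightarrow> (\<lambda>k. f $ k * x ^ k) sums fps_value f x"
  unfolding null_at_def fps_value_def by (rule ultra_sums)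

lemma fps_value_add:
  assumes "null_at x f" "null_at x g"
  shows "fps_value (f + g) x = fps_value f x + fps_value g x"
proof -
  have "(\<lambda>k. (f + g) $ k * x ^ k) sums (fps_value f x + fps_value g x)"
    using ultra_tendsto_add[OF fps_value_sums[OF assms(1), unfolded sums_def]
        fps_value_sums[OF assms(2), unfolded sums_def]]
    by (simp add: sums_def sum.distrib distrib_right)
  then show ?thesis
    unfolding fps_value_def by (simp add: sums_iff)
qed

lemma null_at_sum: "(\<And>i. i \<in> I \<Longrightarrow> null_at x (f i)) \<Longrightarrow> null_at x (sum f I)"
  by (induction I rule: infinite_finite_induct) (auto intro: null_at_add)

lemma fps_value_sum:
  "(\<And>i. i \<in> I \<Longrightarrow> null_at x (f i)) \<Longrightarrow> fps_value (sum f I) x = (\<Sum>i\<in>I. fps_value (f i) x)"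
  by (induction I rule: infinite_finite_induct) (auto simp: fps_value_add null_at_sum)

lemma fps_mult_nth_power:
  fixes f g :: "'a fps"
  shows "(f * g) $ n * x ^ n = (\<Sum>i\<le>n. (f $ i * x ^ i) * (g $ (n - i) * x ^ (n - i)))"
  unfolding fps_mult_nth atMost_atLeast0 sum_distrib_right
  by (rule sum.cong) (auto simp: mult_ac simp flip: power_add)

lemma null_at_mult: "null_at x f \<Longrightarrow> null_at x g \<Longrightarrow> null_at x (f * g)"
  and fps_value_mult:
    "null_at x f \<Longrightarrow> null_at x g \<Longrightarrow> fps_value (f * g) x = fps_value f x * fps_value g x"
  using null_Cauchy_product[of "\<lambda>k. f $ k * x ^ k" "\<lambda>k. g $ k * x ^ k"]
  unfolding null_at_def fps_value_def fps_mult_nth_power by blast+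

lemma null_at_power: "null_at x f \<Longrightarrow> null_at x (f ^ n)"
  by (induction n) (auto intro: null_at_mult)

lemma fps_value_power: "null_at x f \<Longrightarrow> fps_value (f ^ n) x = fps_value f x ^ n"
  by (induction n) (auto simp: fps_value_mult null_at_power)

lemma bounded_null_at:
  assumes "\<And>k. nrm (f $ k) \<le> C" "nrm x < 1"
  shows "null_at x f"
  unfolding null_at_def
proof (rule ultra_tendsto_mult_0)
  show "(\<lambda>k. x ^ k) \<longlonglongrightarrow> 0"
    unfolding tendsto_0_iff nrm_power using assms(2) by (intro LIMSEQ_power_zero) simp
qed (rule assms(1))

lemma integral_null_at: "f \<in> fps_over integers \<Longrightarrow> nrm x < 1 \<Longrightarrow> null_at x f"
  by (rule bounded_null_at[of _ 1]) (auto simp: integers_def fps_over_def)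

text \<open>With N = 1 it keeps values inside the open unit disc; with N = 2 it shows that the
  linear term dominates.\<close>

lemma nrm_fps_value_le:
  assumes "f \<in> fps_over integers" "nrm x < 1" "\<And>k. k < N \<Longrightarrow> f $ k = 0"
  shows "nrm (fps_value f x) \<le> nrm x ^ N"
  unfolding fps_value_def
proof (rule suminf_nrm_le)
  show "(\<lambda>k. f $ k * x ^ k) \<longlonglongrightarrow> 0"
    using integral_null_at[OF assms(1,2)] by (simp add: null_at_def)
  show "nrm (f $ k * x ^ k) \<le> nrm x ^ N" for k
  proof (cases "k < N")
    case False
    then have "nrm (f $ k) * nrm x ^ k \<le> 1 * nrm x ^ N"
      using assms by (intro mult_mono power_decreasing) (auto simp: fps_over_def integers_def)
    then show ?thesis by (simp add: nrm_mult nrm_power)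
  qed (simp add: assms)
qed

text \<open>The array \<open>u a k\<close> of terms f_a [X^k] g^a x^k vanishes for k < a, as g has
  no constant term, and is bounded by |x|^k. It is therefore doubly null, and its two iterated sums
  are the two sides.\<close>

lemma fps_value_compose:
  assumes f: "f \<in> fps_over integers" and g: "g \<in> fps_over integers" "g $ 0 = 0" and x: "nrm x < 1"
  shows "fps_value (f oo g) x = fps_value f (fps_value g x)"
proof -
  define u where "u = (\<lambda>a k. f $ a * (g ^ a) $ k * x ^ k)"
  have ga: "g ^ a \<in> fps_over integers" for a
    by (intro subring_power is_subring_fps_over is_subring_integers g)
  have null: "u a k = 0" if "k < a" for a k
    using startsby_zero_power_prefix[OF g(2)] that by (auto simp: u_def)
  have le: "nrm (u a k) \<le> nrm x ^ k" for a k
    using f ga[of a] mult_right_mono[of "nrm (f $ a) * nrm ((g ^ a) $ k)" 1 "nrm x ^ k"]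
      mult_le_one[of "nrm (f $ a)" "nrm ((g ^ a) $ k)"]
    by (simp add: u_def nrm_mult nrm_power fps_over_def integers_def)
  have dn: "doubly_null u"
    unfolding doubly_null_def
  proof (intro allI impI)
    fix \<epsilon> :: real assume "\<epsilon> > 0"
    then obtain N where N: "nrm x ^ N < \<epsilon>"
      using real_arch_pow_inv x by blast
    have "nrm (u a k) \<le> \<epsilon>" if "a \<ge> N \<or> k \<ge> N" for a k
    proof (cases "k \<ge> N")
      case True
      then have "nrm x ^ k \<le> nrm x ^ N"
        using x by (intro power_decreasing) auto
      with le[of a k] N show ?thesis by linarith
    next
      case False
      with that null[of k a] \<open>\<epsilon> > 0\<close> show ?thesis by simp
    qed
    then show "\<exists>N. \<forall>j k. N \<le> j \<or> N \<le> k \<longrightarrow> nrm (u j k) \<le> \<epsilon>"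
      by blast
  qed
  have "(\<Sum>a. u a k) = (f oo g) $ k * x ^ k" for k
  proof -
    have "(\<Sum>a. u a k) = (\<Sum>a\<le>k. u a k)"
      by (rule suminf_finite) (auto simp: null not_le)
    then show ?thesis
      by (simp add: u_def fps_compose_nth sum_distrib_right atMost_atLeast0)
  qed
  moreover have "suminf (u a) = f $ a * fps_value g x ^ a" for a
  proof -
    have "suminf (u a) = fps_value (fps_const (f $ a) * g ^ a) x"
      by (simp add: fps_value_def u_def)
    also have "\<dots> = f $ a * fps_value g x ^ a"
      using integral_null_at[OF g(1) x] by (simp add: fps_value_mult fps_value_power null_at_power)
    finally show ?thesis .
  qed
  ultimately show ?thesis
    using suminf_swap[OF dn] by (simp add: fps_value_def)
qed

end

section \<open>Composition of power series\<close>

locale unital_ring_hom =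
  fixes \<sigma> :: "'b::comm_ring_1 \<Rightarrow> 'c::comm_ring_1"
  assumes hom_add: "\<sigma> (x + y) = \<sigma> x + \<sigma> y"
    and hom_mult: "\<sigma> (x * y) = \<sigma> x * \<sigma> y"
    and hom_1: "\<sigma> 1 = 1"
begin

lemma hom_0: "\<sigma> 0 = 0"
  using hom_add[of 0 0] by simp

lemma hom_sum: "\<sigma> (sum f I) = (\<Sum>i\<in>I. \<sigma> (f i))"
  by (induction I rule: infinite_finite_induct) (auto simp: hom_0 hom_add)

lemma fps_map_mult: "fps_map \<sigma> (f * g) = fps_map \<sigma> f * fps_map \<sigma> g"
  by (simp add: fps_eq_iff fps_mult_nth hom_sum hom_mult)

lemma fps_map_power: "fps_map \<sigma> (f ^ n) = fps_map \<sigma> f ^ n"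
  by (induction n) (simp_all add: fps_map_mult, simp add: fps_eq_iff hom_0 hom_1)

lemma fps_map_compose: "fps_map \<sigma> (f oo g) = fps_map \<sigma> f oo fps_map \<sigma> g"
  by (simp add: fps_eq_iff fps_compose_nth hom_sum hom_mult flip: fps_map_power)

end

lemma hom_fps_const: "unital_ring_hom (fps_const :: 'b::comm_ring_1 \<Rightarrow> 'b fps)"
  by unfold_locales simp_all

lemma hom_fps_compose: "Q $ 0 = 0 \<Longrightarrow> unital_ring_hom (\<lambda>f. f oo (Q :: 'b::idom fps))"
  by unfold_locales (simp_all add: fps_compose_add_distrib fps_compose_mult_distrib)

lemma fps_compose_nth_cong:
  fixes f g g' :: "'b::comm_ring_1 fps"
  assumes "\<And>k. k \<le> n \<Longrightarrow> g $ k = g' $ k"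
  shows "(f oo g) $ n = (f oo g') $ n"
  unfolding fps_compose_nth by (rule sum.cong) (auto simp: fps_power_nth_cong[OF assms])

text \<open>Without constant terms, a product of at least two factors reaches degree n only through
  coefficients of degree below n.\<close>

lemma fps_power_nth_cong_less:
  fixes f g :: "'b::comm_ring_1 fps"
  assumes "f $ 0 = 0" "g $ 0 = 0" "\<And>k. k < n \<Longrightarrow> f $ k = g $ k" "m \<ge> 2"
  shows "(f ^ m) $ n = (g ^ m) $ n"
proof -
  obtain i where m: "m = Suc i" "i > 0"
    using assms(4) by (cases m) auto
  have "f $ j * (f ^ i) $ (n - j) = g $ j * (g ^ i) $ (n - j)" if "j \<le> n" for j
  proof (cases "j = 0 \<or> j = n")
    case True
    then show ?thesis
      using assms(1,2) m(2) by (auto simp: fps_power_zeroth power_0_left)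
  next
    case False
    then have "(f ^ i) $ (n - j) = (g ^ i) $ (n - j)"
      using that by (intro fps_power_nth_cong assms(3)) auto
    then show ?thesis
      using False that assms(3) by simp
  qed
  then show ?thesis
    by (simp add: m fps_mult_nth)
qed

text \<open>Powers of exponent at least 2 do not see the n-th coefficient, so only the linear term
  of f does. This isolates the newest coefficient in the recursion of
  \<open>functional_equation\<close>.\<close>

lemma fps_compose_nth_diff:
  fixes f g g' :: "'b::comm_ring_1 fps"
  assumes "g $ 0 = 0" "g' $ 0 = 0" "\<And>k. k < n \<Longrightarrow> g $ k = g' $ k" "n > 0"
  shows "(f oo g) $ n - (f oo g') $ n = f $ 1 * (g $ n - g' $ n)"
proof -
  have "(f oo g) $ n - (f oo g') $ n = (\<Sum>i=0..n. f $ i * ((g ^ i) $ n - (g' ^ i) $ n))"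
    by (simp add: fps_compose_nth sum_subtractf right_diff_distrib)
  also have "\<dots> = (\<Sum>i\<in>{1}. f $ i * ((g ^ i) $ n - (g' ^ i) $ n))"
  proof (rule sum.mono_neutral_right)
    show "\<forall>i\<in>{0..n} - {1}. f $ i * ((g ^ i) $ n - (g' ^ i) $ n) = 0"
    proof
      fix i assume "i \<in> {0..n} - {1}"
      then have "i = 0 \<or> i \<ge> 2" by auto
      then show "f $ i * ((g ^ i) $ n - (g' ^ i) $ n) = 0"
        by (elim disjE) (simp_all add: fps_power_nth_cong_less[OF assms(1-3)])
    qed
  qed (use assms(4) in auto)
  finally show ?thesis by simp
qed

lemma fps_const_mult_compose: "(fps_const (c::'b::comm_ring_1) * f) oo g = fps_const c * (f oo g)"
  by (simp add: fps_eq_iff fps_compose_nth sum_distrib_left mult.assoc)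

lemma multiples_nth: "f \<in> multiples (fps_const c) (fps_over A) \<Longrightarrow> \<exists>a\<in>A. f $ n = c * a"
  unfolding multiples_fps_over_iff by (auto simp: multiples_def)

lemma multiples_compose_diff:
  assumes A: "is_subring A" and c: "c \<in> A" and f: "f \<in> fps_over A"
    and gh: "g \<in> fps_over A" "h \<in> fps_over A" "g - h \<in> multiples (fps_const c) (fps_over A)"
  shows "(f oo g) - (f oo h) \<in> multiples (fps_const c) (fps_over A)"
  unfolding multiples_fps_over_iff
proof
  fix n
  have "((f oo g) - (f oo h)) $ n = (\<Sum>i=0..n. f $ i * (g ^ i - h ^ i) $ n)"
    by (simp add: fps_compose_nth sum_subtractf right_diff_distrib)
  also have "\<dots> \<in> multiples c A"
    using multiples_power_diff[OF is_subring_fps_over[OF A] gh] f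
    by (intro multiples_sum[OF A] multiples_mult'[OF A]) (auto simp: multiples_fps_over_iff dest: fps_overD)
  finally show "((f oo g) - (f oo h)) $ n \<in> multiples c A" .
qed

section \<open>The functional equation of the logarithm\<close>

text \<open>An axiomatic form of the valuation ring of K with uniformiser c. The condition
  \<open>frobenius\<close> says that residue classes are fixed by the q-power map;
  \<open>unit\<close> is what allows solving for a coefficient in
  \<open>logarithm_denominators\<close>.\<close>

locale lubin_tate_ring =
  fixes R :: "'a::field_char_0 set" and c :: 'a and p q :: nat
  assumes subring: "is_subring R"
    and c: "c \<in> R" "c \<noteq> 0"
    and p: "prime p" "of_nat p \<in> multiples c R"
    and q: "\<exists>r>0. q = p ^ r"
    and frobenius: "a \<in> R \<Longrightarrow> a ^ q - a \<in> multiples c R"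
    and unit: "a \<in> R \<Longrightarrow> 1 - c * a \<noteq> 0" "a \<in> R \<Longrightarrow> inverse (1 - c * a) \<in> R"
begin

definition lubin_tate :: "'a fps \<Rightarrow> bool" where
  "lubin_tate P \<longleftrightarrow> P \<in> fps_over R \<and> P $ 0 = 0 \<and> P $ 1 = c \<and>
     P - fps_X ^ q \<in> multiples (fps_const c) (fps_over R)"

lemma q_gt_1: "q > 1"
  using q one_less_power[OF prime_gt_1_nat[OF p(1)]] by auto

lemma q_pos: "q > 0"
  using q_gt_1 by linarith

lemma of_nat_q: "of_nat q \<in> multiples c R"
  using q power_in_multiples[OF subring subring_of_nat[OF subring]] multiples_mono[OF subring p(2)]
  by fastforce

lemmas subring1 = is_subring_fps_over[OF subring]
lemmas subring2 = is_subring_fps_over[OF subring1]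

lemma const_in_fps_over: "a \<in> R \<Longrightarrow> fps_const a \<in> fps_over R"
  by (auto simp: fps_over_def subring_0[OF subring])

lemma X_in_fps_over: "fps_X \<in> fps_over R"
  by (auto simp: fps_over_def fps_X_def subring_0[OF subring] subring_1[OF subring])

lemma of_nat_q_fps: "of_nat q \<in> multiples (fps_const c) (fps_over R)"
  using of_nat_q multiples_0[OF subring] by (auto simp add: multiples_fps_over_iff simp flip: fps_of_nat)

lemma of_nat_q_fps2: "of_nat q \<in> multiples (fps_const (fps_const c)) (fps_over (fps_over R))"
  using of_nat_q_fps multiples_0[OF subring] multiples_0[OF subring1] by (auto simp add: multiples_fps_over_iff simp flip: fps_of_nat)

text \<open>The order of k with respect to q, which may be a proper prime power.\<close>

lemma q_valuation:
  assumes "k > 0"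
  obtains s where "q ^ s dvd k" "\<not> q ^ Suc s dvd k"
  using power_dvd_iff_le_multiplicity[of k q] assms q_gt_1
  by (metis Suc_n_not_le_n le_refl nat_dvd_1_iff_1 less_irrefl)

text \<open>Because Q is congruent to T^q, substituting Q for T lifts the q-power map on series over
  R.\<close>

lemma lubin_tate_compose_frobenius:
  assumes Q: "lubin_tate Q" and f: "f \<in> fps_over R"
  shows "f ^ q - (f oo Q) \<in> multiples (fps_const c) (fps_over R)"
proof -
  obtain r where r: "q = p ^ r"
    using q by blast
  have "f ^ q - (fps_map (\<lambda>x. x) f oo fps_X ^ q) \<in> multiples (fps_const c) (fps_over R)"
    unfolding r by (rule fps_frobenius) (use subring p c f frobenius r in auto)
  moreover have "fps_map (\<lambda>x. x) f = f"
    by (simp add: fps_eq_iff)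
  ultimately have 1: "f ^ q - (f oo fps_X ^ q) \<in> multiples (fps_const c) (fps_over R)"
    by simp
  have 2: "(f oo Q) - (f oo fps_X ^ q) \<in> multiples (fps_const c) (fps_over R)"
    using Q f c X_in_fps_over by (intro multiples_compose_diff subring)
      (auto simp: lubin_tate_def intro: subring_power[OF subring1])
  from multiples_diff[OF subring1 1 2] show ?thesis
    by simp
qed

context
  fixes P l :: "'a fps"
  assumes P: "lubin_tate P" and l: "l $ 0 = 0" "l $ 1 = 1" and lP: "l oo P = fps_const c * l"
begin

text \<open>Compare the k-th coefficients in l(P(X)) = c l(X). Replacing P^j by X^(qj) changes the
  terms with j < k by elements of c R, and what these powers leave is l $ (k div q) when q divides
  k. So the denominator grows by one factor c exactly at a division by q.\<close>

lemma logarithm_denominators: "k > 0 \<Longrightarrow> \<not> q ^ Suc s dvd k \<Longrightarrow> c ^ s * l $ k \<in> R"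
proof (induction k arbitrary: s rule: less_induct)
  case (less k)
  show ?case
  proof (cases "k = 1")
    case True
    then show ?thesis using l c subring_power[OF subring] by simp
  next
    case False
    with less.prems have k: "k \<ge> 2" by simp
    let ?X = "fps_X ^ q :: 'a fps"
    \<comment> \<open>If q^t exactly divides j, the power difference contributes c^(t+1), while by
      induction the denominator of \<open>l $ j\<close> is at most c^t.\<close>
    have small: "l $ j * (P ^ j - ?X ^ j) $ k \<in> multiples c R" if "j < k" for j
    proof (cases "j = 0")
      case False
      then obtain t where t: "q ^ t dvd j" "\<not> q ^ Suc t dvd j"
        using q_valuation[of j] by blast
      have "P ^ j - ?X ^ j \<in> multiples (fps_const c ^ Suc t) (fps_over R)"
        using P t X_in_fps_over c const_in_fps_over of_nat_q_fps q_pos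
        by (intro power_diff_in_multiples[OF subring1]) (auto simp: lubin_tate_def subring_power[OF subring1])
      then have "P ^ j - ?X ^ j \<in> multiples (fps_const (c ^ Suc t)) (fps_over R)"
        by simp
      then obtain a where a: "a \<in> R" "(P ^ j - ?X ^ j) $ k = c ^ Suc t * a"
        using multiples_nth by blast
      have "c ^ t * l $ j * a \<in> R"
        using less.IH[OF \<open>j < k\<close> _ t(2)] False by (intro subring_mult[OF subring, of _ a] a(1)) auto
      then show ?thesis
        unfolding a(2) multiples_def by (intro image_eqI[of _ _ "c ^ t * l $ j * a"]) (simp_all add: mult_ac)
    qed (simp add: l multiples_0[OF subring])
    have "c * l $ k = (\<Sum>j\<le>k. l $ j * (P ^ j) $ k)"
      using arg_cong[OF lP, of "\<lambda>f. f $ k"] by (simp add: fps_compose_nth atMost_atLeast0)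
    \<comment> \<open>P starts with c X, so P^k starts with c^k X^k.\<close>
    also have "\<dots> = (\<Sum>j<k. l $ j * (P ^ j) $ k) + l $ k * c ^ k"
      using P startsby_zero_power_nth_same[of P k]
      by (simp add: lubin_tate_def flip: lessThan_Suc_atMost)
    also have "(\<Sum>j<k. l $ j * (P ^ j) $ k) =
        (\<Sum>j<k. l $ j * (P ^ j - ?X ^ j) $ k) + (\<Sum>j<k. l $ j * (?X ^ j) $ k)"
      unfolding sum.distrib[symmetric] by (rule sum.cong) (auto simp: algebra_simps)
    also have "(\<Sum>j<k. l $ j * (?X ^ j) $ k) = (if q dvd k then l $ (k div q) else 0)"
    proof -
      have "(\<Sum>j<k. l $ j * (?X ^ j) $ k) = (\<Sum>j\<le>k. l $ j * (?X ^ j) $ k)"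
        using k q_gt_1 by (intro sum.mono_neutral_left) (auto simp: not_less simp flip: power_mult)
      also have "\<dots> = (l oo ?X) $ k"
        by (simp add: fps_compose_nth atMost_atLeast0)
      finally show ?thesis by (simp only: fps_compose_X_power_nth[OF q_pos])
    qed
    finally have eq: "c * l $ k = (\<Sum>j<k. l $ j * (P ^ j - ?X ^ j) $ k) +
        (if q dvd k then l $ (k div q) else 0) + l $ k * c ^ k" .
    have "(\<Sum>j<k. l $ j * (P ^ j - ?X ^ j) $ k) \<in> multiples c R"
      using small by (intro multiples_sum[OF subring]) auto
    then obtain a where a: "a \<in> R" "(\<Sum>j<k. l $ j * (P ^ j - ?X ^ j) $ k) = c * a"
      by (auto simp: multiples_def)
    obtain k' where k': "k = Suc (Suc k')"
      using k by (metis Suc_le_D numeral_2_eq_2 Suc_le_mono)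
    \<comment> \<open>Here k' = k - 2, so c - c^k = c (1 - c b): this is the factor of
      \<open>l $ k\<close> once its own term is moved to the left.\<close>
    define b where "b = c ^ k'"
    have ck: "c ^ k = c * (c * b)"
      by (simp add: k' b_def)
    have b: "b \<in> R" unfolding b_def by (intro subring_power[OF subring] c)
    \<comment> \<open>If q divides k then s is positive, since q^(s+1) does not divide k. One factor
      of c^s cancels the division by c, and the remaining c^(s-1) suffices for
      \<open>l $ (k div q)\<close>.\<close>
    have main: "c ^ s * a + c ^ s * (if q dvd k then l $ (k div q) else 0) / c \<in> R"
    proof (cases "q dvd k")
      case True
      with less.prems obtain t where t: "s = Suc t"
        by (cases s) auto
      have "\<not> q ^ Suc t dvd k div q"
        using less.prems True q_pos unfolding t by auto
      moreover have "0 < k div q" "k div q < k"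
        using True less.prems q_gt_1 by (auto simp: div_greater_zero_iff dvd_imp_le)
      ultimately have "c ^ t * l $ (k div q) \<in> R"
        using less.IH by blast
      moreover have "c ^ s * a \<in> R"
        using a c by (intro subring_mult[OF subring] subring_power[OF subring])
      ultimately have "c ^ s * a + c ^ t * l $ (k div q) \<in> R"
        by (intro subring_add[OF subring])
      then show ?thesis using True c by (simp add: t)
    qed (use a c in \<open>auto intro: subring_mult[OF subring] subring_power[OF subring]\<close>)
    have "c * l $ k * (1 - c * b) = c * a + (if q dvd k then l $ (k div q) else 0)"
      using eq[unfolded a(2) ck] by (simp add: algebra_simps)
    then have "l $ k * (1 - c * b) = a + (if q dvd k then l $ (k div q) else 0) / c"
      using c by (simp add: field_simps)
    then have "l $ k = (a + (if q dvd k then l $ (k div q) else 0) / c) * inverse (1 - c * b)"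
      using unit(1)[OF b] by (simp add: field_simps)
    then have "c ^ s * l $ k = (c ^ s * a + c ^ s * (if q dvd k then l $ (k div q) else 0) / c) * inverse (1 - c * b)"
      by (simp add: algebra_simps)
    with main unit(2)[OF b] show ?thesis
      by (metis subring_mult[OF subring])
  qed
qed

text \<open>Although l has denominators, it respects congruences modulo c: f^k - g^k is divisible by
  c^(s+1), and \<open>l $ k\<close> has denominator at most c^s.\<close>

lemma logarithm_cong:
  fixes f g :: "'a fps fps"
  assumes f: "f \<in> fps_over (fps_over R)" and g: "g \<in> fps_over (fps_over R)"
    and fg: "f - g \<in> multiples (fps_const (fps_const c)) (fps_over (fps_over R))"
  shows "(fps_map fps_const l oo f) - (fps_map fps_const l oo g)
           \<in> multiples (fps_const (fps_const c)) (fps_over (fps_over R))"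
  unfolding multiples_fps_over_iff[of _ "fps_const c"]
proof
  fix n
  have "fps_const (l $ k) * (f ^ k - g ^ k) $ n \<in> multiples (fps_const c) (fps_over R)" for k
  proof (cases "k = 0")
    case False
    then obtain s where s: "q ^ s dvd k" "\<not> q ^ Suc s dvd k"
      using q_valuation[of k] by blast
    have "f ^ k - g ^ k \<in> multiples (fps_const (fps_const c) ^ Suc s) (fps_over (fps_over R))"
      using f g fg s c of_nat_q_fps2 q_pos
      by (intro power_diff_in_multiples[OF subring2])
        (auto intro!: const_in_fps_over fps_overI simp: subring_0[OF subring] subring_0[OF subring1])
    then have "f ^ k - g ^ k \<in> multiples (fps_const (fps_const (c ^ Suc s))) (fps_over (fps_over R))"
      by simp
    then obtain h where h: "h \<in> fps_over R" "(f ^ k - g ^ k) $ n = fps_const (c ^ Suc s) * h"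
      using multiples_nth by blast
    have "fps_const (c ^ s * l $ k) * h \<in> fps_over R"
      using logarithm_denominators[OF _ s(2)] False h(1)
      by (intro subring_mult[OF subring1] const_in_fps_over) auto
    moreover have "fps_const (l $ k) * (fps_const (c ^ Suc s) * h) = fps_const c * (fps_const (c ^ s * l $ k) * h)"
      by (simp add: fps_eq_iff mult_ac)
    ultimately show ?thesis
      unfolding h(2) multiples_def by (simp only:) (rule imageI)
  qed (simp add: l multiples_0[OF subring1])
  then have "(\<Sum>k=0..n. fps_const (l $ k) * (f ^ k - g ^ k) $ n) \<in> multiples (fps_const c) (fps_over R)"
    by (intro multiples_sum[OF subring1])
  then show "((fps_map fps_const l oo f) - (fps_map fps_const l oo g)) $ n \<in> multiples (fps_const c) (fps_over R)"
    by (simp add: fps_compose_nth right_diff_distrib sum_subtractf)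
qed

text \<open>Write L for l and E for e(S). Every integral W satisfies L(P(W)) congruent to L(W
  twisted) modulo c, because P(W) and the twist of W are both congruent to W^q. The hypothesis on S
  states the same congruence for E. Comparing E in degree n with its truncation W leaves c times the
  n-th coefficient of E in the ideal generated by c, which gives integrality by induction.\<close>

theorem functional_equation:
  fixes e Q :: "'a fps" and S :: "'a fps fps"
  assumes e: "e \<in> fps_over UNIV" "e $ 0 = 0" "e oo l = fps_X" "l oo e = fps_X"
    and Q: "lubin_tate Q" and S: "S $ 0 = 0"
    and fe: "fps_const (fps_const c) * S - (fps_map (\<lambda>f. f oo Q) S oo fps_X ^ q)
               \<in> multiples (fps_const (fps_const c)) (fps_over (fps_over R))"
  shows "fps_map fps_const e oo S \<in> fps_over (fps_over R)"
proof -
  let ?\<sigma> = "\<lambda>f. f oo Q" and ?C = "fps_const (fps_const c)" and ?R = "fps_over (fps_over R)"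
  \<comment> \<open>The twist replaces X by X^q and T by Q(T).\<close>
  define tw where "tw W = fps_map ?\<sigma> W oo fps_X ^ q" for W :: "'a fps fps"
  define E where "E = fps_map fps_const e oo S"
  define L where "L = fps_map fps_const l"
  define P' where "P' = fps_map fps_const P"
  interpret K: unital_ring_hom "fps_const :: 'a \<Rightarrow> 'a fps"
    by (rule hom_fps_const)
  interpret \<sigma>: unital_ring_hom ?\<sigma>
    using Q by (intro hom_fps_compose) (simp add: lubin_tate_def)
  have tw_nth: "tw W $ n = (if q dvd n then ?\<sigma> (W $ (n div q)) else 0)" for W n
    by (simp add: tw_def fps_compose_X_power_nth q_pos)
  have tw_L: "tw (L oo W) = L oo tw W" if "W $ 0 = 0" for W
  proof -
    have "fps_map ?\<sigma> L = L"
      by (simp add: L_def fps_eq_iff)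
    then show ?thesis
      using that q_pos by (simp add: tw_def \<sigma>.fps_map_compose fps_compose_assoc fps_X_power_iff)
  qed
  have E0: "E $ 0 = 0"
    using e by (simp add: E_def)
  have P0: "P' $ 0 = 0" and P'1: "P' $ 1 = fps_const c"
    using P by (simp_all add: P'_def lubin_tate_def)
  have L1: "L $ 1 = 1"
    using l by (simp add: L_def)
  have LE: "L oo E = S"
  proof -
    have "L oo E = fps_map fps_const (l oo e) oo S"
      unfolding L_def E_def K.fps_map_compose
      using S e by (intro fps_compose_assoc) auto
    also have "fps_map fps_const (l oo e) = (fps_X :: 'a fps fps)"
      by (simp add: e(4) fps_eq_iff fps_X_def)
    finally show ?thesis using S by simp
  qed
  have LPW: "L oo (P' oo W) = ?C * (L oo W)" if "W $ 0 = 0" for W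
  proof -
    have "L oo (P' oo W) = fps_map fps_const (l oo P) oo W"
      unfolding L_def P'_def K.fps_map_compose
      using that P by (intro fps_compose_assoc) (auto simp: lubin_tate_def)
    also have "fps_map fps_const (l oo P) = ?C * L"
      by (simp add: lP L_def fps_eq_iff)
    finally show ?thesis by (simp add: fps_const_mult_compose)
  qed
  \<comment> \<open>Since L(E) = S, L(P(E)) is c S and L of the twisted E is the twisted S, so this
    is the hypothesis \<open>fe\<close>.\<close>
  have goal: "(L oo (P' oo E)) - (L oo tw E) \<in> multiples ?C ?R"
    using fe LPW[OF E0] tw_L[OF E0] by (simp add: LE tw_def)
  have P'R: "P' \<in> ?R"
    using P const_in_fps_over by (auto simp: P'_def lubin_tate_def fps_over_def[of "fps_over R"] dest: fps_overD)
  have approx: "(L oo (P' oo W)) - (L oo tw W) \<in> multiples ?C ?R" if W: "W \<in> ?R" "W $ 0 = 0" for W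
    unfolding L_def
  proof (rule logarithm_cong)
    show twR: "tw W \<in> ?R"
      using W Q fps_over_compose[OF subring] subring_0[OF subring1]
      by (auto simp: tw_nth lubin_tate_def fps_over_def[of "fps_over R"])
    show "P' oo W \<in> ?R"
      by (intro fps_over_compose subring1 P'R W)
    have "P' - fps_X ^ q \<in> multiples ?C ?R"
    proof -
      have "P - fps_X ^ q \<in> multiples (fps_const c) (fps_over R)"
        using P by (simp add: lubin_tate_def)
      then have "fps_const ((P - fps_X ^ q) $ n) \<in> multiples (fps_const c) (fps_over R)" for n
        using multiples_0[OF subring] by (auto simp: multiples_fps_over_iff simp del: fps_sub_nth)
      moreover have "(P' - fps_X ^ q) $ n = fps_const ((P - fps_X ^ q) $ n)" for n
        by (simp add: P'_def)
      ultimately show ?thesis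
        by (simp add: multiples_fps_over_iff[of _ "fps_const c" "fps_over R"] del: fps_sub_nth)
    qed
    then obtain G where G: "G \<in> ?R" "P' - fps_X ^ q = ?C * G"
      by (auto simp: multiples_def)
    have "(P' oo W) - W ^ q = (P' - fps_X ^ q) oo W"
      using W(2) by (simp add: fps_compose_sub_distrib fps_X_power_compose)
    also have "\<dots> = ?C * (G oo W)"
      by (simp add: G fps_const_mult_compose)
    finally have 1: "(P' oo W) - W ^ q \<in> multiples ?C ?R"
      using fps_over_compose[OF subring1 G(1) W(1)] by (auto simp: multiples_def)
    obtain r where r: "q = p ^ r"
      using q by blast
    have 2: "W ^ q - tw W \<in> multiples ?C ?R"
      unfolding r tw_def
    proof (rule fps_frobenius[OF subring1 p(1) _ _ _ W(1)])
      show "of_nat p \<in> multiples (fps_const c) (fps_over R)"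
        using p(2) multiples_0[OF subring] by (auto simp: multiples_fps_over_iff simp flip: fps_of_nat)
      show "fps_const c \<in> fps_over R"
        by (intro const_in_fps_over c)
      show "a ^ (p ^ r) - (a oo Q) \<in> multiples (fps_const c) (fps_over R)" if "a \<in> fps_over R" for a
        using lubin_tate_compose_frobenius[OF Q that] by (simp add: r)
    qed
    from multiples_add[OF subring2 1 2] show "(P' oo W) - tw W \<in> multiples ?C ?R"
      by simp
  qed
  have "E $ n \<in> fps_over R" for n
  proof (induction n rule: less_induct)
    case (less n)
    show ?case
    proof (cases "n = 0")
      case True
      then show ?thesis
        using E0 subring_0[OF subring1] by simp
    next
      case False
      \<comment> \<open>The truncation of E below degree n, integral by the induction
        hypothesis.\<close>
      define W where "W = Abs_fps (\<lambda>k. if k < n then E $ k else 0)"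
      have W: "W \<in> ?R" "W $ 0 = 0"
        using less subring_0[OF subring1] E0 by (auto simp: W_def fps_over_def)
      have WE: "W $ k = E $ k" if "k < n" for k
        using that by (simp add: W_def)
      \<comment> \<open>The k-th coefficient of a twist is read off at k div q, which is below n, so
        truncation is invisible here.\<close>
      have "(L oo tw E) $ n = (L oo tw W) $ n"
      proof (rule fps_compose_nth_cong)
        fix k assume "k \<le> n"
        moreover have "k div q < n" if "k > 0"
          using that q_gt_1 \<open>k \<le> n\<close> div_less_dividend[of q k] by linarith
        ultimately show "tw E $ k = tw W $ k"
          using False by (cases "k = 0") (auto simp: tw_nth WE)
      qed
      \<comment> \<open>The composites first differ in degree n, so only linear coefficients act: 1
        for L here, c for P' in the next step.\<close>
      moreover have "(L oo (P' oo E)) $ n - (L oo (P' oo W)) $ n = (P' oo E) $ n - (P' oo W) $ n"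
      proof -
        have "(P' oo E) $ k = (P' oo W) $ k" if "k < n" for k
          using that by (intro fps_compose_nth_cong) (simp add: WE)
        then show ?thesis
          using fps_compose_nth_diff[of "P' oo E" "P' oo W" n L] False P0 L1 by simp
      qed
      moreover have "(P' oo E) $ n - (P' oo W) $ n = fps_const c * E $ n"
        using fps_compose_nth_diff[of E W n P'] False E0 W(2) WE P'1 by (simp add: W_def)
      moreover have "((L oo (P' oo E)) - (L oo tw E)) $ n - ((L oo (P' oo W)) - (L oo tw W)) $ n
          \<in> multiples (fps_const c) (fps_over R)"
        using goal approx[OF W] unfolding multiples_fps_over_iff[of _ "fps_const c"]
        by (intro multiples_diff[OF subring1]) auto
      ultimately have "fps_const c * E $ n \<in> multiples (fps_const c) (fps_over R)"
        by (simp add: algebra_simps)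
      then show ?thesis
        using c by (auto simp: multiples_def)
    qed
  qed
  then show ?thesis
    by (simp add: E_def fps_over_def[of "fps_over R"])
qed

end

end

section \<open>The Dwork series in two variables\<close>

lemma fps_iterate_0 [simp]: "fps_iterate Q 0 = fps_X"
  and fps_iterate_Suc: "fps_iterate Q (Suc i) = Q oo fps_iterate Q i"
  by (simp_all add: fps_iterate_def)

lemma fps_iterate_nth_0 [simp]: "Q $ 0 = 0 \<Longrightarrow> fps_iterate Q i $ 0 = 0"
  by (cases i) (simp_all add: fps_iterate_Suc)

lemma fps_iterate_nth_1: "Q $ 0 = 0 \<Longrightarrow> fps_iterate Q i $ 1 = (Q $ 1) ^ i"
  by (induction i) (simp_all add: fps_iterate_Suc fps_compose_nth)

lemma fps_iterate_compose:
  "Q $ 0 = 0 \<Longrightarrow> fps_iterate Q i oo Q = fps_iterate Q (Suc i)"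
proof (induction i)
  case (Suc i)
  have "fps_iterate Q (Suc i) oo Q = Q oo (fps_iterate Q i oo Q)"
    unfolding fps_iterate_Suc[of Q i] using Suc.prems by (simp add: fps_compose_assoc)
  then show ?case
    using Suc by (simp add: fps_iterate_Suc)
qed (simp add: fps_iterate_Suc)

locale ultrametric_lubin_tate = ultrametric_field nrm + lubin_tate_ring R c p q
  for nrm :: "'a::{field_char_0, complete_space} \<Rightarrow> real" and R :: "'a set" and c :: 'a and p q +
  assumes R_integers: "R \<subseteq> integers" and nrm_c: "nrm c < 1"
begin

lemma fps_over_R_integers: "f \<in> fps_over R \<Longrightarrow> f \<in> fps_over integers"
  using R_integers by (auto simp: fps_over_def)

lemma nrm_R: "a \<in> R \<Longrightarrow> nrm a \<le> 1"
  using R_integers by (auto simp: integers_def)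

lemma nrm_c_pos: "0 < nrm c"
  using c(2) nrm_ge_0[of c] nrm_eq_0[of c] by linarith

lemma fps_value_at_0 [simp]: "fps_value (f :: 'a fps) 0 = f $ 0"
proof -
  have "(\<Sum>k. f $ k * 0 ^ k) = (\<Sum>k\<in>{0}. f $ k * 0 ^ k)"
    by (rule suminf_finite) auto
  then show ?thesis by (simp add: fps_value_def)
qed

lemma nrm_power_nth_le:
  assumes "C \<ge> 0" "\<And>k. nrm (f $ k) \<le> C"
  shows "nrm ((f ^ j) $ k) \<le> max 1 C ^ j"
proof (induction j arbitrary: k)
  case (Suc j)
  have "nrm (f $ i * (f ^ j) $ (k - i)) \<le> max 1 C * max 1 C ^ j" for i
    unfolding nrm_mult using assms(2)[of i] Suc by (intro mult_mono) (auto simp: le_max_iff_disj)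
  then show ?case
    unfolding power_Suc fps_mult_nth by (intro nrm_sum_le) auto
qed auto

lemma q_power_eq_iff: "q ^ i = q ^ j \<longleftrightarrow> i = j"
  using q_gt_1 by simp

lemma le_q_power: "i \<le> q ^ i"
  using less_exp[of i] power_mono[of 2 q i] q_gt_1 by linarith

text \<open>\<open>f\<close> is the value of \<open>F\<close> at \<open>X = 1\<close>, taken coefficientwise in \<open>T\<close>.\<close>

definition column_sums :: "'a fps fps \<Rightarrow> 'a fps \<Rightarrow> bool" where
  "column_sums F f \<longleftrightarrow> (\<forall>k. (\<lambda>j. F $ j $ k) \<longlonglongrightarrow> 0 \<and> (\<lambda>j. F $ j $ k) sums (f $ k))"

lemma column_sums_1: "column_sums 1 1"
proof -
  have "(\<lambda>j. (1::'a fps fps) $ j $ k) = (\<lambda>j. if j = 0 then 1 $ k else 0)" for k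
    by auto
  moreover have "(\<lambda>j::nat. if j = 0 then a else 0) \<longlonglongrightarrow> 0" for a :: 'a
    by (rule tendsto_eventually) (auto simp: eventually_sequentially intro!: exI[of _ 1])
  moreover have "(\<lambda>j::nat. if j = 0 then a else 0) sums a" for a :: 'a
    using sums_finite[of "{0}" "\<lambda>j. if j = 0 then a else 0"] by simp
  ultimately show ?thesis
    unfolding column_sums_def by presburger
qed

text \<open>For fixed k the coefficient of T^k in a product is a finite sum of Cauchy products of
  null sequences.\<close>

lemma column_sums_mult:
  assumes F: "column_sums F f" and G: "column_sums G g"
  shows "column_sums (F * G) (f * g)"
  unfolding column_sums_def
proof (intro allI conjI)
  fix k
  let ?h = "\<lambda>b j. \<Sum>a\<le>j. F $ a $ b * G $ (j - a) $ (k - b)"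
  have FG: "(F * G) $ j $ k = (\<Sum>b\<le>k. ?h b j)" for j
    by (simp add: fps_mult_nth fps_sum_nth atMost_atLeast0 sum.swap[of _ "{0..j}"])
  have h: "?h b \<longlonglongrightarrow> 0" "?h b sums (f $ b * g $ (k - b))" for b
  proof -
    have F': "(\<lambda>j. F $ j $ b) \<longlonglongrightarrow> 0" "(\<Sum>j. F $ j $ b) = f $ b"
      and G': "(\<lambda>j. G $ j $ (k - b)) \<longlonglongrightarrow> 0" "(\<Sum>j. G $ j $ (k - b)) = g $ (k - b)"
      using F G by (auto simp: column_sums_def sums_iff)
    show "?h b \<longlonglongrightarrow> 0"
      by (rule null_Cauchy_product(1)[OF F'(1) G'(1)])
    then show "?h b sums (f $ b * g $ (k - b))"
      using ultra_sums[of "?h b"] null_Cauchy_product(2)[OF F'(1) G'(1)] by (simp add: F'(2) G'(2))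
  qed
  show "(\<lambda>j. (F * G) $ j $ k) \<longlonglongrightarrow> 0"
    unfolding FG using ultra_tendsto_sum[OF h(1)] by simp
  show "(\<lambda>j. (F * G) $ j $ k) sums ((f * g) $ k)"
    unfolding FG fps_mult_nth[of f] atMost_atLeast0 by (rule ultra_sums_sum[OF h(2)[unfolded atMost_atLeast0]])
qed

lemma column_sums_power: "column_sums F f \<Longrightarrow> column_sums (F ^ n) (f ^ n)"
  by (induction n) (auto intro: column_sums_1 column_sums_mult)

text \<open>If T divides F, then T^a divides F^a.\<close>

lemma power_nth_nth_eq_0:
  fixes F :: "'a fps fps"
  assumes "\<And>j. F $ j $ 0 = 0" "k < a"
  shows "(F ^ a) $ j $ k = 0"
  using assms(2)
proof (induction a arbitrary: j k)
  case (Suc a)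
  have "(F $ i * (F ^ a) $ (j - i)) $ k = 0" for i
    unfolding fps_mult_nth
  proof (rule sum.neutral, safe)
    fix l assume "l \<in> {0..k}"
    with Suc show "F $ i $ l * (F ^ a) $ (j - i) $ (k - l) = 0"
      by (cases "l = 0") (auto simp: assms(1))
  qed
  then show ?case
    by (simp add: fps_mult_nth[of F] fps_sum_nth del: fps_mult_nth)
qed simp

text \<open>For fixed k, divisibility of F by T leaves only the powers with a at most k, a range
  independent of j, so a finite sum is all that must commute with the limit. No convergence of e is
  involved.\<close>

lemma column_sums_compose:
  fixes e :: "'a fps"
  assumes F: "column_sums F f" "F $ 0 = 0" "\<And>j. F $ j $ 0 = 0"
  shows "column_sums (fps_map fps_const e oo F) (e oo f)"
  unfolding column_sums_def
proof (intro allI conjI)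
  fix k
  have eq: "(fps_map fps_const e oo F) $ j $ k = (\<Sum>a=0..k. e $ a * (F ^ a) $ j $ k)" for j
  proof -
    have "(fps_map fps_const e oo F) $ j $ k = (\<Sum>a=0..j. e $ a * (F ^ a) $ j $ k)"
      by (simp add: fps_compose_nth fps_sum_nth)
    \<comment> \<open>Terms with a > k vanish because T divides F, and terms with a > j because X
      does; the common range is then enlarged to a at most k.\<close>
    also have "\<dots> = (\<Sum>a\<in>{0..j} \<inter> {0..k}. e $ a * (F ^ a) $ j $ k)"
      using power_nth_nth_eq_0[OF F(3)] by (intro sum.mono_neutral_right) auto
    also have "\<dots> = (\<Sum>a=0..k. e $ a * (F ^ a) $ j $ k)"
      using startsby_zero_power_prefix[OF F(2)] by (intro sum.mono_neutral_left) auto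
    finally show ?thesis .
  qed
  have pow: "(\<lambda>j. (F ^ a) $ j $ k) \<longlonglongrightarrow> 0" "(\<lambda>j. (F ^ a) $ j $ k) sums ((f ^ a) $ k)" for a
    using column_sums_power[OF F(1)] by (auto simp: column_sums_def)
  have null: "(\<lambda>j. e $ a * (F ^ a) $ j $ k) \<longlonglongrightarrow> 0" for a
    using ultra_tendsto_cmult[OF pow(1)] by simp
  show "(\<lambda>j. (fps_map fps_const e oo F) $ j $ k) \<longlonglongrightarrow> 0"
    unfolding eq using ultra_tendsto_sum[OF null, where I = "{0..k}"] by simp
  show "(\<lambda>j. (fps_map fps_const e oo F) $ j $ k) sums ((e oo f) $ k)"
    unfolding eq fps_compose_nth[of e f] by (intro ultra_sums_sum ultra_sums_cmult pow)
qed

section \<open>Scaled iterates of Q, their limit and the two-variable exponent\<close>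

context
  fixes Q :: "'a fps"
  assumes Q: "lubin_tate Q"
begin

lemma Q_props: "Q \<in> fps_over R" "Q $ 0 = 0" "Q $ Suc 0 = c"
  using Q by (auto simp: lubin_tate_def)

definition scaled_iterate :: "nat \<Rightarrow> 'a fps" where
  "scaled_iterate i = fps_const (1 / c ^ i) * fps_iterate Q i"

lemma scaled_iterate_nth_0 [simp]: "scaled_iterate i $ 0 = 0"
  using Q_props by (simp add: scaled_iterate_def)

lemma scaled_iterate_nth_1: "scaled_iterate i $ Suc 0 = 1"
  using Q_props c fps_iterate_nth_1[of Q i] by (simp add: scaled_iterate_def)

lemma scaled_iterate_compose: "scaled_iterate i oo Q = fps_const c * scaled_iterate (Suc i)"
  using Q_props c
  by (simp add: scaled_iterate_def fps_const_mult_compose fps_iterate_compose mult.assoc[symmetric])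

text \<open>Expand the outer Q in Q(Q^i). Its linear term c T reproduces
  \<open>scaled_iterate i\<close>, and the term of degree j keeps c^(ij) / c^(i+1), which for j at
  least 2 is c^(i(j-2)) times c^i / c.\<close>

lemma scaled_iterate_Suc_diff:
  "scaled_iterate (Suc i) $ k - scaled_iterate i $ k =
     (\<Sum>j=2..k. Q $ j * c ^ (i * (j - 2)) * (scaled_iterate i ^ j) $ k * (c ^ i / c))"
proof -
  have it: "fps_iterate Q i = fps_const (c ^ i) * scaled_iterate i"
    using c by (simp add: scaled_iterate_def mult.assoc[symmetric])
  have "scaled_iterate (Suc i) $ k = (\<Sum>j=0..k. 1 / c ^ Suc i * (Q $ j * (c ^ (i * j) * (scaled_iterate i ^ j) $ k)))"
    by (simp add: scaled_iterate_def[of "Suc i"] fps_iterate_Suc fps_compose_nth it power_mult_distrib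
        power_mult fps_const_power sum_distrib_left del: power_Suc)
  also have "\<dots> = scaled_iterate i $ k +
     (\<Sum>j=2..k. 1 / c ^ Suc i * (Q $ j * (c ^ (i * j) * (scaled_iterate i ^ j) $ k)))"
  proof (cases "k = 0")
    case False
    then have "{0..k} = insert 0 (insert 1 {2..k})" by auto
    then show ?thesis
      using Q_props c by simp
  qed (use Q_props in simp)
  also have "(\<Sum>j=2..k. 1 / c ^ Suc i * (Q $ j * (c ^ (i * j) * (scaled_iterate i ^ j) $ k))) =
     (\<Sum>j=2..k. Q $ j * c ^ (i * (j - 2)) * (scaled_iterate i ^ j) $ k * (c ^ i / c))"
  proof (rule sum.cong)
    fix j assume "j \<in> {2..k}"
    then obtain j' where "j = j' + 2"
      by (metis atLeastAtMost_iff le_iff_add add.commute)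
    then show "1 / c ^ Suc i * (Q $ j * (c ^ (i * j) * (scaled_iterate i ^ j) $ k)) =
        Q $ j * c ^ (i * (j - 2)) * (scaled_iterate i ^ j) $ k * (c ^ i / c)"
      using c by (simp add: field_simps power_add power_mult_distrib power2_eq_square)
  qed simp
  finally show ?thesis by simp
qed

text \<open>The terms with j at least 2 involve only coefficients of degree below k, bounded
  uniformly in i by induction. Hence consecutive differences decay like |c|^i, and the k-th
  coefficients are bounded as well.\<close>

lemma scaled_iterate_bounded_diff:
  "\<exists>C\<ge>0. \<forall>i. nrm (scaled_iterate i $ k) \<le> C \<and>
     nrm (scaled_iterate (Suc i) $ k - scaled_iterate i $ k) \<le> C * nrm c ^ i"
proof (induction k rule: less_induct)
  case (less k)
  then obtain C where C: "\<And>l. l < k \<Longrightarrow> C l \<ge> 0 \<and> (\<forall>i. nrm (scaled_iterate i $ l) \<le> C l)"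
    by metis
  define B where "B = (\<Sum>l<k. C l)"
  have B: "B \<ge> 0" unfolding B_def using C by (intro sum_nonneg) auto
  have le_B: "nrm (scaled_iterate i $ l) \<le> B" if "l < k" for i l
  proof -
    have "C l \<le> B"
      unfolding B_def using C that by (intro member_le_sum) auto
    then show ?thesis using C[OF that] order_trans by blast
  qed
  \<comment> \<open>For j at most k the j-th powers contribute at most the k-th power of
    \<open>max 1 B\<close>; the division comes from the factor c^i / c.\<close>
  define D where "D = max 1 B ^ k / nrm c"
  have D: "D \<ge> 0" using B by (simp add: D_def)
  have diff: "nrm (scaled_iterate (Suc i) $ k - scaled_iterate i $ k) \<le> D * nrm c ^ i" for i
    unfolding scaled_iterate_Suc_diff
  proof (rule nrm_sum_le)
    fix j assume j: "j \<in> {2..k}"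
    define g where "g = Abs_fps (\<lambda>l. if l < k then scaled_iterate i $ l else 0)"
    have "(scaled_iterate i ^ j) $ k = (g ^ j) $ k"
      by (rule fps_power_nth_cong_less) (use j in \<open>auto simp: g_def\<close>)
    moreover have "nrm ((g ^ j) $ k) \<le> max 1 B ^ j"
      using B le_B by (intro nrm_power_nth_le) (auto simp: g_def)
    moreover have "max 1 B ^ j \<le> max 1 B ^ k"
      using j by (intro power_increasing) auto
    ultimately have 1: "nrm ((scaled_iterate i ^ j) $ k) \<le> max 1 B ^ k" by simp
    have "nrm (Q $ j * c ^ (i * (j - 2))) \<le> 1"
      using nrm_R fps_overD[OF Q_props(1)] nrm_c
      by (auto simp: nrm_mult nrm_power intro!: mult_le_one power_le_one)
    then have "nrm (Q $ j * c ^ (i * (j - 2))) * nrm ((scaled_iterate i ^ j) $ k) \<le> 1 * max 1 B ^ k"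
      using 1 by (intro mult_mono) auto
    then have "nrm (Q $ j * c ^ (i * (j - 2)) * (scaled_iterate i ^ j) $ k) * (nrm c ^ i / nrm c)
        \<le> max 1 B ^ k * (nrm c ^ i / nrm c)"
      by (intro mult_right_mono) (auto simp: nrm_mult)
    then show "nrm (Q $ j * c ^ (i * (j - 2)) * (scaled_iterate i ^ j) $ k * (c ^ i / c)) \<le> D * nrm c ^ i"
      unfolding nrm_mult[of _ "c ^ i / c"] nrm_divide nrm_power D_def by (simp add: mult_ac)
  qed (use D in simp)
  define M where "M = max (nrm (scaled_iterate 0 $ k)) D"
  have "nrm (scaled_iterate i $ k) \<le> M" for i
  proof (induction i)
    case (Suc i)
    have "D * nrm c ^ i \<le> D * 1"
      using D nrm_c by (intro mult_left_mono power_le_one) auto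
    then have "nrm (scaled_iterate (Suc i) $ k - scaled_iterate i $ k) \<le> M"
      using diff[of i] by (simp add: M_def)
    from nrm_add_le[OF this Suc] show ?case by simp
  qed (simp add: M_def)
  moreover have "nrm (scaled_iterate (Suc i) $ k - scaled_iterate i $ k) \<le> M * nrm c ^ i" for i
    using diff[of i] mult_right_mono[of D M "nrm c ^ i"] by (simp add: M_def)
  moreover have "M \<ge> 0" using D by (simp add: M_def)
  ultimately show ?case by blast
qed

lemma scaled_iterate_diff_null:
  "(\<lambda>i. scaled_iterate (Suc i) $ k - scaled_iterate i $ k) \<longlonglongrightarrow> 0"
proof -
  obtain C where C: "C \<ge> 0"
      "\<And>i. nrm (scaled_iterate (Suc i) $ k - scaled_iterate i $ k) \<le> C * nrm c ^ i"
    using scaled_iterate_bounded_diff[of k] by blast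
  show ?thesis
    unfolding tendsto_0_iff
  proof (rule tendsto_sandwich[where f = "\<lambda>_. 0"])
    show "(\<lambda>i. C * nrm c ^ i) \<longlonglongrightarrow> 0"
      using nrm_c by (intro tendsto_mult_right_zero LIMSEQ_power_zero) simp
  qed (use C in simp_all)
qed

definition logarithm :: "'a fps" where
  "logarithm = Abs_fps (\<lambda>k. lim (\<lambda>i. scaled_iterate i $ k))"

lemma logarithm_nth: "(\<lambda>i. scaled_iterate i $ k) \<longlonglongrightarrow> logarithm $ k"
  using Cauchy_convergent[OF ultra_Cauchy[OF scaled_iterate_diff_null]]
  by (simp add: logarithm_def convergent_LIMSEQ_iff)

lemma logarithm_nth_0: "logarithm $ 0 = 0"
  using logarithm_nth[of 0] by (simp add: LIMSEQ_const_iff)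

lemma logarithm_nth_1: "logarithm $ Suc 0 = 1"
  using logarithm_nth[of "Suc 0"] by (simp add: LIMSEQ_const_iff scaled_iterate_nth_1)

text \<open>The relation \<open>scaled_iterate_compose\<close> passes to the limit, as each
  coefficient of a composite is a finite linear combination.\<close>

lemma logarithm_compose: "logarithm oo Q = fps_const c * logarithm"
proof (rule fps_ext)
  fix k
  have "(\<lambda>i. (scaled_iterate i oo Q) $ k) \<longlonglongrightarrow> (logarithm oo Q) $ k"
    unfolding fps_compose_nth
    using ultra_tendsto_cmult[OF logarithm_nth] by (intro ultra_tendsto_sum) (simp add: mult.commute)
  moreover have "(\<lambda>i. (scaled_iterate i oo Q) $ k) \<longlonglongrightarrow> c * logarithm $ k"
    unfolding scaled_iterate_compose fps_mult_left_const_nth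
    by (intro ultra_tendsto_cmult LIMSEQ_Suc logarithm_nth)
  ultimately show "(logarithm oo Q) $ k = (fps_const c * logarithm) $ k"
    using LIMSEQ_unique by fastforce
qed

text \<open>The coefficient of X^(q^i) is Q^i(T)/c^i, for all i without an upper limit. The finite
  range is enough because i is at most q^i.\<close>

definition iterate_sum :: "'a fps fps" where
  "iterate_sum = Abs_fps (\<lambda>j. \<Sum>i\<le>j. if q ^ i = j then scaled_iterate i else 0)"

definition dwork_exponent :: "'a fps fps" where
  "dwork_exponent = iterate_sum - (iterate_sum oo fps_X ^ q)"

lemma iterate_sum_nth_power: "iterate_sum $ (q ^ i) = scaled_iterate i"
  by (simp add: iterate_sum_def q_power_eq_iff le_q_power)

lemma iterate_sum_nth_other: "(\<And>i. j \<noteq> q ^ i) \<Longrightarrow> iterate_sum $ j = 0"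
  by (simp add: iterate_sum_def eq_commute[of "q ^ _" j])

lemma iterate_sum_nth_0 [simp]: "iterate_sum $ 0 = 0"
  using q_pos by (intro iterate_sum_nth_other) (metis not_less_zero zero_less_power)

text \<open>The twist turns the i-th term into c times the next one, so the difference telescopes to
  the term i = 0, which is c T X.\<close>

lemma iterate_sum_equation:
  "fps_const (fps_const c) * iterate_sum - (fps_map (\<lambda>f. f oo Q) iterate_sum oo fps_X ^ q) =
     fps_const (fps_const c) * (fps_const fps_X * fps_X)"
proof (rule fps_ext)
  fix j
  have rhs: "(fps_const (fps_const c) * (fps_const fps_X * fps_X)) $ j = (if j = 1 then fps_const c * fps_X else 0 :: 'a fps)"
    by (auto simp: fps_X_def)
  consider (one) "j = 1" | (power) i where "j = q ^ Suc i" | (other) "\<And>i. j \<noteq> q ^ i"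
    by (metis power_0 not0_implies_Suc)
  then show "(fps_const (fps_const c) * iterate_sum - (fps_map (\<lambda>f. f oo Q) iterate_sum oo fps_X ^ q)) $ j =
     (fps_const (fps_const c) * (fps_const fps_X * fps_X)) $ j"
  proof cases
    case one
    then show ?thesis
      using iterate_sum_nth_power[of 0] q_gt_1 q_pos by (simp add: fps_compose_X_power_nth scaled_iterate_def)
  next
    case power
    then have "j \<noteq> 1" using q_gt_1 by (metis nat.distinct(1) power_0 q_power_eq_iff)
    moreover have "q dvd j" "j div q = q ^ i"
      using power q_pos by simp_all
    ultimately show ?thesis
      using q_pos iterate_sum_nth_power[of "Suc i", folded power]
      by (simp add: rhs fps_compose_X_power_nth iterate_sum_nth_power scaled_iterate_compose)
  next
    case other
    have "iterate_sum $ (j div q) = 0" if "q dvd j"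
      using that other by (intro iterate_sum_nth_other) (metis dvd_mult_div_cancel power_Suc)
    moreover have "j \<noteq> 1" using other[of 0] by simp
    ultimately show ?thesis
      using other q_pos by (simp add: fps_compose_X_power_nth iterate_sum_nth_other)
  qed
qed

text \<open>The twist commutes with replacing X by X^q, so \<open>iterate_sum_equation\<close>
  applies to both parts of the exponent and leaves c (T X - T X^q).\<close>

lemma dwork_exponent_equation:
  "fps_const (fps_const c) * dwork_exponent - (fps_map (\<lambda>f. f oo Q) dwork_exponent oo fps_X ^ q)
     \<in> multiples (fps_const (fps_const c)) (fps_over (fps_over R))"
proof -
  let ?\<sigma> = "\<lambda>f. f oo Q" and ?C = "fps_const (fps_const c) :: 'a fps fps" and ?X = "fps_X ^ q :: 'a fps fps"
  let ?D = "fps_const fps_X * fps_X :: 'a fps fps"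
  interpret \<sigma>: unital_ring_hom ?\<sigma>
    using Q_props by (intro hom_fps_compose)
  have map_diff: "fps_map ?\<sigma> (f - g) = fps_map ?\<sigma> f - fps_map ?\<sigma> g" for f g
    by (simp add: fps_eq_iff fps_compose_sub_distrib)
  have X: "fps_map ?\<sigma> ?X = ?X"
    unfolding \<sigma>.fps_map_power by (rule arg_cong[where f = "\<lambda>x. x ^ q"]) (simp add: fps_eq_iff fps_X_def)
  have "fps_map ?\<sigma> dwork_exponent oo ?X =
      (fps_map ?\<sigma> iterate_sum oo ?X) - (fps_map ?\<sigma> iterate_sum oo ?X oo ?X)"
    by (simp add: dwork_exponent_def map_diff \<sigma>.fps_map_compose X fps_compose_sub_distrib)
  then have "?C * dwork_exponent - (fps_map ?\<sigma> dwork_exponent oo ?X) =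
     (?C * iterate_sum - (fps_map ?\<sigma> iterate_sum oo ?X)) -
     ((?C * iterate_sum - (fps_map ?\<sigma> iterate_sum oo ?X)) oo ?X)"
    by (simp add: dwork_exponent_def fps_compose_sub_distrib fps_const_mult_compose algebra_simps)
  also have "\<dots> = ?C * (?D - (?D oo ?X))"
    unfolding iterate_sum_equation fps_const_mult_compose by (simp add: algebra_simps)
  also have "\<dots> \<in> multiples ?C (fps_over (fps_over R))"
  proof -
    have D: "?D \<in> fps_over (fps_over R)"
      using X_in_fps_over subring_0[OF subring1] by (auto simp: fps_over_def[of "fps_over R"])
    have "?X \<in> fps_over (fps_over R)"
      using subring_0[OF subring1] subring_1[OF subring1] by (auto simp: fps_over_def[of "fps_over R"])
    then have "?D - (?D oo ?X) \<in> fps_over (fps_over R)"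
      using D by (intro subring_diff[OF subring2] fps_over_compose subring1)
    then show ?thesis
      unfolding multiples_def by (rule imageI)
  qed
  finally show ?thesis .
qed

lemma dwork_exponent_nth_0 [simp]: "dwork_exponent $ 0 = 0"
  by (simp add: dwork_exponent_def)

lemma dwork_exponent_nth_power_0: "dwork_exponent $ 1 = scaled_iterate 0"
  using q_gt_1 q_pos iterate_sum_nth_power[of 0]
  by (simp add: dwork_exponent_def fps_compose_X_power_nth)

lemma dwork_exponent_nth_power_Suc:
  "dwork_exponent $ (q ^ Suc i) = scaled_iterate (Suc i) - scaled_iterate i"
  using q_pos iterate_sum_nth_power[of "Suc i"] iterate_sum_nth_power[of i]
  by (simp add: dwork_exponent_def fps_compose_X_power_nth)

lemma dwork_exponent_nth_other:
  assumes "\<And>i. j \<noteq> q ^ i"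
  shows "dwork_exponent $ j = 0"
proof -
  have "iterate_sum $ (j div q) = 0" if "q dvd j"
    using that assms by (intro iterate_sum_nth_other) (metis dvd_mult_div_cancel power_Suc)
  then show ?thesis
    using assms q_pos by (simp add: dwork_exponent_def fps_compose_X_power_nth iterate_sum_nth_other)
qed

lemma dwork_exponent_nth_nth_0 [simp]: "dwork_exponent $ j $ 0 = 0"
proof -
  have "iterate_sum $ i $ 0 = 0" for i
    by (simp add: iterate_sum_def fps_sum_nth if_distrib[of "\<lambda>f. f $ 0"] cong: if_cong)
  then show ?thesis
    using q_pos by (simp add: dwork_exponent_def fps_compose_X_power_nth)
qed

text \<open>The exponent has nonzero coefficients only at powers of q, where they are consecutive
  differences of scaled iterates. Its partial sums up to q^i telescope to
  \<open>scaled_iterate i\<close>.\<close>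

lemma column_sums_dwork_exponent: "column_sums dwork_exponent logarithm"
  unfolding column_sums_def
proof (intro allI conjI)
  fix k
  let ?s = "\<lambda>j. dwork_exponent $ j $ k"
  show null: "?s \<longlonglongrightarrow> 0"
  proof (rule LIMSEQ_0_leI)
    fix \<epsilon> :: real assume e: "\<epsilon> > 0"
    then obtain N where N: "\<And>i. i \<ge> N \<Longrightarrow> nrm (scaled_iterate (Suc i) $ k - scaled_iterate i $ k) \<le> \<epsilon>"
      using LIMSEQ_0_leD[OF scaled_iterate_diff_null] by blast
    have "nrm (?s j) \<le> \<epsilon>" if j: "j > q ^ N" for j
    proof (cases "\<exists>i. j = q ^ i")
      case True
      then obtain i where i: "j = q ^ i" by auto
      with j q_gt_1 have "i > N" by (metis power_strict_increasing_iff)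
      then obtain i' where "i = Suc i'" "i' \<ge> N" by (cases i) auto
      then show ?thesis
        using N[of i'] unfolding i by (simp add: dwork_exponent_nth_power_Suc del: power_Suc)
    qed (use e dwork_exponent_nth_other in auto)
    then show "\<exists>N. \<forall>j\<ge>N. nrm (?s j) \<le> \<epsilon>"
      by (intro exI[of _ "Suc (q ^ N)"]) auto
  qed
  have partial: "sum ?s {..<Suc (q ^ i)} = scaled_iterate i $ k" for i
  proof (induction i)
    case 0
    then show ?case using dwork_exponent_nth_power_0 by simp
  next
    case (Suc i)
    have lt: "q ^ i < q ^ Suc i"
      using q_gt_1 by (intro power_strict_increasing) auto
    have "Suc (q ^ i) \<le> Suc (q ^ Suc i)"
      using lt by linarith
    then have "sum ?s {..<Suc (q ^ Suc i)} = sum ?s {..<Suc (q ^ i)} + sum ?s {Suc (q ^ i)..<Suc (q ^ Suc i)}"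
      using sum.atLeastLessThan_concat[of 0 "Suc (q ^ i)" "Suc (q ^ Suc i)" ?s]
      by (simp add: atLeast0LessThan del: power_Suc sum.lessThan_Suc sum.op_ivl_Suc)
    also have "sum ?s {Suc (q ^ i)..<Suc (q ^ Suc i)} = sum ?s {q ^ Suc i}"
    proof (rule sum.mono_neutral_right)
      show "\<forall>j\<in>{Suc (q ^ i)..<Suc (q ^ Suc i)} - {q ^ Suc i}. ?s j = 0"
      proof
        fix j assume j: "j \<in> {Suc (q ^ i)..<Suc (q ^ Suc i)} - {q ^ Suc i}"
        have "j \<noteq> q ^ l" for l
        proof
          assume "j = q ^ l"
          with j have "q ^ i < q ^ l" "q ^ l < q ^ Suc i" by auto
          then have "i < l" "l < Suc i"
            using q_gt_1 power_strict_increasing_iff by blast+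
          then show False by simp
        qed
        then show "?s j = 0" by (simp add: dwork_exponent_nth_other)
      qed
    qed (use lt in \<open>auto simp del: power_Suc\<close>)
    finally show ?case
      using Suc by (simp add: dwork_exponent_nth_power_Suc del: power_Suc sum.lessThan_Suc sum.op_ivl_Suc)
  qed
  \<comment> \<open>Convergence is already known, so the sum may be computed along the partial sums
    ending at powers of q.\<close>
  have "?s sums suminf ?s" by (rule ultra_sums[OF null])
  moreover have "strict_mono (\<lambda>i. Suc (q ^ i))"
    using q_gt_1 by (auto simp: strict_mono_def)
  ultimately have "((\<lambda>n. sum ?s {..<n}) \<circ> (\<lambda>i. Suc (q ^ i))) \<longlonglongrightarrow> suminf ?s"
    unfolding sums_def by (rule LIMSEQ_subseq_LIMSEQ)
  then have "(\<lambda>i. scaled_iterate i $ k) \<longlonglongrightarrow> suminf ?s"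
    by (simp only: o_def partial)
  then have "suminf ?s = logarithm $ k"
    using logarithm_nth LIMSEQ_unique by blast
  with \<open>?s sums suminf ?s\<close> show "?s sums (logarithm $ k)" by simp
qed

end

end

section \<open>The intertwining series and its values at the roots\<close>

context ultrametric_lubin_tate
begin

lemma fps_iterate_integral: "f \<in> fps_over R \<Longrightarrow> fps_iterate f i \<in> fps_over R"
  by (induction i) (simp_all add: fps_iterate_Suc X_in_fps_over fps_over_compose[OF subring])

lemma fps_value_iterate_Suc:
  assumes "f \<in> fps_over R" "f $ 0 = 0" "nrm x < 1"
  shows "fps_value (fps_iterate f (Suc i)) x = fps_value f (fps_value (fps_iterate f i) x)"
  unfolding fps_iterate_Suc using assms
  by (intro fps_value_compose) (auto intro!: fps_over_R_integers fps_iterate_integral)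

lemma fps_value_lubin_tate_0: "lubin_tate Q \<Longrightarrow> fps_value Q 0 = 0"
  by (simp add: lubin_tate_def)

text \<open>Each application of Q moves one root down, and 0 stays at 0. The hypotheses stop at m so
  that the lemma also covers a series sharing only the values at the first m roots.\<close>

lemma fps_value_iterate_root:
  assumes Q: "lubin_tate Q"
    and \<omega>: "\<And>i. 1 \<le> i \<Longrightarrow> i \<le> m \<Longrightarrow> nrm (\<omega> i) < 1"
    and \<omega>_1: "fps_value Q (\<omega> 1) = 0"
    and \<omega>_Suc: "\<And>i. 1 \<le> i \<Longrightarrow> i < m \<Longrightarrow> fps_value Q (\<omega> (i + 1)) = \<omega> i"
    and m: "m > 0"
  shows "fps_value (fps_iterate Q i) (\<omega> m) = (if i < m then \<omega> (m - i) else 0)"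
proof (induction i)
  case (Suc i)
  have "fps_value (fps_iterate Q (Suc i)) (\<omega> m) = fps_value Q (fps_value (fps_iterate Q i) (\<omega> m))"
    using Q \<omega>[of m] m by (intro fps_value_iterate_Suc) (auto simp: lubin_tate_def)
  also have "\<dots> = (if Suc i < m then \<omega> (m - Suc i) else 0)"
  proof -
    consider "m \<le> i" | "m = Suc i" | "Suc i < m" by linarith
    then show ?thesis
    proof cases
      case 3
      then have "m - i = (m - Suc i) + 1" by linarith
      then have "fps_value Q (\<omega> (m - i)) = \<omega> (m - Suc i)"
        using \<omega>_Suc[of "m - Suc i"] 3 by simp
      then show ?thesis
        using 3 Suc by simp
    qed (use Suc fps_value_lubin_tate_0[OF Q] \<omega>_1 in simp_all)
  qed
  finally show ?case .
qed (use m in simp)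

context
  fixes P e Q :: "'a fps"
  assumes P: "lubin_tate P" and Q: "lubin_tate Q"
    and e: "e $ 0 = 0" "e $ 1 = 1" and Pe: "P oo e = e oo (fps_const c * fps_X)"
begin

text \<open>In Lubin-Tate theory this is the isomorphism with derivative 1 from the formal group of
  Q to that of P.\<close>

definition intertwiner :: "'a fps" where "intertwiner = e oo logarithm Q"

lemma intertwiner_nth_0 [simp]: "intertwiner $ 0 = 0"
  using e by (simp add: intertwiner_def)

lemma intertwiner_nth_1 [simp]: "intertwiner $ Suc 0 = 1"
  using e logarithm_nth_0[OF Q] logarithm_nth_1[OF Q] by (simp add: intertwiner_def fps_compose_nth)

text \<open>The logarithm of Q turns Q into multiplication by c, and e turns multiplication by c
  into P.\<close>

lemma intertwiner_intertwines: "P oo intertwiner = intertwiner oo Q"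
proof -
  have "P oo intertwiner = (e oo (fps_const c * fps_X)) oo logarithm Q"
    unfolding intertwiner_def Pe[symmetric] using e logarithm_nth_0[OF Q] by (intro fps_compose_assoc) auto
  also have "\<dots> = e oo ((fps_const c * fps_X) oo logarithm Q)"
    using logarithm_nth_0[OF Q] by (intro fps_compose_assoc[symmetric]) auto
  also have "(fps_const c * fps_X) oo logarithm Q = logarithm Q oo Q"
    using logarithm_nth_0[OF Q] by (simp add: fps_const_mult_compose logarithm_compose[OF Q])
  also have "e oo (logarithm Q oo Q) = intertwiner oo Q"
    unfolding intertwiner_def using Q logarithm_nth_0[OF Q] by (intro fps_compose_assoc) (auto simp: lubin_tate_def)
  finally show ?thesis .
qed

definition two_var_series :: "'a fps fps" where "two_var_series = fps_map fps_const e oo dwork_exponent Q"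

text \<open>The inverse series of e serves as the logarithm of P; its functional equation follows
  from \<open>Pe\<close> by cancelling e on the right.\<close>

lemma two_var_series_integral: "two_var_series \<in> fps_over (fps_over R)"
  unfolding two_var_series_def
proof (rule functional_equation[OF P, where l = "fps_inv e"])
  have e1: "e $ 1 \<noteq> 0" using e by simp
  show l0: "fps_inv e $ 0 = 0" by (simp add: fps_inv_def)
  show "fps_inv e $ 1 = 1"
    using e by (simp add: fps_inv_def)
  show le: "fps_inv e oo e = fps_X" and "e oo fps_inv e = fps_X"
    using fps_inv[OF e(1) e1] fps_inv_right[OF e(1) e1] by auto
  show "fps_inv e oo P = fps_const c * fps_inv e"
  proof -
    have "(fps_inv e oo P) oo e = fps_inv e oo (e oo (fps_const c * fps_X))"
      unfolding Pe[symmetric] using P e by (intro fps_compose_assoc[symmetric]) (auto simp: lubin_tate_def)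
    also have "\<dots> = (fps_inv e oo e) oo (fps_const c * fps_X)"
      using e by (intro fps_compose_assoc) auto
    also have "\<dots> = (fps_const c * fps_inv e) oo e"
      by (simp add: le fps_const_mult_compose)
    finally show ?thesis
      using fps_compose_inj_right[OF e(1) e1] by blast
  qed
qed (use e Q dwork_exponent_nth_0[OF Q] dwork_exponent_equation[OF Q] in \<open>simp_all add: fps_over_def\<close>)

lemma two_var_series_column_sums: "column_sums two_var_series intertwiner"
  unfolding two_var_series_def intertwiner_def
  using column_sums_dwork_exponent[OF Q] dwork_exponent_nth_0[OF Q] dwork_exponent_nth_nth_0[OF Q]
  by (intro column_sums_compose)

text \<open>Both e and the logarithm may have denominators. Integrality is inherited from the
  two-variable series, whose columns sum to the coefficients.\<close>

lemma intertwiner_integral: "intertwiner \<in> fps_over integers"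
proof (rule fps_overI)
  fix k
  have *: "(\<lambda>j. two_var_series $ j $ k) \<longlonglongrightarrow> 0" "(\<Sum>j. two_var_series $ j $ k) = intertwiner $ k"
    using two_var_series_column_sums by (auto simp: column_sums_def sums_iff)
  have "nrm (two_var_series $ j $ k) \<le> 1" for j
    using two_var_series_integral R_integers by (auto simp: fps_over_def integers_def)
  then show "intertwiner $ k \<in> integers"
    using suminf_nrm_le[OF *(1), of 1] by (simp add: *(2) integers_def)
qed

text \<open>Having coefficients in R rather than merely of norm at most 1 is what later shows that
  the values are algebraic.\<close>

lemma intertwiner_over:
  assumes "closed R"
  shows "intertwiner \<in> fps_over R"
proof (rule fps_overI)
  fix k
  have lim: "(\<lambda>n. \<Sum>j<n. two_var_series $ j $ k) \<longlonglongrightarrow> intertwiner $ k"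
    using two_var_series_column_sums by (simp add: column_sums_def sums_def)
  have mem: "(\<Sum>j<n. two_var_series $ j $ k) \<in> R" for n
    using two_var_series_integral by (intro subring_sum[OF subring]) (auto simp: fps_over_def)
  show "intertwiner $ k \<in> R"
    by (rule closed_sequentially[OF assms mem lim])
qed

lemma fps_value_P_intertwiner:
  assumes "nrm x < 1"
  shows "fps_value P (fps_value intertwiner x) = fps_value intertwiner (fps_value Q x)"
proof -
  have "fps_value P (fps_value intertwiner x) = fps_value (P oo intertwiner) x"
    using P assms by (intro fps_value_compose[symmetric] intertwiner_integral fps_over_R_integers)
      (auto simp: lubin_tate_def)
  also have "\<dots> = fps_value intertwiner (fps_value Q x)"
    unfolding intertwiner_intertwines using Q assms
    by (intro fps_value_compose intertwiner_integral fps_over_R_integers) (auto simp: lubin_tate_def)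
  finally show ?thesis .
qed

lemma nrm_intertwiner_less: "nrm x < 1 \<Longrightarrow> nrm (fps_value intertwiner x) < 1"
  using nrm_fps_value_le[OF intertwiner_integral, of x 1] by simp

lemma nrm_pos: "x \<noteq> 0 \<Longrightarrow> 0 < nrm x"
  using nrm_ge_0[of x] nrm_eq_0[of x] by linarith

text \<open>The part of degree at least 2 has value at most |x|^2, so the linear term x determines
  the norm.\<close>

lemma fps_value_intertwiner_neq_0:
  assumes "nrm x < 1" "x \<noteq> 0"
  shows "fps_value intertwiner x \<noteq> 0"
proof -
  define \<psi> where "\<psi> = intertwiner - fps_X"
  have X: "fps_X \<in> fps_over integers"
    by (rule fps_over_R_integers[OF X_in_fps_over])
  have \<psi>: "\<psi> \<in> fps_over integers"
    unfolding \<psi>_def by (intro subring_diff is_subring_fps_over is_subring_integers intertwiner_integral X)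
  have "\<psi> $ k = 0" if "k < 2" for k
    using that by (auto simp: \<psi>_def less_2_cases_iff)
  then have "nrm (fps_value \<psi> x) \<le> nrm x ^ 2"
    by (intro nrm_fps_value_le \<psi> assms(1))
  also have "\<dots> < nrm x"
    using assms mult_strict_left_mono[of "nrm x" 1 "nrm x"] by (simp add: power2_eq_square nrm_pos)
  finally have "nrm (x + fps_value \<psi> x) = nrm x"
    by (rule nrm_add_eq)
  moreover have "fps_value intertwiner x = x + fps_value \<psi> x"
    using fps_value_add[OF integral_null_at[OF X assms(1)] integral_null_at[OF \<psi> assms(1)]]
    by (simp add: \<psi>_def)
  ultimately show ?thesis
    using assms(2) nrm_eq_0 by metis
qed

context
  fixes \<omega> :: "nat \<Rightarrow> 'a" and m :: nat
  assumes \<omega>: "\<And>i. 1 \<le> i \<Longrightarrow> i \<le> m \<Longrightarrow> nrm (\<omega> i) < 1"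
    and \<omega>_1: "fps_value Q (\<omega> 1) = 0"
    and \<omega>_Suc: "\<And>i. 1 \<le> i \<Longrightarrow> i < m \<Longrightarrow> fps_value Q (\<omega> (i + 1)) = \<omega> i"
    and m: "m > 0"
begin

lemmas value_iterate = fps_value_iterate_root[OF Q \<omega> \<omega>_1 \<omega>_Suc m]

text \<open>Substitution of \<open>\<omega> m\<close> for T, separately in the coefficient of each
  power of X.\<close>

definition evaluates_to :: "'a fps fps \<Rightarrow> 'a fps \<Rightarrow> bool" where
  "evaluates_to F f \<longleftrightarrow> (\<forall>j. null_at (\<omega> m) (F $ j) \<and> fps_value (F $ j) (\<omega> m) = f $ j)"

lemma evaluates_to_mult: "evaluates_to F f \<Longrightarrow> evaluates_to G g \<Longrightarrow> evaluates_to (F * G) (f * g)"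
  unfolding evaluates_to_def fps_mult_nth
  by (auto simp: fps_value_sum null_at_mult fps_value_mult intro!: null_at_sum)

lemma evaluates_to_power: "evaluates_to F f \<Longrightarrow> evaluates_to (F ^ n) (f ^ n)"
proof (induction n)
  case 0
  then show ?case by (simp add: evaluates_to_def)
qed (simp add: evaluates_to_mult)

lemma evaluates_to_diff:
  assumes "evaluates_to F f" "evaluates_to G g"
  shows "evaluates_to (F - G) (f - g)"
proof -
  have *: "F $ j - G $ j = F $ j + fps_const (-1) * G $ j" for j
    by (simp flip: fps_const_neg)
  show ?thesis
    using assms unfolding evaluates_to_def fps_sub_nth *
    by (auto simp: fps_value_add null_at_mult fps_value_mult intro!: null_at_add)
qed

lemma evaluates_to_compose_const:
  assumes "evaluates_to F f"
  shows "evaluates_to (fps_map fps_const g oo F) (g oo f)"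
proof -
  have "null_at (\<omega> m) ((F ^ a) $ j)" "fps_value ((F ^ a) $ j) (\<omega> m) = (f ^ a) $ j" for a j
    using evaluates_to_power[OF assms, of a] by (auto simp: evaluates_to_def)
  then show ?thesis
    unfolding evaluates_to_def fps_compose_nth
    by (auto simp: fps_value_sum null_at_mult fps_value_mult intro!: null_at_sum)
qed

text \<open>The infinite sum over iterates becomes the sum over i < m, because the i-th iterate of Q
  vanishes at \<open>\<omega> m\<close> for i at least m.\<close>

lemma evaluates_to_exponent:
  "evaluates_to (dwork_exponent Q) (\<Sum>i<m. fps_const (\<omega> (m - i) / c ^ i) * (fps_X ^ (q ^ i) - fps_X ^ (q ^ (i + 1))))"
proof -
  define v where "v = (\<Sum>i<m. fps_const (\<omega> (m - i) / c ^ i) * fps_X ^ (q ^ i))"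
  have lam: "null_at (\<omega> m) (scaled_iterate Q i)"
    "fps_value (scaled_iterate Q i) (\<omega> m) = (if i < m then \<omega> (m - i) / c ^ i else 0)" for i
  proof -
    have "null_at (\<omega> m) (fps_iterate Q i)"
      using Q \<omega>[of m] m by (intro integral_null_at fps_over_R_integers fps_iterate_integral)
        (auto simp: lubin_tate_def)
    then show "null_at (\<omega> m) (scaled_iterate Q i)"
      "fps_value (scaled_iterate Q i) (\<omega> m) = (if i < m then \<omega> (m - i) / c ^ i else 0)"
      unfolding scaled_iterate_def[OF Q]
      by (simp_all add: null_at_mult fps_value_mult value_iterate)
  qed
  have V: "evaluates_to (iterate_sum Q) v"
    unfolding evaluates_to_def
  proof (intro allI conjI)
    fix j
    show "null_at (\<omega> m) (iterate_sum Q $ j)"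
      by (auto simp: iterate_sum_def[OF Q] lam intro!: null_at_sum)
    show "fps_value (iterate_sum Q $ j) (\<omega> m) = v $ j"
    proof (cases "\<exists>i. j = q ^ i")
      case True
      then obtain i where i: "j = q ^ i" by auto
      have "v $ j = (\<Sum>l<m. if l = i then \<omega> (m - l) / c ^ l else 0)"
        unfolding v_def fps_sum_nth by (rule sum.cong) (simp_all add: i q_power_eq_iff eq_commute[of i])
      then show ?thesis
        by (simp add: i iterate_sum_nth_power[OF Q] lam)
    next
      case False
      then have "v $ j = 0"
        by (auto simp: v_def fps_sum_nth intro!: sum.neutral)
      then show ?thesis
        using False iterate_sum_nth_other[OF Q, of j] by simp
    qed
  qed
  have "(iterate_sum Q oo fps_X ^ q) $ j = (if q dvd j then iterate_sum Q $ (j div q) else 0)"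
    "(v oo fps_X ^ q) $ j = (if q dvd j then v $ (j div q) else 0)" for j
    by (simp_all add: fps_compose_X_power_nth q_pos)
  then have "evaluates_to (iterate_sum Q oo fps_X ^ q) (v oo fps_X ^ q)"
    using V by (auto simp: evaluates_to_def)
  with V have "evaluates_to (dwork_exponent Q) (v - (v oo fps_X ^ q))"
    unfolding dwork_exponent_def[OF Q] by (intro evaluates_to_diff)
  also have "v - (v oo fps_X ^ q) =
      (\<Sum>i<m. fps_const (\<omega> (m - i) / c ^ i) * (fps_X ^ (q ^ i) - fps_X ^ (q ^ (i + 1))))"
  proof -
    have "(fps_X ^ (q ^ i) :: 'a fps) oo fps_X ^ q = fps_X ^ (q ^ (i + 1))" for i
      using q_pos fps_X_power_compose[of "fps_X ^ q :: 'a fps" "q ^ i"] by (simp flip: power_mult)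
    then show ?thesis
      unfolding v_def fps_compose_sum_distrib sum_subtractf[symmetric]
      by (simp only: fps_const_mult_compose right_diff_distrib)
  qed
  finally show ?thesis .
qed

text \<open>Sum the array \<open>?u\<close> in both orders: summing over k first gives the
  coefficients of the Dwork series, summing over j first gives the terms of the intertwiner at
  \<open>\<omega> m\<close>. Columns with large k are small by integrality, and each of the
  remaining finitely many columns tends to 0.\<close>

theorem dwork_series_value: "fps_value (dwork_series e c q \<omega> m) 1 = fps_value intertwiner (\<omega> m)"
proof -
  let ?w = "\<omega> m" and ?u = "\<lambda>j k. two_var_series $ j $ k * \<omega> m ^ k"
  have w: "nrm ?w < 1" using \<omega> m by simp
  have two_var_series: "evaluates_to two_var_series (dwork_series e c q \<omega> m)"
    unfolding two_var_series_def dwork_series_def by (intro evaluates_to_compose_const evaluates_to_exponent)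
  have col: "(\<lambda>j. two_var_series $ j $ k) \<longlonglongrightarrow> 0" "(\<lambda>j. two_var_series $ j $ k) sums (intertwiner $ k)" for k
    using two_var_series_column_sums by (auto simp: column_sums_def)
  have two_var_series_le: "nrm (two_var_series $ j $ k) \<le> 1" for j k
    using two_var_series_integral R_integers by (auto simp: fps_over_def integers_def)
  have "doubly_null ?u"
    unfolding doubly_null_def
  proof (intro allI impI)
    fix \<epsilon> :: real assume \<epsilon>: "\<epsilon> > 0"
    obtain M where M: "nrm ?w ^ M < \<epsilon>"
      using real_arch_pow_inv[OF \<epsilon> w] by blast
    have "\<exists>N. \<forall>j\<ge>N. nrm (two_var_series $ j $ k) \<le> \<epsilon>" for k
      by (rule LIMSEQ_0_leD[OF col(1) \<epsilon>])
    then obtain N where N: "\<And>j k. j \<ge> N k \<Longrightarrow> nrm (two_var_series $ j $ k) \<le> \<epsilon>"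
      by metis
    have u1: "nrm (?u j k) \<le> nrm ?w ^ k" for j k
      using mult_right_mono[OF two_var_series_le[of j k], of "nrm ?w ^ k"] by (simp add: nrm_mult nrm_power)
    have u2: "nrm (?u j k) \<le> nrm (two_var_series $ j $ k)" for j k
      using mult_left_mono[OF power_le_one[of "nrm ?w" k], of "nrm (two_var_series $ j $ k)"] w
      by (simp add: nrm_mult nrm_power)
    \<comment> \<open>The sum of the thresholds \<open>N k\<close> serves as a common bound for all
      columns k < M.\<close>
    define N' where "N' = M + (\<Sum>k<M. N k)"
    have "nrm (?u j k) \<le> \<epsilon>" if "N' \<le> j \<or> N' \<le> k" for j k
    proof (cases "M \<le> k")
      case True
      then have "nrm ?w ^ k \<le> nrm ?w ^ M"
        using w by (intro power_decreasing) auto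
      with u1[of j k] M show ?thesis by linarith
    next
      case False
      then have "N k \<le> (\<Sum>k<M. N k)"
        by (intro member_le_sum) auto
      with that False have "j \<ge> N k" by (auto simp: N'_def)
      with N[of k j] u2[of j k] show ?thesis by linarith
    qed
    then show "\<exists>N. \<forall>j k. N \<le> j \<or> N \<le> k \<longrightarrow> nrm (?u j k) \<le> \<epsilon>"
      by blast
  qed
  from suminf_swap[OF this] have "(\<Sum>j. \<Sum>k. ?u j k) = (\<Sum>k. \<Sum>j. ?u j k)" .
  moreover have "(\<Sum>k. ?u j k) = dwork_series e c q \<omega> m $ j" for j
    using two_var_series by (simp add: evaluates_to_def fps_value_def)
  moreover have "(\<Sum>j. ?u j k) = intertwiner $ k * ?w ^ k" for k
    using ultra_sums_cmult[OF col(2)[of k], of "?w ^ k"] by (simp add: sums_iff mult.commute)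
  ultimately show ?thesis
    by (simp add: fps_value_def)
qed

text \<open>Used for i = m, where it gives a zero, and for i = m - 1, where it gives the value at
  \<open>\<omega> 1\<close>.\<close>

lemma fps_value_iterate_intertwiner:
  "fps_value (fps_iterate P i) (fps_value intertwiner (\<omega> m)) = (if i < m then fps_value intertwiner (\<omega> (m - i)) else 0)"
proof -
  have w: "nrm (\<omega> m) < 1" using \<omega> m by simp
  have "fps_value (fps_iterate P i) (fps_value intertwiner (\<omega> m)) = fps_value intertwiner (fps_value (fps_iterate Q i) (\<omega> m))"
  proof (induction i)
    case (Suc i)
    have "nrm (fps_value (fps_iterate Q i) (\<omega> m)) < 1"
      using \<omega>[of "m - i"] by (simp add: value_iterate)
    then show ?case
      using P Q Suc w by (simp add: fps_value_iterate_Suc fps_value_P_intertwiner nrm_intertwiner_less lubin_tate_def)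
  qed simp
  then show ?thesis
    by (simp add: value_iterate)
qed

end

end

end

section \<open>The exponential of the formal group\<close>

text \<open>Only the parts of degree \<open>0\<close> and \<open>1\<close> in \<open>Y\<close> of the defining identities are needed: they
  give the differential equation satisfied by the exponential.\<close>

definition deg0_part :: "'a::field fps fps fps \<Rightarrow> 'a fps" where
  "deg0_part G = Abs_fps (\<lambda>i. G $ i $ 0 $ 0)"

definition deg1_part :: "'a::field fps fps fps \<Rightarrow> 'a fps" where
  "deg1_part G = Abs_fps (\<lambda>i. G $ i $ 1 $ 0)"

lemma deg0_part_nth: "deg0_part G $ i = G $ i $ 0 $ 0"
  and deg1_part_nth: "deg1_part G $ i = G $ i $ 1 $ 0"
  by (simp_all add: deg0_part_def deg1_part_def)

lemma deg0_part_mult: "deg0_part (G * H) = deg0_part G * deg0_part H"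
  by (simp add: deg0_part_def fps_eq_iff fps_mult_nth fps_sum_nth)

text \<open>The product rule: the part linear in Y is the partial derivative in Y at Y = Z =
  0.\<close>

lemma deg1_part_mult:
  "deg1_part (G * H) = deg1_part G * deg0_part H + deg0_part G * deg1_part H"
  by (simp add: deg0_part_def deg1_part_def fps_eq_iff fps_mult_nth fps_sum_nth sum.distrib add.commute)

lemma deg_part_1 [simp]: "deg0_part 1 = 1" "deg1_part 1 = 0"
  by (auto simp: deg0_part_def deg1_part_def fps_eq_iff)

lemma deg0_part_power: "deg0_part (G ^ n) = deg0_part G ^ n"
  by (induction n) (simp_all add: deg0_part_mult)

lemma deg1_part_power: "deg1_part (G ^ n) = of_nat n * deg0_part G ^ (n - 1) * deg1_part G"
proof (induction n)
  case (Suc n)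
  then show ?case
    by (cases n) (simp_all add: deg1_part_mult deg0_part_mult deg0_part_power algebra_simps)
qed simp

lemma deg0_part_subst1: "deg0_part (subst1 f A) = f oo deg0_part A"
proof (rule fps_ext)
  fix i
  have "(A ^ a) $ i $ 0 $ 0 = (deg0_part A ^ a) $ i" for a
    by (simp only: deg0_part_nth flip: deg0_part_power)
  moreover have "deg0_part (subst1 f A) $ i = (\<Sum>a\<le>i. f $ a * (A ^ a) $ i $ 0 $ 0)"
    by (simp add: deg0_part_nth subst1_def)
  ultimately show "deg0_part (subst1 f A) $ i = (f oo deg0_part A) $ i"
    by (simp add: fps_compose_nth atMost_atLeast0)
qed

text \<open>The cut-off N may exceed i, as it does in \<open>subst1\<close> and
  \<open>subst2\<close> for coefficients of positive degree in Y; the extra powers of B vanish up to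
  degree i.\<close>

lemma fps_compose_mult_nth:
  fixes f B C :: "'a::field fps"
  assumes "B $ 0 = 0" "i \<le> N"
  shows "((f oo B) * C) $ i = (\<Sum>a\<le>N. f $ a * (B ^ a * C) $ i)"
proof -
  have "(f oo B) $ l = (\<Sum>a\<le>N. f $ a * (B ^ a) $ l)" if "l \<le> i" for l
    unfolding fps_compose_nth using that assms startsby_zero_power_prefix[OF assms(1)]
    by (intro sum.mono_neutral_left) auto
  then have "((f oo B) * C) $ i = (\<Sum>l=0..i. (\<Sum>a\<le>N. f $ a * (B ^ a) $ l) * C $ (i - l))"
    by (simp add: fps_mult_nth)
  also have "\<dots> = (\<Sum>a\<le>N. f $ a * (B ^ a * C) $ i)"
    by (simp add: fps_mult_nth sum_distrib_left sum_distrib_right mult.assoc sum.swap[of _ "{0..i}"])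
  finally show ?thesis .
qed

lemma deg1_part_subst1:
  assumes "deg0_part A $ 0 = 0"
  shows "deg1_part (subst1 f A) = (fps_deriv f oo deg0_part A) * deg1_part A"
proof (rule fps_ext)
  fix i
  have nth: "(A ^ a) $ i $ 1 $ 0 = (of_nat a * deg0_part A ^ (a - 1) * deg1_part A) $ i" for a
    by (simp only: deg1_part_nth flip: deg1_part_power)
  have "deg1_part (subst1 f A) $ i = (\<Sum>a\<le>Suc i. f $ a * (of_nat a * deg0_part A ^ (a - 1) * deg1_part A) $ i)"
    unfolding nth[symmetric] by (simp add: deg1_part_nth subst1_def)
  \<comment> \<open>The cut-off is i + 1 because a coefficient of Y is read. The term a = 0 carries
    the factor 0, so the shifted index ends at i.\<close>
  also have "\<dots> = (\<Sum>a\<le>i. f $ Suc a * (of_nat (Suc a) * deg0_part A ^ a * deg1_part A) $ i)"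
    by (subst sum.atMost_Suc_shift) simp
  also have "\<dots> = (\<Sum>a\<le>i. fps_deriv f $ a * (deg0_part A ^ a * deg1_part A) $ i)"
    by (intro sum.cong) (simp_all add: mult.assoc flip: fps_of_nat del: of_nat_Suc)
  also have "\<dots> = ((fps_deriv f oo deg0_part A) * deg1_part A) $ i"
    by (rule fps_compose_mult_nth[symmetric, OF assms order_refl])
  finally show "deg1_part (subst1 f A) $ i = ((fps_deriv f oo deg0_part A) * deg1_part A) $ i" .
qed

text \<open>For b = 1 this is the partial derivative of F in its second variable at (X,0), the
  reciprocal of the invariant differential.\<close>

definition column :: "'a::field fps fps \<Rightarrow> nat \<Rightarrow> 'a fps" where
  "column F b = Abs_fps (\<lambda>a. F $ a $ b)"

lemma deg0_part_subst2:
  assumes "deg0_part B = 0"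
  shows "deg0_part (subst2 F A B) = column F 0 oo deg0_part A"
proof (rule fps_ext)
  fix i
  have nth: "(A ^ a * B ^ b) $ i $ 0 $ 0 = (if b = 0 then (deg0_part A ^ a) $ i else 0)" for a b
  proof -
    have "(A ^ a * B ^ b) $ i $ 0 $ 0 = deg0_part (A ^ a * B ^ b) $ i"
      by (simp add: deg0_part_def)
    then show ?thesis
      using assms by (simp add: deg0_part_mult deg0_part_power power_0_left)
  qed
  have "deg0_part (subst2 F A B) $ i = (\<Sum>a\<le>i. \<Sum>b\<le>i. F $ a $ b * (A ^ a * B ^ b) $ i $ 0 $ 0)"
    by (simp add: deg0_part_nth subst2_def)
  then show "deg0_part (subst2 F A B) $ i = (column F 0 oo deg0_part A) $ i"
    by (simp add: nth fps_compose_nth column_def atMost_atLeast0 if_distrib cong: if_cong)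
qed

lemma deg1_part_subst2:
  assumes "deg0_part A $ 0 = 0" "deg1_part A = 0" "deg0_part B = 0"
  shows "deg1_part (subst2 F A B) = (column F 1 oo deg0_part A) * deg1_part B"
proof (rule fps_ext)
  fix i
  have nth: "(A ^ a * B ^ b) $ i $ 1 $ 0 = (if b = 1 then (deg0_part A ^ a * deg1_part B) $ i else 0)" for a b
  proof -
    have "(A ^ a * B ^ b) $ i $ 1 $ 0 = deg1_part (A ^ a * B ^ b) $ i"
      by (simp add: deg1_part_def)
    also have "\<dots> = (if b = 1 then (deg0_part A ^ a * deg1_part B) $ i else 0)"
      using assms(2,3) by (cases "b = 0") (simp_all add: deg1_part_mult deg0_part_power deg1_part_power power_0_left)
    finally show ?thesis .
  qed
  have "deg1_part (subst2 F A B) $ i = (\<Sum>a\<le>Suc i. column F 1 $ a * (deg0_part A ^ a * deg1_part B) $ i)"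
  proof -
    have "deg1_part (subst2 F A B) $ i = (\<Sum>a\<le>Suc i. \<Sum>b\<le>Suc i. F $ a $ b * (A ^ a * B ^ b) $ i $ 1 $ 0)"
      by (simp add: deg1_part_nth subst2_def)
    then show ?thesis
      unfolding nth by (simp add: column_def if_distrib del: sum.atMost_Suc cong: if_cong)
  qed
  also have "\<dots> = ((column F 1 oo deg0_part A) * deg1_part B) $ i"
    using assms(1) by (intro fps_compose_mult_nth[symmetric]) auto
  finally show "deg1_part (subst2 F A B) $ i = ((column F 1 oo deg0_part A) * deg1_part B) $ i" .
qed

lemma deg_part_vars:
  "deg0_part var_X = fps_X" "deg1_part var_X = 0" "deg0_part var_Y = 0" "deg1_part var_Y = 1"
  "deg0_part (var_X + var_Y) = fps_X" "deg1_part (var_X + var_Y) = 1"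
  by (auto simp: deg0_part_def deg1_part_def fps_eq_iff fps_X_def)

text \<open>The equation expresses coefficient n + 1 through the coefficients up to n.\<close>

lemma autonomous_ode_unique:
  fixes u w :: "'a::field_char_0 fps"
  assumes "u $ 0 = w $ 0" "fps_deriv u = fps_const c * (G oo u)" "fps_deriv w = fps_const c * (G oo w)"
  shows "u = w"
proof (rule fps_ext)
  show "u $ n = w $ n" for n
  proof (induction n rule: less_induct)
    case (less n)
    show ?case
    proof (cases n)
      case (Suc k)
      have "(G oo u) $ k = (G oo w) $ k"
        using less Suc by (intro fps_compose_nth_cong) auto
      then have "fps_deriv u $ k = fps_deriv w $ k"
        by (simp add: assms)
      then show ?thesis
        by (simp add: Suc del: of_nat_Suc)
    qed (use assms in simp)
  qed
qed

text \<open>With G the derivative of F in Y at (X,0) and c = P'(0), the addition law of e gives e' =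
  G(e), and the homomorphism property of P gives P' G = c G(P). Hence P(e(X)) and e(c X) solve the
  same equation y' = c G(y) with y(0) = 0.\<close>

lemma formal_group_exp_intertwines:
  fixes P e :: "'a::field_char_0 fps"
  assumes F: "lubin_tate_formal_group v K P F" and e: "formal_group_exp K F e"
    and P: "P $ 0 = 0"
  shows "P oo e = e oo (fps_const (P $ 1) * fps_X)"
proof -
  define G where "G = column F 1"
  have e0: "e $ 0 = 0" and e1: "e $ 1 = 1"
    and add: "subst1 e (var_X + var_Y) = subst2 F (subst1 e var_X) (subst1 e var_Y)"
    using e by (auto simp: formal_group_exp_def)
  have hom: "subst1 P (subst2 F var_X var_Y) = subst2 F (subst1 P var_X) (subst1 P var_Y)"
    using F by (auto simp: lubin_tate_formal_group_def)
  have parts: "deg0_part (subst1 f var_X) = f" "deg1_part (subst1 f var_X) = 0"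
    "deg0_part (subst1 f var_Y) = 0" "deg1_part (subst1 f var_Y) = fps_const (f $ 1)"
    if "f $ 0 = 0" for f :: "'a fps"
    using that by (simp_all add: deg0_part_subst1 deg1_part_subst1 deg_part_vars)
  \<comment> \<open>This says F(e(X),0) = e(X); cancelling e yields F(X,0) = X.\<close>
  have "column F 0 oo e = fps_X oo e"
    using arg_cong[OF add, of deg0_part] e0
    by (simp add: deg0_part_subst1 deg0_part_subst2 parts deg_part_vars)
  then have F0: "column F 0 = fps_X"
    using fps_compose_inj_right[OF e0] e1 by simp
  have de: "fps_deriv e = G oo e"
    using arg_cong[OF add, of deg1_part] e0 e1
    by (simp add: deg1_part_subst1 deg1_part_subst2 parts deg_part_vars G_def)
  have dP: "fps_deriv P * G = fps_const (P $ 1) * (G oo P)"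
    using arg_cong[OF hom, of deg1_part] P
    by (simp add: deg1_part_subst1 deg1_part_subst2 deg0_part_subst2 parts deg_part_vars F0 G_def mult.commute)
  let ?c = "fps_const (P $ 1)"
  show ?thesis
  proof (rule autonomous_ode_unique)
    show "(P oo e) $ 0 = (e oo (?c * fps_X)) $ 0"
      using P e0 by simp
    have "fps_deriv (P oo e) = (fps_deriv P * G) oo e"
      using e0 by (simp add: fps_compose_deriv fps_compose_mult_distrib de)
    also have "\<dots> = ?c * (G oo (P oo e))"
      using P e0 by (simp add: dP fps_const_mult_compose fps_compose_assoc)
    finally show "fps_deriv (P oo e) = ?c * (G oo (P oo e))" .
    have "fps_deriv (e oo (?c * fps_X)) = (fps_deriv e oo (?c * fps_X)) * ?c"
      by (simp add: fps_compose_deriv)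
    then show "fps_deriv (e oo (?c * fps_X)) = ?c * (G oo (e oo (?c * fps_X)))"
      using e0 by (simp add: de fps_compose_assoc mult.commute)
  qed
qed

section \<open>Finite-dimensional spaces over a subfield\<close>

definition is_subfield :: "'b::field set \<Rightarrow> bool" where
  "is_subfield F \<longleftrightarrow> is_subring F \<and> (\<forall>x\<in>F. inverse x \<in> F)"

definition lin_span :: "'b::field set \<Rightarrow> 'i set \<Rightarrow> ('i \<Rightarrow> 'b) \<Rightarrow> 'b set" where
  "lin_span F I g = {(\<Sum>i\<in>I. c i * g i) | c. \<forall>i\<in>I. c i \<in> F}"

text \<open>Gaussian elimination for n + 1 unknowns and n equations, keeping the solution inside the
  subfield: the last equation is either trivial or used to eliminate one unknown.\<close>

lemma homogeneous_system:
  fixes a :: "nat \<Rightarrow> nat \<Rightarrow> 'b::field"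
  assumes F: "is_subfield F" and a: "\<And>i j. a i j \<in> F"
  shows "\<exists>c. (\<forall>i. c i \<in> F) \<and> (\<exists>i\<le>n. c i \<noteq> 0) \<and> (\<forall>j<n. (\<Sum>i\<le>n. c i * a i j) = 0)"
  using a
proof (induction n arbitrary: a)
  case 0
  show ?case
    using F by (intro exI[of _ "\<lambda>_. 1"]) (auto simp: is_subfield_def intro: subring_1)
next
  case (Suc n)
  have R: "is_subring F" and inv: "\<And>x. x \<in> F \<Longrightarrow> inverse x \<in> F"
    using F by (auto simp: is_subfield_def)
  show ?case
  proof (cases "\<forall>i\<le>Suc n. a i n = 0")
    case True
    obtain c where c: "\<forall>i. c i \<in> F" "\<exists>i\<le>n. c i \<noteq> 0" "\<forall>j<n. (\<Sum>i\<le>n. c i * a i j) = 0"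
      using Suc.IH[of a, OF Suc.prems] by blast
    define d where "d = c(Suc n := 0)"
    have sum_d: "(\<Sum>i\<le>Suc n. d i * a i j) = (\<Sum>i\<le>n. c i * a i j)" for j
      by (simp add: d_def)
    have "(\<Sum>i\<le>n. c i * a i n) = 0"
      using True by (intro sum.neutral) auto
    with c(3) have "\<forall>j<Suc n. (\<Sum>i\<le>Suc n. d i * a i j) = 0"
      unfolding sum_d by (auto simp: less_Suc_eq)
    moreover have "\<forall>i. d i \<in> F"
      using c(1) subring_0[OF R] by (auto simp: d_def)
    moreover have "\<exists>i\<le>Suc n. d i \<noteq> 0"
    proof -
      obtain i where "i \<le> n" "c i \<noteq> 0" using c(2) by blast
      then show ?thesis by (intro exI[of _ i]) (simp add: d_def)
    qed
    ultimately show ?thesis by blast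
  next
    case False
    then obtain i0 where i0: "i0 \<le> Suc n" "a i0 n \<noteq> 0" by auto
    \<comment> \<open>The transposition moves an unknown with nonzero coefficient in the last
      equation to the last place.\<close>
    define s where "s = id(i0 := Suc n, Suc n := i0)"
    have ss: "s (s i) = i" for i
      by (simp add: s_def)
    have s_le: "s i \<le> Suc n" if "i \<le> Suc n" for i
      using that i0 by (auto simp: s_def)
    define b where "b i = a (s i)" for i
    have b0: "b (Suc n) n \<noteq> 0"
      using i0 by (simp add: b_def s_def)
    have bF: "b i j \<in> F" for i j
      using Suc.prems by (simp add: b_def)
    define t where "t i = b i n / b (Suc n) n" for i
    have tF: "t i \<in> F" for i
      unfolding t_def divide_inverse by (intro subring_mult[OF R] inv bF)
    obtain c where c: "\<forall>i. c i \<in> F" "\<exists>i\<le>n. c i \<noteq> 0"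
        "\<forall>j<n. (\<Sum>i\<le>n. c i * (b i j - t i * b (Suc n) j)) = 0"
    proof -
      have "b i j - t i * b (Suc n) j \<in> F" for i j
        by (intro subring_diff[OF R] subring_mult[OF R] bF tF)
      from Suc.IH[of "\<lambda>i j. b i j - t i * b (Suc n) j", OF this] show ?thesis
        using that by blast
    qed
    \<comment> \<open>This value of the last unknown turns the equations for \<open>d\<close> into
      the eliminated ones and satisfies the last equation.\<close>
    define d where "d = c(Suc n := - (\<Sum>i\<le>n. c i * t i))"
    have sum_d: "(\<Sum>i\<le>Suc n. d i * b i j) = (\<Sum>i\<le>n. c i * (b i j - t i * b (Suc n) j))" for j
      by (simp add: d_def algebra_simps sum_subtractf sum_distrib_left sum_distrib_right)
    have "(\<Sum>i\<le>n. c i * (b i n - t i * b (Suc n) n)) = 0"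
      using b0 by (simp add: t_def)
    with c(3) have zero: "\<forall>j<Suc n. (\<Sum>i\<le>Suc n. d i * b i j) = 0"
      unfolding sum_d by (auto simp: less_Suc_eq)
    have "(\<Sum>i\<le>Suc n. d (s i) * a i j) = (\<Sum>i\<le>Suc n. d i * b i j)" for j
      by (rule sum.reindex_bij_witness[of _ s s]) (auto simp: ss s_le b_def simp del: sum.atMost_Suc)
    with zero have "\<forall>j<Suc n. (\<Sum>i\<le>Suc n. d (s i) * a i j) = 0"
      by simp
    moreover have "\<forall>i. d (s i) \<in> F"
      using c(1) tF by (auto simp: d_def intro!: subring_minus[OF R] subring_sum[OF R] subring_mult[OF R])
    moreover have "\<exists>i\<le>Suc n. d (s i) \<noteq> 0"
    proof -
      obtain i where "i \<le> n" "c i \<noteq> 0" using c(2) by blast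
      then have "d (s (s i)) \<noteq> 0" by (simp add: ss d_def)
      then show ?thesis
        using s_le[of i] \<open>i \<le> n\<close> by (intro exI[of _ "s i"]) auto
    qed
    ultimately show ?thesis by (intro exI[of _ "\<lambda>i. d (s i)"]) blast
  qed
qed

text \<open>The \<open>card I + 1\<close> lowest powers of y lie in the span of
  \<open>card I\<close> elements, so they satisfy a nontrivial linear relation over F.\<close>

lemma lin_span_powers_algebraic:
  assumes F: "is_subfield F" and I: "finite I" and y: "\<And>k. y ^ k \<in> lin_span F I g"
  shows "\<exists>f. f \<noteq> 0 \<and> (\<forall>i. poly.coeff f i \<in> F) \<and> poly f y = 0"
proof -
  have R: "is_subring F" using F by (simp add: is_subfield_def)
  obtain h where h: "bij_betw h {0..<card I} I"
    using ex_bij_betw_nat_finite[OF I] by blast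
  have "\<forall>k. \<exists>a. (\<forall>j\<in>I. a j \<in> F) \<and> y ^ k = (\<Sum>j\<in>I. a j * g j)"
    using y unfolding lin_span_def by blast
  from choice[OF this] obtain a
    where "\<forall>k. (\<forall>j\<in>I. a k j \<in> F) \<and> y ^ k = (\<Sum>j\<in>I. a k j * g j)" ..
  then have a: "j \<in> I \<Longrightarrow> a k j \<in> F" "y ^ k = (\<Sum>j\<in>I. a k j * g j)" for k j
    by blast+
  define b where "b k j = (if j < card I then a k (h j) else 0)" for k j
  have hI: "h j \<in> I" if "j < card I" for j
    using bij_betw_apply[OF h] that by simp
  have y_b: "y ^ k = (\<Sum>j<card I. b k j * g (h j))" for k
  proof -
    have "y ^ k = (\<Sum>j\<in>{0..<card I}. a k (h j) * g (h j))"
      unfolding a(2) by (rule sum.reindex_bij_betw[OF h, symmetric])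
    then show ?thesis by (simp add: b_def atLeast0LessThan)
  qed
  have "b k j \<in> F" for k j
    using a(1) hI subring_0[OF R] by (simp add: b_def)
  from homogeneous_system[where n = "card I" and a = b, OF F this] obtain c where c: "\<forall>i. c i \<in> F"
      "\<exists>i\<le>card I. c i \<noteq> 0" "\<forall>j<card I. (\<Sum>i\<le>card I. c i * b i j) = 0"
    by blast
  define f where "f = (\<Sum>i\<le>card I. Polynomial.monom (c i) i)"
  have coeff_f: "poly.coeff f i = (if i \<le> card I then c i else 0)" for i
    by (simp add: f_def coeff_sum)
  have "f \<noteq> 0"
  proof
    assume "f = 0"
    then have "c i = 0" if "i \<le> card I" for i
      using coeff_f[of i] that by simp
    with c(2) show False by blast
  qed
  have "poly f y = (\<Sum>i\<le>card I. c i * y ^ i)"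
    by (simp add: f_def poly_sum poly_monom)
  also have "\<dots> = (\<Sum>j<card I. (\<Sum>i\<le>card I. c i * b i j) * g (h j))"
    unfolding y_b sum_distrib_left sum_distrib_right mult.assoc by (rule sum.swap)
  also have "\<dots> = 0" using c(3) by simp
  finally have "poly f y = 0" .
  moreover note \<open>f \<noteq> 0\<close>
  moreover have "\<forall>i. poly.coeff f i \<in> F"
    using c(1) coeff_f subring_0[OF R] by simp
  ultimately show ?thesis by blast
qed

context
  fixes F :: "'b::field set" and I :: "'i set" and g :: "'i \<Rightarrow> 'b"
  assumes F: "is_subring F"
begin

lemma lin_span_add: "x \<in> lin_span F I g \<Longrightarrow> y \<in> lin_span F I g \<Longrightarrow> x + y \<in> lin_span F I g"
proof -
  assume "x \<in> lin_span F I g" "y \<in> lin_span F I g"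
  then obtain c d where "\<forall>i\<in>I. c i \<in> F" "x = (\<Sum>i\<in>I. c i * g i)" "\<forall>i\<in>I. d i \<in> F" "y = (\<Sum>i\<in>I. d i * g i)"
    unfolding lin_span_def by auto
  then show ?thesis
    unfolding lin_span_def
    by (auto intro!: exI[of _ "\<lambda>i. c i + d i"] subring_add[OF F] simp: sum.distrib distrib_right)
qed

lemma lin_span_scale: "a \<in> F \<Longrightarrow> x \<in> lin_span F I g \<Longrightarrow> a * x \<in> lin_span F I g"
proof -
  assume "a \<in> F" "x \<in> lin_span F I g"
  then obtain c where "\<forall>i\<in>I. c i \<in> F" "x = (\<Sum>i\<in>I. c i * g i)"
    unfolding lin_span_def by auto
  with \<open>a \<in> F\<close> show ?thesis
    unfolding lin_span_def
    by (auto intro!: exI[of _ "\<lambda>i. a * c i"] subring_mult[OF F] simp: sum_distrib_left mult.assoc)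
qed

lemma lin_span_0: "0 \<in> lin_span F I g"
  unfolding lin_span_def using subring_0[OF F] by (auto intro!: exI[of _ "\<lambda>_. 0"])

lemma lin_span_sum: "(\<And>j. j \<in> J \<Longrightarrow> f j \<in> lin_span F I g) \<Longrightarrow> sum f J \<in> lin_span F I g"
  by (induction J rule: infinite_finite_induct) (auto intro: lin_span_0 lin_span_add)

lemma lin_span_base: "finite I \<Longrightarrow> i \<in> I \<Longrightarrow> g i \<in> lin_span F I g"
  unfolding lin_span_def using subring_0[OF F] subring_1[OF F]
  by (auto intro!: exI[of _ "\<lambda>j. if j = i then 1 else 0"] simp: if_distrib[of "\<lambda>x. x * _"] sum.delta cong: if_cong)

end

lemma lin_span_insert:
  assumes "finite I" "i \<notin> I"
  shows "x \<in> lin_span F (insert i I) g \<longleftrightarrow> (\<exists>a\<in>F. \<exists>y\<in>lin_span F I g. x = a * g i + y)"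
proof
  assume "x \<in> lin_span F (insert i I) g"
  then obtain c where "\<forall>j\<in>insert i I. c j \<in> F" "x = (\<Sum>j\<in>insert i I. c j * g j)"
    unfolding lin_span_def by auto
  with assms show "\<exists>a\<in>F. \<exists>y\<in>lin_span F I g. x = a * g i + y"
    by (intro bexI[of _ "c i"] bexI[of _ "\<Sum>j\<in>I. c j * g j"]) (auto simp: lin_span_def)
next
  assume "\<exists>a\<in>F. \<exists>y\<in>lin_span F I g. x = a * g i + y"
  then obtain a c where ac: "a \<in> F" "\<forall>j\<in>I. c j \<in> F" "x = a * g i + (\<Sum>j\<in>I. c j * g j)"
    unfolding lin_span_def by auto
  have "(\<Sum>j\<in>I. (c(i := a)) j * g j) = (\<Sum>j\<in>I. c j * g j)"
    using assms by (intro sum.cong) auto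
  with ac assms show "x \<in> lin_span F (insert i I) g"
    unfolding lin_span_def by (auto intro!: exI[of _ "c(i := a)"])
qed

section \<open>Bolzano-Weierstrass for finite extensions of \<open>\<rat>\<^sub>p\<close>\<close>

context ultrametric_field
begin

text \<open>Asked of subsets because the ambient field is not locally compact. It yields both the
  closedness of finite-dimensional spaces and the finiteness of the residue field.\<close>

definition bolzano_weierstrass :: "'a set \<Rightarrow> bool" where
  "bolzano_weierstrass S \<longleftrightarrow> (\<forall>(x :: nat \<Rightarrow> 'a) M. (\<forall>n. x n \<in> S \<and> nrm (x n) \<le> M) \<longrightarrow>
     (\<exists>l\<in>S. \<exists>r. strict_mono r \<and> (x \<circ> r) \<longlonglongrightarrow> l))"

lemma bolzano_weierstrassD:
  fixes x :: "nat \<Rightarrow> 'a"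
  assumes "bolzano_weierstrass S" "\<And>n. x n \<in> S" "\<And>n. nrm (x n) \<le> M"
  obtains l r where "l \<in> S" "strict_mono r" "(x \<circ> r) \<longlonglongrightarrow> l"
proof -
  have "\<exists>l\<in>S. \<exists>r. strict_mono r \<and> (x \<circ> r) \<longlonglongrightarrow> l"
    using assms(1)[unfolded bolzano_weierstrass_def, rule_format, of x M] assms(2,3) by simp
  then show ?thesis using that by (elim bexE exE conjE)
qed

lemma bolzano_weierstrass_closed:
  assumes "bolzano_weierstrass S"
  shows "closed S"
  unfolding closed_sequential_limits
proof (intro allI impI, elim conjE)
  fix x l assume x: "\<forall>n. x n \<in> S" "x \<longlonglongrightarrow> l"
  obtain N where N: "\<And>n. n \<ge> N \<Longrightarrow> nrm (x n - l) < 1"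
    using x(2)[unfolded LIMSEQ_nrm_iff, rule_format, OF zero_less_one] by blast
  \<comment> \<open>Only a tail is known to be bounded, and it has the same limit.\<close>
  have bdd: "nrm (x (n + N)) \<le> max 1 (nrm l)" for n
    using nrm_add[of "x (n + N) - l" l] N[of "n + N"] by auto
  obtain l' r where r: "l' \<in> S" "strict_mono r" "((\<lambda>n. x (n + N)) \<circ> r) \<longlonglongrightarrow> l'"
    by (rule bolzano_weierstrassD[OF assms, where x = "\<lambda>n. x (n + N)", OF _ bdd]) (use x(1) in auto)
  have lim: "((\<lambda>n. x (n + N)) \<circ> r) \<longlonglongrightarrow> l"
    by (rule LIMSEQ_subseq_LIMSEQ[OF LIMSEQ_ignore_initial_segment[OF x(2)] r(2)])
  show "l \<in> S" using LIMSEQ_unique[OF r(3) lim] r(1) by simp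
qed

lemma closed_nrm_distance:
  assumes "closed S" "b \<notin> S"
  obtains d where "d > 0" "\<And>s. s \<in> S \<Longrightarrow> nrm (b - s) \<ge> d"
proof -
  have "open (- S)" "b \<in> - S" using assms by auto
  then obtain d where "d > 0" "ball b d \<subseteq> - S"
    unfolding open_contains_ball by blast
  then show ?thesis
    by (intro that[of d]) (auto simp: ball_def dist_nrm not_less subset_iff)
qed

text \<open>A generator outside the span of the others has positive distance d from it, since that
  span is closed. The coefficient of this generator is then at most M/d, so subsequences can be
  chosen first for the coefficients and then for the remainders.\<close>

lemma bolzano_weierstrass_lin_span:
  assumes F: "is_subfield F" "bolzano_weierstrass F" and "finite I"
  shows "bolzano_weierstrass (lin_span F I g)"
  using assms(3)
proof (induction I)
  case empty
  show ?case
    unfolding bolzano_weierstrass_def lin_span_def by (auto intro!: exI[of _ id] simp: strict_mono_def comp_def)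
next
  case (insert i I)
  have R: "is_subring F" and inv: "\<And>x. x \<in> F \<Longrightarrow> inverse x \<in> F"
    using F by (auto simp: is_subfield_def)
  let ?S = "lin_span F I g"
  show ?case
  proof (cases "g i \<in> ?S")
    case True
    have "lin_span F (insert i I) g = ?S"
    proof (intro equalityI subsetI)
      fix x assume "x \<in> lin_span F (insert i I) g"
      then obtain a y where "a \<in> F" "y \<in> ?S" "x = a * g i + y"
        using lin_span_insert[OF insert.hyps] by metis
      with True show "x \<in> ?S"
        by (simp add: lin_span_add[OF R] lin_span_scale[OF R])
    next
      fix x assume "x \<in> ?S"
      then show "x \<in> lin_span F (insert i I) g"
        unfolding lin_span_insert[OF insert.hyps] using subring_0[OF R] by (intro bexI[of _ 0] bexI[of _ x]) auto
    qed
    with insert.IH show ?thesis by simp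
  next
    case False
    obtain d where d: "d > 0" "\<And>s. s \<in> ?S \<Longrightarrow> nrm (g i - s) \<ge> d"
      using closed_nrm_distance[OF bolzano_weierstrass_closed[OF insert.IH] False] by blast
    \<comment> \<open>Factor out a: a g + y = a (g - s) with s = - y / a in the span.\<close>
    have coeff_le: "nrm a * d \<le> nrm (a * g i + y)" if "a \<in> F" "y \<in> ?S" for a y
    proof (cases "a = 0")
      case False
      have "- inverse a * y \<in> ?S"
        using that by (intro lin_span_scale[OF R] subring_minus[OF R] inv)
      then have "d \<le> nrm (g i - (- inverse a * y))" by (rule d(2))
      then have "nrm a * d \<le> nrm a * nrm (g i - (- inverse a * y))"
        by (intro mult_left_mono) auto
      also have "\<dots> = nrm (a * g i + y)"
      proof -
        have "a * (g i - (- inverse a * y)) = a * g i + y"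
          using False by (simp add: distrib_left)
        then show ?thesis by (metis nrm_mult)
      qed
      finally show ?thesis .
    qed simp
    show ?thesis
      unfolding bolzano_weierstrass_def
    proof (intro allI impI)
      fix x :: "nat \<Rightarrow> 'a" and M :: real
      assume x: "\<forall>n. x n \<in> lin_span F (insert i I) g \<and> nrm (x n) \<le> M"
      then have "\<forall>n. \<exists>a y. a \<in> F \<and> y \<in> ?S \<and> x n = a * g i + y"
        using lin_span_insert[OF insert.hyps, of _ F g] by blast
      from choice[OF this] obtain a where "\<forall>n. \<exists>y. a n \<in> F \<and> y \<in> ?S \<and> x n = a n * g i + y" ..
      from choice[OF this] obtain y where "\<forall>n. a n \<in> F \<and> y n \<in> ?S \<and> x n = a n * g i + y n" ..
      then have ay: "a n \<in> F" "y n \<in> ?S" "x n = a n * g i + y n" for n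
        by blast+
      have a_le: "nrm (a n) \<le> M / d" for n
      proof -
        have "nrm (a n) * d \<le> nrm (x n)"
          unfolding ay(3)[of n] by (rule coeff_le[OF ay(1,2)])
        also have "\<dots> \<le> M" using x by blast
        finally show ?thesis using d(1) by (simp add: pos_le_divide_eq)
      qed
      obtain a' r where r: "a' \<in> F" "strict_mono r" "(a \<circ> r) \<longlonglongrightarrow> a'"
        by (rule bolzano_weierstrassD[OF F(2) ay(1) a_le])
      have y_le: "nrm (y n) \<le> max M (M / d * nrm (g i))" for n
      proof -
        have "y n = x n - a n * g i" using ay(3)[of n] by simp
        then have "nrm (y n) \<le> max (nrm (x n)) (nrm (a n) * nrm (g i))"
          using nrm_diff[of "x n" "a n * g i"] by (simp add: nrm_mult)
        also have "\<dots> \<le> max M (M / d * nrm (g i))"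
          using x a_le by (intro max.mono mult_right_mono) auto
        finally show ?thesis .
      qed
      have "(y \<circ> r) n \<in> ?S" "nrm ((y \<circ> r) n) \<le> max M (M / d * nrm (g i))" for n
        using ay(2) y_le by simp_all
      then obtain y' r' where r': "y' \<in> ?S" "strict_mono r'" "((y \<circ> r) \<circ> r') \<longlonglongrightarrow> y'"
        by (rule bolzano_weierstrassD[OF insert.IH])
      have "(\<lambda>n. g i * (a \<circ> r \<circ> r') n + (y \<circ> r \<circ> r') n) \<longlonglongrightarrow> g i * a' + y'"
        by (intro ultra_tendsto_add ultra_tendsto_cmult r'(3) LIMSEQ_subseq_LIMSEQ[OF r(3) r'(2)])
      then have "(x \<circ> (r \<circ> r')) \<longlonglongrightarrow> a' * g i + y'"
        by (simp add: comp_def ay(3) mult.commute)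
      moreover have "strict_mono (r \<circ> r')"
        using r(2) r'(2) by (rule strict_mono_o)
      moreover have "a' * g i + y' \<in> lin_span F (insert i I) g"
        using lin_span_insert[OF insert.hyps] r(1) r'(1) by blast
      ultimately show "\<exists>l\<in>lin_span F (insert i I) g. \<exists>r. strict_mono r \<and> (x \<circ> r) \<longlonglongrightarrow> l"
        by blast
    qed
  qed
qed

end

section \<open>The field \<open>\<rat>\<^sub>p\<close>\<close>

context padic_complex_field
begin

definition nrm :: "'a \<Rightarrow> real" where "nrm x = dist x 0"

lemma p_gt_1: "real p > 1"
  using prime_gt_1_nat[OF prime_p] by simp

lemma nrm_eq: "nrm x = (if x = 0 then 0 else real p powr (- real_of_ereal (v x)))"
  by (simp add: nrm_def dist_eq)

lemma v_finite:
  assumes "x \<noteq> 0"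
  obtains a where "v x = ereal a" "nrm x = real p powr - a"
  using assms v_eq_infinity_iff[of x] v_not_minus_infinity[of x] by (cases "v x") (auto simp: nrm_eq)

sublocale ultrametric_field nrm
proof
  fix x y :: 'a
  show "dist x y = nrm (x - y)"
    by (simp add: nrm_eq dist_eq)
  show "nrm (x * y) = nrm x * nrm y"
  proof (cases "x = 0 \<or> y = 0")
    case False
    then obtain a b where "v x = ereal a" "nrm x = real p powr - a" "v y = ereal b" "nrm y = real p powr - b"
      by (metis v_finite)
    then show ?thesis
      using False v_mult[of x y] by (simp add: nrm_eq[of "x * y"] flip: powr_add)
  qed (auto simp: nrm_eq)
  show "nrm (x + y) \<le> max (nrm x) (nrm y)"
  proof (cases "x = 0 \<or> y = 0 \<or> x + y = 0")
    case False
    then obtain a b c where abc: "v x = ereal a" "nrm x = real p powr - a" "v y = ereal b" "nrm y = real p powr - b"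
      "v (x + y) = ereal c" "nrm (x + y) = real p powr - c"
      by (metis v_finite)
    have "min a b \<le> c"
      using v_add[of x y] by (simp add: abc(1,3,5) min_def split: if_splits)
    then have "a \<le> c \<or> b \<le> c" by linarith
    then show ?thesis
      using p_gt_1 by (auto simp: abc(2,4,6) le_max_iff_disj)
  qed (auto simp: nrm_eq le_max_iff_disj)
qed

lemma v_ge_0_iff: "v x \<ge> 0 \<longleftrightarrow> nrm x \<le> 1"
proof (cases "x = 0")
  case False
  then obtain a where "v x = ereal a" "nrm x = real p powr - a"
    by (rule v_finite)
  then show ?thesis
    using p_gt_1 powr_le_cancel_iff[of "real p" "- a" 0] by simp
qed (use v_eq_infinity_iff[of x] in \<open>simp add: nrm_eq\<close>)

lemma v_gt_0_iff: "v x > 0 \<longleftrightarrow> nrm x < 1"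
proof (cases "x = 0")
  case False
  then obtain a where "v x = ereal a" "nrm x = real p powr - a"
    by (rule v_finite)
  then show ?thesis
    using p_gt_1 powr_less_cancel_iff[of "real p" "- a" 0] by simp
qed (use v_eq_infinity_iff[of x] in \<open>simp add: nrm_eq\<close>)

lemma nrm_p: "nrm (of_nat p) < 1" "nrm (of_nat p) > 0"
proof -
  have "of_nat p \<noteq> (0::'a)"
    using prime_gt_0_nat[OF prime_p] by simp
  then have "nrm (of_nat p) = real p powr - 1"
    using v_p by (simp add: nrm_eq)
  then show "nrm (of_nat p) < 1" "nrm (of_nat p) > 0"
    using p_gt_1 by (simp_all add: powr_minus_divide)
qed

lemma nrm_of_int_le: "nrm (of_int z) \<le> 1"
proof -
  have "of_nat n \<in> integers" for n
    by (rule subring_of_nat[OF is_subring_integers])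
  then have "of_nat n \<in> integers \<and> - of_nat n \<in> integers" for n
    using subring_minus[OF is_subring_integers] by blast
  then show ?thesis
    by (cases z) (auto simp: integers_def simp del: of_nat_Suc nrm_minus)
qed

text \<open>In a Bezout relation s p + t z = 1 the first term has norm below 1, so z cannot have
  norm below 1.\<close>

lemma nrm_of_int_eq_1:
  assumes "\<not> int p dvd z"
  shows "nrm (of_int z) = 1"
proof -
  have "coprime (int p) z"
    using assms prime_p prime_imp_coprime by (metis prime_nat_int_transfer)
  then obtain s t where st: "s * int p + t * z = 1"
    using bezout_int[of "int p" z] by auto
  have "1 = nrm (of_int (s * int p + t * z))"
    by (simp add: st)
  also have "\<dots> \<le> max (nrm (of_int s) * nrm (of_nat p)) (nrm (of_int t) * nrm (of_int z))"
    using nrm_add[of "of_int s * of_nat p" "of_int t * of_int z"] by (simp add: nrm_mult)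
  also have "\<dots> \<le> max (nrm (of_nat p)) (nrm (of_int z))"
    using mult_right_mono[OF nrm_of_int_le[of s], of "nrm (of_nat p)"]
      mult_right_mono[OF nrm_of_int_le[of t], of "nrm (of_int z)"] by (intro max.mono) auto
  finally show ?thesis
    using nrm_p(1) nrm_of_int_le[of z] by linarith
qed

text \<open>A rational approximation a/b of norm at most 1 has a denominator prime to p, which can
  be inverted modulo p^N.\<close>

lemma Qp_approx:
  assumes x: "x \<in> Qp" "nrm x \<le> 1"
  shows "\<exists>k<p ^ N. nrm (x - of_nat k) \<le> nrm (of_nat p) ^ N"
proof -
  let ?\<epsilon> = "nrm (of_nat p) ^ N"
  have \<epsilon>: "0 < ?\<epsilon>" "?\<epsilon> \<le> 1"
    using nrm_p by (auto intro: power_le_one)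
  obtain y where y: "y \<in> \<rat>" "dist y x < ?\<epsilon>"
    using x(1)[unfolded Qp_def closure_approachable, rule_format, OF \<epsilon>(1)] by blast
  then have xy: "nrm (x - y) < ?\<epsilon>" by (simp add: dist_nrm nrm_diff_commute)
  have "nrm y \<le> 1"
    using nrm_diff[of x "x - y"] x(2) xy \<epsilon>(2) by simp
  obtain r where r: "y = of_rat r" using y(1) by (rule Rats_cases)
  obtain a b where ab: "quotient_of r = (a, b)" by fastforce
  have b: "b > 0" and cop: "coprime a b" and y_ab: "y = of_int a / of_int b"
    using quotient_of_denom_pos[OF ab] quotient_of_coprime[OF ab] quotient_of_div[OF ab]
    by (simp_all add: r of_rat_divide)
  have pb: "\<not> int p dvd b"
  proof
    assume pb: "int p dvd b"
    have "\<not> int p dvd a"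
    proof
      assume "int p dvd a"
      with pb cop have "int p dvd 1"
        using coprime_common_divisor by blast
      then show False using prime_gt_1_nat[OF prime_p] by auto
    qed
    then have "nrm (of_int a) = 1" by (rule nrm_of_int_eq_1)
    moreover obtain l where l: "b = int p * l" using pb by auto
    have "nrm (of_int b) \<le> nrm (of_nat p)"
      using mult_left_mono[OF nrm_of_int_le[of l], of "nrm (of_nat p)"] by (simp add: l nrm_mult)
    moreover have "nrm (of_int b) > 0"
      using b nrm_ge_0[of "of_int b"] nrm_eq_0[of "of_int b"] by (simp add: order_less_le)
    ultimately have "nrm y > 1"
      using nrm_p(1) by (simp add: y_ab nrm_divide)
    with \<open>nrm y \<le> 1\<close> show False by simp
  qed
  have "coprime (int p ^ N) b"
    using pb prime_p prime_imp_coprime by (metis prime_nat_int_transfer coprime_power_left_iff)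
  then obtain s t where st: "s * int p ^ N + t * b = 1"
    using bezout_int[of "int p ^ N" b] by auto
  \<comment> \<open>By \<open>st\<close>, t inverts b modulo p^N, so k represents a/b.\<close>
  define k where "k = nat ((a * t) mod int p ^ N)"
  have p0: "int p ^ N > 0" using prime_gt_0_nat[OF prime_p] by simp
  have "k < p ^ N"
  proof -
    have "(a * t) mod int p ^ N < int p ^ N" using p0 by simp
    then have "k < nat (int p ^ N)" unfolding k_def using p0 by (subst nat_less_eq_zless) auto
    then show ?thesis by (simp add: nat_power_eq)
  qed
  define d where "d = a * t div int p ^ N"
  have k_eq: "int k = a * t - int p ^ N * d"
    using p0 by (simp add: k_def d_def minus_mult_div_eq_mod)
  have "a - b * int k = int p ^ N * (a * s + b * d) + a * (1 - (s * int p ^ N + t * b))"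
    unfolding k_eq by (simp add: algebra_simps)
  then have eq: "a - b * int k = int p ^ N * (a * s + b * d)"
    unfolding st by simp
  have "nrm (of_int (a - b * int k)) \<le> ?\<epsilon>"
    unfolding eq using mult_left_mono[OF nrm_of_int_le, of ?\<epsilon>] \<epsilon>
    by (simp add: nrm_mult nrm_power del: of_int_add)
  moreover have "y - of_nat k = of_int (a - b * int k) / of_int b"
    using b by (simp add: y_ab field_simps)
  ultimately have "nrm (y - of_nat k) \<le> ?\<epsilon>"
    using nrm_of_int_eq_1[OF pb] by (simp add: nrm_divide)
  then have "nrm (x - of_nat k) \<le> ?\<epsilon>"
    using xy nrm_triangle_le[of x y ?\<epsilon> "of_nat k"] by simp
  with \<open>k < p ^ N\<close> show ?thesis by blast
qed

lemma Qp_sequence: "x \<in> Qp \<longleftrightarrow> (\<exists>f. (\<forall>n. f n \<in> \<rat>) \<and> f \<longlonglongrightarrow> (x :: 'a))"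
  unfolding Qp_def closure_sequential ..

lemma is_subfield_Qp: "is_subfield (Qp :: 'a set)"
  unfolding is_subfield_def is_subring_def
proof (intro conjI ballI)
  show "1 \<in> (Qp :: 'a set)"
    unfolding Qp_def by (rule subsetD[OF closure_subset Rats_1])
  fix x y :: 'a assume x: "x \<in> Qp" and y: "y \<in> Qp"
  obtain f g where fg: "\<forall>n. f n \<in> \<rat>" "f \<longlonglongrightarrow> x" "\<forall>n. g n \<in> \<rat>" "g \<longlonglongrightarrow> y"
    using x y unfolding Qp_sequence by auto
  show "x - y \<in> Qp"
    unfolding Qp_sequence using fg ultra_tendsto_diff[OF fg(2,4)] by (intro exI[of _ "\<lambda>n. f n - g n"]) auto
  show "x * y \<in> Qp"
    unfolding Qp_sequence using fg ultra_tendsto_mult[OF fg(2,4)] by (intro exI[of _ "\<lambda>n. f n * g n"]) auto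
next
  fix x :: 'a assume x: "x \<in> Qp"
  show "inverse x \<in> Qp"
  proof (cases "x = 0")
    case False
    then have nx: "nrm x > 0"
      using nrm_ge_0[of x] nrm_eq_0[of x] by linarith
    show ?thesis
      unfolding Qp_def closure_approachable
    proof (intro allI impI)
      fix \<epsilon> :: real assume "\<epsilon> > 0"
      \<comment> \<open>The first bound forces |y| = |x|; the second then makes |x - y| / |x|^2
        smaller than \<open>\<epsilon>\<close>.\<close>
      then have "min (nrm x) (\<epsilon> * nrm x ^ 2) > 0" using nx False by simp
      from x[unfolded Qp_def closure_approachable, rule_format, OF this]
      obtain y where y: "y \<in> \<rat>" "dist y x < min (nrm x) (\<epsilon> * nrm x ^ 2)"
        by blast
      then have xy: "nrm (x - y) < nrm x" "nrm (x - y) < \<epsilon> * nrm x ^ 2"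
        by (simp_all add: dist_nrm nrm_diff_commute)
      have ny: "nrm y = nrm x"
        using nrm_add_eq[of "y - x" x] xy(1) by (simp add: nrm_diff_commute)
      then have "y \<noteq> 0" using nx by auto
      then have "inverse y - inverse x = (x - y) / (x * y)"
        using False by (simp add: field_simps)
      then have "nrm (inverse y - inverse x) = nrm (x - y) / nrm x ^ 2"
        by (simp add: nrm_divide nrm_mult ny power2_eq_square)
      also have "\<dots> < \<epsilon>" using xy(2) by (subst pos_divide_less_eq) (simp_all add: False)
      finally show "\<exists>y\<in>\<rat>. dist y (inverse x) < \<epsilon>"
        using y(1) by (intro bexI[of _ "inverse y"]) (auto simp: dist_nrm)
    qed
  qed (use x in simp)
qed

lemma closed_Qp: "closed (Qp :: 'a set)"
  by (simp add: Qp_def)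

lemma of_nat_in_Qp: "of_nat n \<in> (Qp :: 'a set)"
  using is_subfield_Qp subring_of_nat by (auto simp: is_subfield_def)

lemma nrm_le_eq_cball: "{x. nrm x \<le> M} = cball 0 M"
  by (auto simp: dist_nrm)

text \<open>The unit ball of \<open>Qp\<close> is complete and, by \<open>Qp_approx\<close>, totally
  bounded, hence compact. A bounded sequence is moved into it by a power of p.\<close>

lemma bolzano_weierstrass_Qp: "bolzano_weierstrass (Qp :: 'a set)"
proof -
  have sub: "is_subring (Qp :: 'a set)" and inv: "\<And>x :: 'a. x \<in> Qp \<Longrightarrow> inverse x \<in> Qp"
    using is_subfield_Qp by (auto simp: is_subfield_def)
  define Z where "Z = Qp \<inter> {x. nrm x \<le> 1}"
  have "closed Z"
    unfolding Z_def nrm_le_eq_cball by (intro closed_Int closed_Qp closed_cball)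
  moreover have "\<exists>k. finite k \<and> Z \<subseteq> (\<Union>x\<in>k. ball x \<epsilon>)" if \<epsilon>: "\<epsilon> > 0" for \<epsilon>
  proof -
    obtain N where N: "nrm (of_nat p) ^ N < \<epsilon>"
      using real_arch_pow_inv[OF \<epsilon> nrm_p(1)] by blast
    have "Z \<subseteq> (\<Union>x\<in>of_nat ` {..<p ^ N}. ball x \<epsilon>)"
    proof
      fix x assume "x \<in> Z"
      then obtain k where "k < p ^ N" "nrm (x - of_nat k) \<le> nrm (of_nat p) ^ N"
        using Qp_approx[of x N] by (auto simp: Z_def)
      with N have "dist (of_nat k) x < \<epsilon>" by (simp add: dist_nrm nrm_diff_commute)
      with \<open>k < p ^ N\<close> show "x \<in> (\<Union>x\<in>of_nat ` {..<p ^ N}. ball x \<epsilon>)" by auto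
    qed
    then show ?thesis by (intro exI[of _ "of_nat ` {..<p ^ N}"]) auto
  qed
  ultimately have "compact Z"
    unfolding compact_eq_totally_bounded complete_eq_closed by blast
  then have Z: "seq_compact Z"
    by (simp add: compact_eq_seq_compact_metric)
  show ?thesis
    unfolding bolzano_weierstrass_def
  proof (intro allI impI)
    fix x :: "nat \<Rightarrow> 'a" and M :: real
    assume x: "\<forall>n. x n \<in> Qp \<and> nrm (x n) \<le> M"
    define M' where "M' = max M 1"
    have "inverse M' > 0" by (simp add: M'_def)
    then obtain t where t: "nrm (of_nat p) ^ t < inverse M'"
      using real_arch_pow_inv[OF _ nrm_p(1)] by blast
    define P where "P = (of_nat p :: 'a) ^ t"
    have P: "P \<in> Qp" "P \<noteq> 0"
      using subring_power[OF sub of_nat_in_Qp] prime_gt_0_nat[OF prime_p] by (auto simp: P_def)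
    have "P * x n \<in> Z" for n
    proof -
      have "nrm (P * x n) \<le> inverse M' * M'"
        unfolding nrm_mult using t x by (intro mult_mono) (auto simp: P_def nrm_power M'_def le_max_iff_disj)
      moreover have "M' \<noteq> 0" by (simp add: M'_def)
      ultimately show ?thesis
        using subring_mult[OF sub] P(1) x by (auto simp: Z_def)
    qed
    then obtain l r where l: "l \<in> Z" "strict_mono r" "((\<lambda>n. P * x n) \<circ> r) \<longlonglongrightarrow> l"
      using seq_compactE[OF Z, of "\<lambda>n. P * x n"] by blast
    have "(\<lambda>n. inverse P * ((\<lambda>n. P * x n) \<circ> r) n) \<longlonglongrightarrow> inverse P * l"
      by (rule ultra_tendsto_cmult[OF l(3)])
    then have "(x \<circ> r) \<longlonglongrightarrow> inverse P * l"
      using P(2) by (simp add: comp_def mult.assoc[symmetric])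
    moreover have "inverse P * l \<in> Qp"
      using l(1) P(1) by (auto simp: Z_def intro: subring_mult[OF sub] inv)
    ultimately show "\<exists>l\<in>Qp. \<exists>r. strict_mono r \<and> (x \<circ> r) \<longlonglongrightarrow> l"
      using l(2) by blast
  qed
qed

end

section \<open>The residue field\<close>

text \<open>If another prime l divided the order, Sylow's theorem would give a subgroup of order l,
  and the order of a nontrivial element of it would divide both l and p.\<close>

lemma (in group) order_prime_power:
  assumes fin: "finite (carrier G)" and p: "prime p" and exp: "\<And>x. x \<in> carrier G \<Longrightarrow> x [^] p = \<one>"
  shows "\<exists>k. order G = p ^ k"
proof -
  have "order G > 0"
    using fin order_gt_0_iff_finite by blast
  then obtain m where m: "order G = p ^ multiplicity p (order G) * m" "\<not> p dvd m"
    using p multiplicity_decompose'[of "order G" p] by (metis not_prime_unit not_gr_zero)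
  have "m = 1"
  proof (rule ccontr)
    assume "m \<noteq> 1"
    then obtain l where l: "prime l" "l dvd m"
      using prime_factor_nat by blast
    then have "l \<noteq> p" using m(2) by blast
    obtain m' where m': "order G = l ^ 1 * m'"
      using l(2) m(1) by (metis dvd_mult dvdE power_one_right)
    obtain H where H: "subgroup H G" "card H = l ^ 1"
      using sylow_thm[OF l(1) group_axioms m' fin] by blast
    then have "card H > 1" using prime_gt_1_nat[OF l(1)] by simp
    moreover have "card H \<le> 1" if "H \<subseteq> {\<one>}"
      using card_mono[OF _ that] by simp
    ultimately obtain x where x: "x \<in> H" "x \<noteq> \<one>"
      using not_le by blast
    interpret H: group "G\<lparr>carrier := H\<rparr>"
      by (rule subgroup.subgroup_is_group[OF H(1) group_axioms])
    have "x [^]\<^bsub>G\<lparr>carrier := H\<rparr>\<^esub> order (G\<lparr>carrier := H\<rparr>) = \<one>"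
      using H.pow_order_eq_1[of x] x(1) by simp
    then have "x [^] l = \<one>"
      using H(2) by (simp add: order_def nat_pow_consistent[symmetric])
    moreover have xG: "x \<in> carrier G"
      using x(1) subgroup.subset[OF H(1)] by blast
    ultimately have "ord x dvd l" "ord x dvd p"
      using pow_eq_id exp by auto
    moreover have "coprime l p"
      using l(1) p \<open>l \<noteq> p\<close> by (simp add: primes_coprime)
    ultimately have "ord x = 1"
      using coprime_common_divisor_nat by blast
    then show False
      using x(2) ord_eq_1[OF xG] by simp
  qed
  with m(1) show ?thesis by auto
qed

context padic_complex_field
begin

lemma val_ring_eq: "val_ring v K = {x \<in> K. nrm x \<le> 1}"
  by (simp add: val_ring_def v_ge_0_iff)

lemma max_ideal_eq: "max_ideal v K = {x \<in> K. nrm x < 1}"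
  by (simp add: max_ideal_def v_gt_0_iff)

context
  fixes K :: "'a set"
  assumes K: "finite_extension_Qp K"
begin

lemma is_subfield_extension: "is_subfield K"
proof -
  have "1 \<in> K"
    using K is_subfield_Qp by (auto simp: finite_extension_Qp_def is_subfield_def is_subring_def)
  moreover have "x - y \<in> K" if "x \<in> K" "y \<in> K" for x y
  proof -
    have "- y \<in> K" using K that by (simp add: finite_extension_Qp_def)
    then have "x + - y \<in> K" using K that unfolding finite_extension_Qp_def by blast
    then show ?thesis by simp
  qed
  ultimately show ?thesis
    using K by (auto simp: is_subfield_def is_subring_def finite_extension_Qp_def)
qed

lemma is_subring_extension: "is_subring K"
  using is_subfield_extension by (simp add: is_subfield_def)

lemma extension_basis:
  obtains B where "finite B" "B \<subseteq> K" "K = lin_span Qp B (\<lambda>b. b)"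
proof -
  from K obtain B where B: "finite B" "B \<subseteq> K"
      "\<And>x. x \<in> K \<Longrightarrow> \<exists>c. (\<forall>b\<in>B. c b \<in> Qp) \<and> x = (\<Sum>b\<in>B. c b * b)" and QK: "Qp \<subseteq> K"
    unfolding finite_extension_Qp_def by blast
  have "K = lin_span Qp B (\<lambda>b. b)"
  proof (intro equalityI subsetI)
    fix x assume "x \<in> K"
    with B(3) show "x \<in> lin_span Qp B (\<lambda>b. b)"
      unfolding lin_span_def by blast
  next
    fix x assume "x \<in> lin_span Qp B (\<lambda>b. b)"
    then obtain c where "\<forall>b\<in>B. c b \<in> Qp" "x = (\<Sum>b\<in>B. c b * b)"
      unfolding lin_span_def by blast
    with B(2) QK show "x \<in> K"
      by (auto intro!: subring_sum[OF is_subring_extension] subring_mult[OF is_subring_extension])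
  qed
  with B that show ?thesis by blast
qed

lemma bolzano_weierstrass_extension: "bolzano_weierstrass K"
  using extension_basis bolzano_weierstrass_lin_span[OF is_subfield_Qp bolzano_weierstrass_Qp] by metis

lemma is_subring_val_ring: "is_subring (val_ring v K)"
  using is_subring_extension is_subring_integers
  by (auto simp: val_ring_eq is_subring_def integers_def)

lemma closed_val_ring: "closed (val_ring v K)"
proof -
  have "val_ring v K = K \<inter> {x. nrm x \<le> 1}"
    by (auto simp: val_ring_eq)
  then show ?thesis
    unfolding nrm_le_eq_cball
    by (simp add: closed_Int bolzano_weierstrass_closed[OF bolzano_weierstrass_extension])
qed

definition residue_rel :: "('a \<times> 'a) set" where
  "residue_rel = {(x, y). x \<in> val_ring v K \<and> y \<in> val_ring v K \<and> x - y \<in> max_ideal v K}"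

lemma residue_card_eq: "residue_card v K = card (val_ring v K // residue_rel)"
  by (simp add: residue_card_def residue_rel_def)

lemma residue_rel_iff:
  "(x, y) \<in> residue_rel \<longleftrightarrow> x \<in> val_ring v K \<and> y \<in> val_ring v K \<and> nrm (x - y) < 1"
  using subring_diff[OF is_subring_extension] by (auto simp: residue_rel_def max_ideal_eq val_ring_eq)

lemma equiv_residue_rel: "equiv (val_ring v K) residue_rel"
proof (rule equivI)
  show "trans residue_rel"
    by (rule transI) (auto simp: residue_rel_iff intro: nrm_triangle_less)
qed (auto simp: residue_rel_iff refl_on_def sym_def nrm_diff_commute)

text \<open>Representatives of infinitely many classes would have a convergent subsequence, two
  terms of which are congruent.\<close>

lemma finite_residue: "finite (val_ring v K // residue_rel)"
proof (rule ccontr)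
  assume "infinite (val_ring v K // residue_rel)"
  then obtain f :: "nat \<Rightarrow> 'a set" where f: "inj f" "range f \<subseteq> val_ring v K // residue_rel"
    using infinite_countable_subset by blast
  have "\<exists>x. x \<in> f n" for n
    using f(2) in_quotient_imp_non_empty[OF equiv_residue_rel] by blast
  then obtain x where x: "x n \<in> f n" for n by metis
  have xO: "x n \<in> val_ring v K" for n
    using f(2) x in_quotient_imp_subset[OF equiv_residue_rel] by blast
  then have xK: "x n \<in> K" "nrm (x n) \<le> 1" for n
    by (auto simp: val_ring_eq)
  obtain l s where "l \<in> K" and s: "strict_mono s" "(x \<circ> s) \<longlonglongrightarrow> l"
    by (rule bolzano_weierstrassD[OF bolzano_weierstrass_extension xK])
  have "Cauchy (x \<circ> s)" using s(2) by (rule LIMSEQ_imp_Cauchy)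
  from this[unfolded Cauchy_nrm_iff, rule_format, OF zero_less_one]
  obtain N where "\<forall>m\<ge>N. \<forall>n\<ge>N. nrm ((x \<circ> s) m - (x \<circ> s) n) < 1" ..
  then have "(x (s N), x (s (Suc N))) \<in> residue_rel"
    using xO by (simp add: residue_rel_iff)
  moreover have "f (s N) \<in> val_ring v K // residue_rel" "f (s (Suc N)) \<in> val_ring v K // residue_rel"
    using f(2) by blast+
  ultimately have "f (s N) = f (s (Suc N))"
    using quotient_eqI[OF equiv_residue_rel _ _ x x] by simp
  then have "s N = s (Suc N)" using f(1) by (simp add: inj_eq)
  moreover have "s N < s (Suc N)" using s(1) by (simp add: strict_monoD)
  ultimately show False by simp
qed

text \<open>The additive group of the residue field is killed by p. The exponent is positive because
  0 and 1 lie in different classes.\<close>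

lemma residue_card_prime_power: "\<exists>k>0. residue_card v K = p ^ k"
proof -
  let ?O = "val_ring v K" and ?M = "max_ideal v K"
  define G where "G = \<lparr>carrier = ?O, monoid.mult = (+), one = (0::'a)\<rparr>"
  note O = subring_add[OF is_subring_val_ring] subring_0[OF is_subring_val_ring] subring_minus[OF is_subring_val_ring]
  interpret G: comm_group G
    by (rule comm_groupI) (auto simp: G_def O add_ac intro!: bexI[of _ "- _"])
  have inv_G: "inv\<^bsub>G\<^esub> x = - x" if "x \<in> ?O" for x
    using that by (intro G.inv_equality) (auto simp: G_def O)
  have M: "x \<in> ?M \<longleftrightarrow> x \<in> ?O \<and> nrm x < 1" for x
    by (auto simp: max_ideal_eq val_ring_eq)
  have "0 \<in> ?M" by (simp add: M O)
  then have "?M \<noteq> {}" by blast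
  then have "subgroup ?M G"
    by (intro G.subgroupI)
      (auto simp: G_def M O inv_G[unfolded G_def] intro: nrm_add_less)
  then interpret N: normal ?M G by (rule G.subgroup_imp_normal)
  interpret Q: group "G Mod ?M" by (rule N.factorgroup_is_group)
  have coset: "?M #>\<^bsub>G\<^esub> a = residue_rel `` {a}" if "a \<in> ?O" for a
  proof (intro equalityI subsetI)
    fix y assume "y \<in> ?M #>\<^bsub>G\<^esub> a"
    with that show "y \<in> residue_rel `` {a}"
      by (auto simp: r_coset_def G_def residue_rel_iff M O)
  next
    fix y assume "y \<in> residue_rel `` {a}"
    then have "y \<in> ?O" "nrm (y - a) < 1" by (auto simp: residue_rel_iff nrm_diff_commute)
    with that have "y - a \<in> ?M" using subring_diff[OF is_subring_val_ring] by (simp add: M)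
    then show "y \<in> ?M #>\<^bsub>G\<^esub> a"
      by (auto simp: r_coset_def G_def intro!: bexI[of _ "y - a"])
  qed
  have carrier_eq: "carrier (G Mod ?M) = ?O // residue_rel"
    using coset by (auto simp: FactGroup_def RCOSETS_def quotient_def G_def)
  have pow: "x [^]\<^bsub>G\<^esub> n = of_nat n * x" if "x \<in> ?O" for x and n :: nat
    by (induction n) (simp_all add: G_def nat_pow_def algebra_simps)
  have "X [^]\<^bsub>G Mod ?M\<^esub> p = \<one>\<^bsub>G Mod ?M\<^esub>" if X: "X \<in> carrier (G Mod ?M)" for X
  proof -
    obtain a where a: "a \<in> carrier G" "X = ?M #>\<^bsub>G\<^esub> a"
      using X by (auto simp: FactGroup_def RCOSETS_def)
    then have aO: "a \<in> ?O" by (simp add: G_def)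
    have "X [^]\<^bsub>G Mod ?M\<^esub> p = ?M #>\<^bsub>G\<^esub> (a [^]\<^bsub>G\<^esub> p)"
      unfolding a(2) using hom_nat_pow[OF N.r_coset_hom_Mod a(1) G.group_axioms Q.group_axioms] by simp
    also have "a [^]\<^bsub>G\<^esub> p = of_nat p * a" by (rule pow[OF aO])
    also have "?M #>\<^bsub>G\<^esub> (of_nat p * a) = ?M"
    proof (rule G.coset_join2)
      have "nrm (of_nat p) * nrm a \<le> nrm (of_nat p) * 1"
        using aO by (intro mult_left_mono) (auto simp: val_ring_eq)
      then have "nrm (of_nat p * a) < 1" using nrm_p(1) by (simp add: nrm_mult)
      moreover have pa: "of_nat p * a \<in> ?O"
        by (intro subring_mult[OF is_subring_val_ring] subring_of_nat[OF is_subring_val_ring] aO)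
      ultimately show "of_nat p * a \<in> ?M" by (simp add: M)
      show "of_nat p * a \<in> carrier G" using pa by (simp add: G_def)
    qed (rule \<open>subgroup ?M G\<close>)
    finally show ?thesis by (simp add: FactGroup_def)
  qed
  then obtain k where k: "order (G Mod ?M) = p ^ k"
    using Q.order_prime_power[OF _ prime_p] finite_residue by (auto simp: carrier_eq)
  then have q: "residue_card v K = p ^ k"
    by (simp add: residue_card_eq order_def carrier_eq)
  have "k \<noteq> 0"
  proof
    assume "k = 0"
    then have "card (?O // residue_rel) = 1" using q by (simp add: residue_card_eq)
    then obtain X where "?O // residue_rel = {X}" by (auto simp: card_1_singleton_iff)
    then have "residue_rel `` {0} = residue_rel `` {1}"
      using O(2) subring_1[OF is_subring_val_ring] by (metis quotientI singletonD)
    then have "(0, 1) \<in> residue_rel"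
      using eq_equiv_class[OF _ equiv_residue_rel subring_1[OF is_subring_val_ring]] by blast
    then show False by (simp add: residue_rel_iff)
  qed
  with q show ?thesis by blast
qed

text \<open>In the maximal ideal the claim is clear. The units modulo the principal units U1 form a
  group of order q - 1, so the (q-1)-th power of a unit lies in U1.\<close>

lemma residue_frobenius:
  assumes a: "a \<in> val_ring v K"
  shows "a ^ residue_card v K - a \<in> max_ideal v K"
proof -
  let ?O = "val_ring v K" and ?q = "residue_card v K"
  obtain k where k: "k > 0" "?q = p ^ k" using residue_card_prime_power by blast
  have q: "?q > 1"
    unfolding k(2) by (rule one_less_power[OF prime_gt_1_nat[OF prime_p] k(1)])
  note O = subring_mult[OF is_subring_val_ring] subring_1[OF is_subring_val_ring] subring_diff[OF is_subring_val_ring]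
    subring_power[OF is_subring_val_ring]
  have M: "x \<in> max_ideal v K \<longleftrightarrow> x \<in> ?O \<and> nrm x < 1" for x
    by (auto simp: max_ideal_eq val_ring_eq)
  show ?thesis
  proof (cases "nrm a < 1")
    case True
    then have "nrm (a ^ ?q) < 1"
      unfolding nrm_power using q by (intro power_less_one_iff[THEN iffD2]) auto
    with True have "nrm (a ^ ?q - a) < 1"
      using nrm_diff[of "a ^ ?q" a] by linarith
    then show ?thesis using a O by (simp add: M)
  next
    case False
    with a have na: "nrm a = 1" by (auto simp: val_ring_eq)
    define U where "U = {x \<in> ?O. nrm x = 1}"
    define U1 where "U1 = {x \<in> ?O. nrm (x - 1) < 1}"
    define G where "G = \<lparr>carrier = U, monoid.mult = (*), one = (1::'a)\<rparr>"
    have inv: "inverse x \<in> U" if "x \<in> U" for x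
      using that is_subfield_extension by (auto simp: U_def val_ring_eq nrm_inverse is_subfield_def)
    have U0: "x \<noteq> 0" if "x \<in> U" for x using that by (auto simp: U_def)
    interpret G: comm_group G
    proof (rule comm_groupI)
      show "\<exists>y\<in>carrier G. y \<otimes>\<^bsub>G\<^esub> x = \<one>\<^bsub>G\<^esub>" if "x \<in> carrier G" for x
        using that inv[of x] U0[of x] by (intro bexI[of _ "inverse x"]) (auto simp: G_def)
    qed (auto simp: G_def U_def O mult_ac nrm_mult)
    have inv_G: "inv\<^bsub>G\<^esub> x = inverse x" if "x \<in> U" for x
      using that inv U0 by (intro G.inv_equality) (auto simp: G_def)
    have U1_U: "x \<in> U" if "x \<in> U1" for x
      using that nrm_add_eq[of "x - 1" 1] by (auto simp: U_def U1_def)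
    have "subgroup U1 G"
    proof (rule G.subgroupI)
      show "U1 \<subseteq> carrier G" using U1_U by (auto simp: G_def)
      show "U1 \<noteq> {}" using O(2) by (auto simp: U1_def intro!: exI[of _ 1])
      fix x y assume x: "x \<in> U1" and y: "y \<in> U1"
      have eq: "x * y - 1 = x * (y - 1) + (x - 1)" by (simp add: algebra_simps)
      have "nrm (x * (y - 1)) < 1" using U1_U[OF x] y by (simp add: nrm_mult U_def U1_def)
      then have "nrm (x * y - 1) < 1"
        unfolding eq by (rule nrm_add_less) (use x in \<open>simp add: U1_def\<close>)
      then show "x \<otimes>\<^bsub>G\<^esub> y \<in> U1" using x y O by (simp add: G_def U1_def)
    next
      fix x assume x: "x \<in> U1"
      have xU: "x \<in> U" by (rule U1_U[OF x])
      have "inverse x - 1 = (1 - x) * inverse x" using U0[OF xU] by (simp add: left_diff_distrib)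
      then have "nrm (inverse x - 1) < 1"
        using x xU by (simp add: nrm_mult nrm_inverse U_def U1_def nrm_diff_commute)
      then show "inv\<^bsub>G\<^esub> x \<in> U1" using inv[OF xU] by (simp add: inv_G[OF xU] U_def U1_def)
    qed
    then interpret N: normal U1 G by (rule G.subgroup_imp_normal)
    interpret Q: group "G Mod U1" by (rule N.factorgroup_is_group)
    have coset: "U1 #>\<^bsub>G\<^esub> x = residue_rel `` {x}" if x: "x \<in> U" for x
    proof (intro equalityI subsetI)
      fix y assume "y \<in> U1 #>\<^bsub>G\<^esub> x"
      then obtain u where u: "u \<in> U1" "y = u * x" by (auto simp: r_coset_def G_def)
      have "x - y = (1 - u) * x" by (simp add: u(2) left_diff_distrib)
      then have "nrm (x - y) < 1" using u(1) x by (simp add: nrm_mult U_def U1_def nrm_diff_commute)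
      then show "y \<in> residue_rel `` {x}" using u x O by (simp add: residue_rel_iff U_def U1_def)
    next
      fix y assume "y \<in> residue_rel `` {x}"
      then have y: "y \<in> ?O" "nrm (y - x) < 1" by (auto simp: residue_rel_iff nrm_diff_commute)
      have "y * inverse x - 1 = (y - x) * inverse x"
        using U0[OF x] by (simp add: left_diff_distrib)
      then have "nrm (y * inverse x - 1) < 1"
        using y x by (simp add: nrm_mult nrm_inverse U_def)
      then have "y * inverse x \<in> U1" using y inv[OF x] O by (simp add: U1_def U_def)
      then show "y \<in> U1 #>\<^bsub>G\<^esub> x"
        using U0[OF x] by (auto simp: r_coset_def G_def intro!: bexI[of _ "y * inverse x"])
    qed
    have zero: "0 \<in> ?O" by (rule subring_0[OF is_subring_val_ring])
    \<comment> \<open>A coset of U1 is a residue class, and the classes of units are all classes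
      except that of 0.\<close>
    have "carrier (G Mod U1) = ?O // residue_rel - {residue_rel `` {0}}"
    proof (intro equalityI subsetI)
      fix X assume "X \<in> carrier (G Mod U1)"
      then obtain x where x: "x \<in> U" "X = residue_rel `` {x}"
        using coset by (auto simp: FactGroup_def RCOSETS_def G_def)
      have "residue_rel `` {x} \<noteq> residue_rel `` {0}"
      proof
        assume "residue_rel `` {x} = residue_rel `` {0}"
        then have "(x, 0) \<in> residue_rel"
          using eq_equiv_class[OF _ equiv_residue_rel zero] by blast
        then show False using x(1) by (simp add: residue_rel_iff U_def)
      qed
      then show "X \<in> ?O // residue_rel - {residue_rel `` {0}}"
        using x by (auto simp: U_def intro: quotientI)
    next
      fix X assume X: "X \<in> ?O // residue_rel - {residue_rel `` {0}}"
      then obtain x where x: "x \<in> ?O" "X = residue_rel `` {x}" by (auto elim: quotientE)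
      have "nrm x = 1"
      proof (rule ccontr)
        assume "nrm x \<noteq> 1"
        then have "(x, 0) \<in> residue_rel" using x(1) zero by (auto simp: residue_rel_iff val_ring_eq)
        then have "X = residue_rel `` {0}"
          unfolding x(2) by (rule equiv_class_eq[OF equiv_residue_rel])
        with X show False by blast
      qed
      then have "x \<in> U" using x(1) by (simp add: U_def)
      then show "X \<in> carrier (G Mod U1)"
        using coset x(2) by (auto simp: FactGroup_def RCOSETS_def G_def)
    qed
    then have order: "order (G Mod U1) = ?q - 1"
      using finite_residue zero by (simp add: order_def residue_card_eq card_Diff_singleton quotientI)
    have aU: "a \<in> U" using a na by (simp add: U_def)
    then have aG: "a \<in> carrier G" by (simp add: G_def)
    have pow: "x [^]\<^bsub>G\<^esub> n = x ^ n" for x and n :: nat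
      by (induction n) (simp_all add: G_def nat_pow_def mult.commute)
    have "(U1 #>\<^bsub>G\<^esub> a) [^]\<^bsub>G Mod U1\<^esub> (?q - 1) = \<one>\<^bsub>G Mod U1\<^esub>"
      unfolding order[symmetric] using aG by (intro Q.pow_order_eq_1) (auto simp: FactGroup_def RCOSETS_def)
    then have "U1 #>\<^bsub>G\<^esub> (a ^ (?q - 1)) = U1"
      using hom_nat_pow[OF N.r_coset_hom_Mod aG G.group_axioms Q.group_axioms] by (simp add: FactGroup_def pow)
    moreover have "a ^ (?q - 1) \<in> U1 #>\<^bsub>G\<^esub> (a ^ (?q - 1))"
      using O(2) by (auto simp: r_coset_def G_def U1_def intro!: bexI[of _ 1])
    ultimately have "nrm (a ^ (?q - 1) - 1) < 1" by (simp add: U1_def)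
    moreover have "a ^ ?q - a = a * (a ^ (?q - 1) - 1)"
      using q by (cases ?q) (simp_all add: right_diff_distrib)
    ultimately have "nrm (a ^ ?q - a) < 1" using na by (simp add: nrm_mult)
    then show ?thesis using a O by (simp add: M)
  qed
qed

end

end

section \<open>Division points\<close>

context padic_complex_field
begin

section \<open>Values at algebraic points, uniformisers and the change of uniformiser\<close>

context
  fixes K :: "'a set"
  assumes K: "finite_extension_Qp K"
begin

lemma Qp_subset_extension: "Qp \<subseteq> K"
  using K by (simp add: finite_extension_Qp_def)

text \<open>The space V = K[w] has finite dimension over \<open>Qp\<close>, hence is closed.
  Multiplication by the partial sums preserves V, so multiplication by the value does too; all
  powers of the value lie in V, which makes it algebraic.\<close>

lemma fps_value_in_Qp_bar:
  assumes f: "f \<in> fps_over (val_ring v K)" and w: "w \<in> Qp_bar" "nrm w < 1"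
  shows "fps_value f w \<in> Qp_bar"
proof -
  have Qp: "is_subring (Qp :: 'a set)" and inv: "\<And>x :: 'a. x \<in> Qp \<Longrightarrow> inverse x \<in> Qp"
    using is_subfield_Qp by (auto simp: is_subfield_def)
  obtain g where g: "g \<noteq> 0" "\<And>i. poly.coeff g i \<in> Qp" "poly g w = 0"
    using w(1) unfolding Qp_bar_def by auto
  define d where "d = degree g"
  have "d > 0"
  proof (rule ccontr)
    assume "\<not> d > 0"
    then obtain a where "g = [:a:]" unfolding d_def by (auto elim: degree_eq_zeroE)
    with g show False by simp
  qed
  obtain B where B: "finite B" "B \<subseteq> K" "K = lin_span Qp B (\<lambda>b. b)"
    by (rule extension_basis[OF K])
  define I where "I = B \<times> {..<d}"
  define h where "h = (\<lambda>(b, i). b * w ^ i)"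
  define V where "V = lin_span Qp I h"
  have I: "finite I" using B(1) by (simp add: I_def)
  note V_add = lin_span_add[OF Qp, of _ I h, folded V_def]
    and V_scale = lin_span_scale[OF Qp, of _ _ I h, folded V_def]
    and V_sum = lin_span_sum[OF Qp, of _ _ I h, folded V_def]
  have V_base: "b * w ^ i \<in> V" if "b \<in> B" "i < d" for b i
    using lin_span_base[OF Qp I, of "(b, i)" h] that by (simp add: V_def I_def h_def)
  \<comment> \<open>Induction over the span, applied below to the sets of elements that w, or a
    given element of K, multiplies into V.\<close>
  have V_mono: "V \<subseteq> W" if add: "\<And>x y. x \<in> W \<Longrightarrow> y \<in> W \<Longrightarrow> x + y \<in> W" and zero: "0 \<in> W"
    and scale: "\<And>a b i. a \<in> Qp \<Longrightarrow> b \<in> B \<Longrightarrow> i < d \<Longrightarrow> a * (b * w ^ i) \<in> W" for W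
  proof
    fix x assume "x \<in> V"
    then obtain c where c: "\<forall>j\<in>I. c j \<in> Qp" "x = (\<Sum>j\<in>I. c j * h j)"
      unfolding V_def lin_span_def by blast
    have "(\<Sum>j\<in>J. c j * h j) \<in> W" if "finite J" "J \<subseteq> I" for J
      using that by (induction J) (use c(1) in \<open>auto simp: h_def I_def intro!: add zero scale\<close>)
    then show "x \<in> W" using I c(2) by blast
  qed
  have V_zero: "0 \<in> V" unfolding V_def by (rule lin_span_0[OF Qp])
  have w_d: "w ^ d = (\<Sum>j<d. (- poly.coeff g j * inverse (poly.coeff g d)) * w ^ j)"
  proof -
    have "0 = (\<Sum>j\<le>d. poly.coeff g j * w ^ j)"
      using g(3) by (simp add: poly_altdef d_def)
    also have "\<dots> = (\<Sum>j<d. poly.coeff g j * w ^ j) + poly.coeff g d * w ^ d"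
      by (simp flip: lessThan_Suc_atMost)
    finally have "poly.coeff g d * w ^ d = - (\<Sum>j<d. poly.coeff g j * w ^ j)"
      by (simp add: eq_neg_iff_add_eq_0 add.commute)
    moreover have "poly.coeff g d \<noteq> 0" using g(1) by (simp add: d_def)
    ultimately have "w ^ d = inverse (poly.coeff g d) * - (\<Sum>j<d. poly.coeff g j * w ^ j)"
      by (metis mult.assoc left_inverse mult_1)
    then show ?thesis
      by (simp add: sum_distrib_left mult_ac flip: sum_negf)
  qed
  have V_w: "w * x \<in> V" if "x \<in> V" for x
  proof -
    have "V \<subseteq> {x. w * x \<in> V}"
    proof (rule V_mono)
      fix a b :: 'a and i :: nat
      assume abi: "a \<in> Qp" "b \<in> B" "i < d"
      have "b * w ^ Suc i \<in> V"
      proof (cases "Suc i < d")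
        case True
        then show ?thesis using V_base[OF abi(2)] by blast
      next
        case False
        with abi(3) have "Suc i = d" by simp
        then have "b * w ^ Suc i = (\<Sum>j<d. (- poly.coeff g j * inverse (poly.coeff g d)) * (b * w ^ j))"
          using w_d by (simp add: sum_distrib_left mult_ac del: power_Suc)
        also have "\<dots> \<in> V"
          by (intro V_sum V_scale subring_mult[OF Qp] subring_minus[OF Qp] inv g(2) V_base abi(2)) auto
        finally show ?thesis .
      qed
      then have "a * (b * w ^ Suc i) \<in> V" using abi(1) V_scale by blast
      then show "a * (b * w ^ i) \<in> {x. w * x \<in> V}" by (simp add: mult_ac)
    qed (auto simp: distrib_left V_zero intro: V_add)
    with that show ?thesis by blast
  qed
  have V_K: "k * x \<in> V" if "k \<in> K" "x \<in> V" for k x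
  proof -
    have "V \<subseteq> {x. k * x \<in> V}"
    proof (rule V_mono)
      fix a b :: 'a and i :: nat
      assume abi: "a \<in> Qp" "b \<in> B" "i < d"
      have "k * b \<in> K" using that(1) B(2) abi(2) subring_mult[OF is_subring_extension[OF K]] by blast
      then obtain c where c: "\<forall>b\<in>B. c b \<in> Qp" "k * b = (\<Sum>b\<in>B. c b * b)"
        using B(3) unfolding lin_span_def by auto
      have "(\<Sum>b\<in>B. c b * (b * w ^ i)) \<in> V"
        using c(1) abi(3) by (intro V_sum V_scale V_base) auto
      then have "k * b * w ^ i \<in> V"
        by (simp add: c(2) sum_distrib_right mult.assoc)
      then have "a * (k * b * w ^ i) \<in> V" using abi(1) V_scale by blast
      then show "a * (b * w ^ i) \<in> {x. k * x \<in> V}" by (simp add: mult_ac)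
    qed (auto simp: distrib_left V_zero intro: V_add)
    with that show ?thesis by blast
  qed
  have V_1: "1 \<in> V"
  proof -
    have "1 \<in> K" by (rule subring_1[OF is_subring_extension[OF K]])
    then obtain c where c: "\<forall>b\<in>B. c b \<in> Qp" "1 = (\<Sum>b\<in>B. c b * b)"
      using B(3) unfolding lin_span_def by auto
    have "(\<Sum>b\<in>B. c b * (b * w ^ 0)) \<in> V"
      using c(1) \<open>d > 0\<close> by (intro V_sum V_scale V_base) auto
    then show ?thesis using c(2) by simp
  qed
  have closed_V: "closed V"
    unfolding V_def
    by (intro bolzano_weierstrass_closed bolzano_weierstrass_lin_span is_subfield_Qp bolzano_weierstrass_Qp I)
  have w_pow: "w ^ n * x \<in> V" if "x \<in> V" for n x
    by (induction n) (use that V_w in \<open>auto simp: mult.assoc\<close>)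
  let ?y = "fps_value f w"
  have f_int: "f \<in> fps_over integers"
    using f by (auto simp: fps_over_def val_ring_eq integers_def)
  have y_V: "?y * x \<in> V" if x: "x \<in> V" for x
  proof -
    have "(\<lambda>n. \<Sum>k<n. f $ k * w ^ k) \<longlonglongrightarrow> ?y"
      using fps_value_sums[OF integral_null_at[OF f_int w(2)]] by (simp add: sums_def)
    then have lim: "(\<lambda>n. x * (\<Sum>k<n. f $ k * w ^ k)) \<longlonglongrightarrow> x * ?y"
      by (rule ultra_tendsto_cmult)
    have mem: "x * (\<Sum>k<n. f $ k * w ^ k) \<in> V" for n
    proof -
      have "(\<Sum>k<n. f $ k * (w ^ k * x)) \<in> V"
        using f by (intro V_sum V_K w_pow x) (auto simp: fps_over_def val_ring_eq)
      then show ?thesis by (simp add: sum_distrib_left mult_ac)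
    qed
    have "x * ?y \<in> V" by (rule closed_sequentially[OF closed_V mem lim])
    then show ?thesis by (simp add: mult.commute)
  qed
  have "?y ^ k \<in> V" for k
    by (induction k) (use V_1 y_V in auto)
  then have "\<exists>f. f \<noteq> 0 \<and> (\<forall>i. poly.coeff f i \<in> Qp) \<and> poly f ?y = 0"
    unfolding V_def by (rule lin_span_powers_algebraic[OF is_subfield_Qp I])
  then show ?thesis by (simp add: Qp_bar_def)
qed

context
  fixes \<pi> :: 'a
  assumes \<pi>: "uniformiser v K \<pi>"
begin

lemma max_ideal_multiples: "max_ideal v K = multiples \<pi> (val_ring v K)"
  using \<pi> by (simp add: uniformiser_def multiples_def)

lemma uniformiser_in_max_ideal: "\<pi> \<in> max_ideal v K"
  unfolding max_ideal_multiples by (rule multiples_self[OF is_subring_val_ring[OF K]])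

lemma of_nat_p_in_max_ideal: "of_nat p \<in> max_ideal v K"
  using nrm_p(1) of_nat_in_Qp[of p] Qp_subset_extension by (auto simp: max_ideal_eq)

lemma uniformiser_neq_0: "\<pi> \<noteq> 0"
  using of_nat_p_in_max_ideal prime_gt_0_nat[OF prime_p]
  unfolding max_ideal_multiples multiples_def by auto

lemma nrm_le_uniformiser: "x \<in> max_ideal v K \<Longrightarrow> nrm x \<le> nrm \<pi>"
  unfolding max_ideal_multiples multiples_def
  by (auto simp: nrm_mult val_ring_eq intro!: mult_left_le)

lemma max_ideal_power_bound:
  "x \<in> max_ideal_power v K n \<Longrightarrow> x \<in> K \<and> nrm x \<le> nrm \<pi> ^ n"
proof (induction n arbitrary: x)
  case 0
  then show ?case by (simp add: val_ring_eq)
next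
  case (Suc n)
  then obtain k :: nat and a b where ab: "x = (\<Sum>j<k. a j * b j)"
      "\<forall>j<k. a j \<in> max_ideal v K \<and> b j \<in> max_ideal_power v K n"
    by auto
  have "a j * b j \<in> K \<and> nrm (a j * b j) \<le> nrm \<pi> ^ Suc n" if "j < k" for j
  proof -
    have a: "a j \<in> max_ideal v K" and b: "b j \<in> K" "nrm (b j) \<le> nrm \<pi> ^ n"
      using ab(2) Suc.IH that by auto
    have "nrm (a j) * nrm (b j) \<le> nrm \<pi> * nrm \<pi> ^ n"
      by (intro mult_mono nrm_le_uniformiser a b) auto
    then show ?thesis
      using a b subring_mult[OF is_subring_extension[OF K]] by (auto simp: nrm_mult max_ideal_eq)
  qed
  then show ?case
    unfolding ab(1) by (auto intro!: nrm_sum_le subring_sum[OF is_subring_extension[OF K]])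
qed

lemma ultrametric_lubin_tate_val_ring:
  "ultrametric_lubin_tate nrm (val_ring v K) \<pi> p (residue_card v K)"
proof unfold_locales
  show "is_subring (val_ring v K)" by (rule is_subring_val_ring[OF K])
  have \<pi>': "\<pi> \<in> K" "nrm \<pi> < 1"
    using uniformiser_in_max_ideal by (auto simp: max_ideal_eq)
  then show "\<pi> \<in> val_ring v K" "nrm \<pi> < 1" by (auto simp: val_ring_eq)
  show "\<pi> \<noteq> 0" by (rule uniformiser_neq_0)
  show "prime p" by (rule prime_p)
  show "of_nat p \<in> multiples \<pi> (val_ring v K)"
    using of_nat_p_in_max_ideal by (simp add: max_ideal_multiples)
  show "\<exists>r>0. residue_card v K = p ^ r" by (rule residue_card_prime_power[OF K])
  show "a ^ residue_card v K - a \<in> multiples \<pi> (val_ring v K)" if "a \<in> val_ring v K" for a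
    using residue_frobenius[OF K that] by (simp add: max_ideal_multiples)
  show "val_ring v K \<subseteq> integers"
    by (auto simp: val_ring_eq integers_def)
  fix a assume a: "a \<in> val_ring v K"
  have "nrm (\<pi> * a) < 1"
    using a \<pi>'(2) mult_left_le[of "nrm a" "nrm \<pi>"] by (simp add: nrm_mult val_ring_eq)
  then have n1: "nrm (1 - \<pi> * a) = 1"
    using nrm_add_eq[of "- (\<pi> * a)" 1] by simp
  then show "1 - \<pi> * a \<noteq> 0" by auto
  have "1 - \<pi> * a \<in> K"
  proof -
    note K' = is_subring_extension[OF K]
    show ?thesis
      by (intro subring_diff[OF K'] subring_1[OF K'] subring_mult[OF K'] \<pi>'(1)) (use a in \<open>simp add: val_ring_eq\<close>)
  qed
  then show "inverse (1 - \<pi> * a) \<in> val_ring v K"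
    using n1 is_subfield_extension[OF K] by (simp add: val_ring_eq nrm_inverse is_subfield_def)
qed

lemma lubin_tate_series_iff:
  "lubin_tate_series v K \<pi> P \<longleftrightarrow> lubin_tate_ring.lubin_tate (val_ring v K) \<pi> (residue_card v K) P"
proof -
  interpret ultrametric_lubin_tate nrm "val_ring v K" \<pi> p "residue_card v K"
    by (rule ultrametric_lubin_tate_val_ring)
  let ?O = "val_ring v K"
  have "(\<exists>G\<in>fps_over ?O. P - fps_const \<pi> * fps_X = fps_X ^ 2 * G) \<longleftrightarrow> P $ 0 = 0 \<and> P $ 1 = \<pi>"
    if P: "P \<in> fps_over ?O"
  proof
    assume "\<exists>G\<in>fps_over ?O. P - fps_const \<pi> * fps_X = fps_X ^ 2 * G"
    then obtain G where G: "P - fps_const \<pi> * fps_X = fps_X ^ 2 * G" by blast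
    have "(P - fps_const \<pi> * fps_X) $ k = 0" if "k < 2" for k
      unfolding G using that by (simp add: fps_X_power_mult_nth)
    from this[of 0] this[of 1] show "P $ 0 = 0 \<and> P $ 1 = \<pi>" by simp
  next
    assume P01: "P $ 0 = 0 \<and> P $ 1 = \<pi>"
    have "P - fps_const \<pi> * fps_X = fps_X ^ 2 * fps_shift 2 P"
    proof (rule fps_ext)
      fix k :: nat
      consider "k = 0" | "k = 1" | k' where "k = Suc (Suc k')"
        by (metis One_nat_def not0_implies_Suc)
      then show "(P - fps_const \<pi> * fps_X) $ k = (fps_X ^ 2 * fps_shift 2 P) $ k"
        using P01 by cases (auto simp: fps_X_power_mult_nth)
    qed
    moreover have "fps_shift 2 P \<in> fps_over ?O"
      using P by (simp add: fps_over_def)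
    ultimately show "\<exists>G\<in>fps_over ?O. P - fps_const \<pi> * fps_X = fps_X ^ 2 * G" by blast
  qed
  then show ?thesis
    unfolding lubin_tate_series_def lubin_tate_def multiples_def image_iff by metis
qed

end

text \<open>The roots \<open>\<omega>\<^sub>1, \<dots>, \<omega>\<^sub>m\<close> are zeros of the \<open>m\<close>-th iterate of \<open>Q\<close>, and
  \<open>\<pi> - \<pi>'\<close> absorbs the denominator needed to give this iterate the linear coefficient
  \<open>\<pi> - \<pi>'\<close>.\<close>

lemma change_uniformiser:
  assumes \<pi>: "uniformiser v K \<pi>" and \<pi>': "uniformiser v K \<pi>'"
    and Q: "lubin_tate_series v K \<pi>' Q" and cong: "\<pi> - \<pi>' \<in> max_ideal_power v K (n + 1)"
    and m: "0 < m" "m \<le> n" and \<omega>: "coherent_roots v Q \<omega>"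
  obtains Q' where "lubin_tate_series v K \<pi> Q'"
    "\<And>i. 1 \<le> i \<Longrightarrow> i \<le> m \<Longrightarrow> fps_value Q' (\<omega> i) = fps_value Q (\<omega> i)"
proof -
  let ?O = "val_ring v K" and ?q = "residue_card v K"
  interpret L: ultrametric_lubin_tate nrm ?O \<pi> p ?q
    by (rule ultrametric_lubin_tate_val_ring[OF \<pi>])
  interpret L': ultrametric_lubin_tate nrm ?O \<pi>' p ?q
    by (rule ultrametric_lubin_tate_val_ring[OF \<pi>'])
  have Q_lt: "L'.lubin_tate Q"
    using Q by (simp add: lubin_tate_series_iff[OF \<pi>'])
  have mult_eq: "multiples \<pi>' ?O = multiples \<pi> ?O"
    using max_ideal_multiples[OF \<pi>] max_ideal_multiples[OF \<pi>'] by simp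
  define a where "a = (\<pi> - \<pi>') / \<pi>' ^ m"
  define N where "N = fps_iterate Q m"
  have Q0: "Q $ 0 = 0" "Q $ 1 = \<pi>'" and QO: "Q \<in> fps_over ?O"
    using Q_lt by (auto simp: L'.lubin_tate_def)
  have NO: "N \<in> fps_over ?O"
    unfolding N_def by (rule L'.fps_iterate_integral[OF QO])
  have bound: "\<pi> - \<pi>' \<in> K" "nrm (\<pi> - \<pi>') \<le> nrm \<pi>' ^ (n + 1)"
    using max_ideal_power_bound[OF \<pi>' cong] by auto
  \<comment> \<open>Here m at most n is used: after division by \<open>\<pi>'^m\<close> at least one
    factor of norm \<open>nrm \<pi>'\<close> remains, so the correction vanishes modulo the maximal
    ideal.\<close>
  have a_max: "a \<in> max_ideal v K"
  proof -
    have "nrm \<pi>' ^ (n + 1) \<le> nrm \<pi>' ^ (m + 1)"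
      using m L'.nrm_c by (intro power_decreasing) auto
    then have "nrm (\<pi> - \<pi>') \<le> nrm \<pi>' * nrm \<pi>' ^ m"
      using bound(2) by simp
    then have "nrm a \<le> nrm \<pi>'"
      using L'.nrm_c_pos by (simp add: a_def nrm_divide nrm_power pos_divide_le_eq)
    moreover have "a \<in> K"
    proof -
      have "\<pi>' ^ m \<in> K"
        using L'.c(1) by (intro subring_power[OF is_subring_extension[OF K]]) (simp add: val_ring_eq)
      then show ?thesis
        using bound(1) is_subfield_extension[OF K] subring_mult[OF is_subring_extension[OF K]]
        by (simp add: a_def divide_inverse is_subfield_def)
    qed
    ultimately show ?thesis using L'.nrm_c by (simp add: max_ideal_eq)
  qed
  then have aO: "a \<in> ?O" by (auto simp: max_ideal_eq val_ring_eq)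
  define Q' where "Q' = Q + fps_const a * N"
  have aN: "fps_const a * N \<in> multiples (fps_const \<pi>) (fps_over ?O)"
    using a_max NO max_ideal_multiples[OF \<pi>] multiples_mult[OF L.subring]
    by (auto simp: multiples_fps_over_iff fps_overD)
  have "L.lubin_tate Q'"
    unfolding L.lubin_tate_def
  proof (intro conjI)
    show "Q' \<in> fps_over ?O"
      unfolding Q'_def by (intro subring_add[OF L.subring1] subring_mult[OF L.subring1] QO NO L.const_in_fps_over aO)
    show "Q' $ 0 = 0" using Q0 by (simp add: Q'_def N_def)
    have "N $ 1 = \<pi>' ^ m"
      unfolding N_def using fps_iterate_nth_1[OF Q0(1)] Q0(2) by simp
    then show "Q' $ 1 = \<pi>"
      using Q0(2) L'.c(2) by (simp add: Q'_def a_def)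
    have "Q - fps_X ^ ?q \<in> multiples (fps_const \<pi>) (fps_over ?O)"
      using Q_lt by (simp add: L'.lubin_tate_def multiples_fps_over_iff mult_eq)
    from multiples_add[OF L.subring1 this aN]
    show "Q' - fps_X ^ ?q \<in> multiples (fps_const \<pi>) (fps_over ?O)"
      by (simp add: Q'_def algebra_simps)
  qed
  then have "lubin_tate_series v K \<pi> Q'"
    by (simp add: lubin_tate_series_iff[OF \<pi>])
  moreover have "fps_value Q' (\<omega> i) = fps_value Q (\<omega> i)" if i: "1 \<le> i" "i \<le> m" for i
  proof -
    have w: "nrm (\<omega> j) < 1" if "1 \<le> j" for j
      using \<omega> that by (simp add: coherent_roots_def v_gt_0_iff)
    have "fps_value N (\<omega> i) = (if m < i then \<omega> (i - m) else 0)"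
      unfolding N_def using \<omega> w i by (intro L'.fps_value_iterate_root Q_lt) (auto simp: coherent_roots_def)
    then have "fps_value N (\<omega> i) = 0" using i by simp
    then show ?thesis
      using QO NO w[OF i(1)] unfolding Q'_def
      by (simp add: fps_value_add fps_value_mult null_at_mult integral_null_at L.fps_over_R_integers)
  qed
  ultimately show ?thesis using that by blast
qed

end

end

theorem proposition1:
  fixes p :: nat
    and v :: "'a::{field_char_0, complete_space} \<Rightarrow> ereal"
    and K :: "'a set"
    and \<pi> \<pi>' :: 'a
    and P Q e :: "'a fps"
    and F :: "'a fps fps"
    and \<omega> :: "nat \<Rightarrow> 'a"
    and n :: nat
  assumes "padic_complex_field p v"
    and "finite_extension_Qp K"
    and "uniformiser v K \<pi>" and "uniformiser v K \<pi>'"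
    and "lubin_tate_series v K \<pi> P" and "lubin_tate_series v K \<pi>' Q"
    and "lubin_tate_formal_group v K P F"
    and "formal_group_exp K F e"
    and "coherent_roots v Q \<omega>"
    and "n \<ge> 1"
  shows "(\<pi> - \<pi>' \<in> max_ideal_power v K (n + 1) \<longrightarrow>
           (\<forall>m. 0 < m \<and> m \<le> n \<longrightarrow>
             primitive_division_point v P m
               (fps_value (dwork_series e \<pi> (residue_card v K) \<omega> m) 1))) \<and>
         (\<pi>' = \<pi> \<longrightarrow>
           coherent_roots v P (\<lambda>i. fps_value (dwork_series e \<pi> (residue_card v K) \<omega> i) 1))"
proof -
  interpret padic_complex_field p v by (rule assms(1))
  note K = assms(2)
  let ?O = "val_ring v K" and ?q = "residue_card v K"
  interpret L: ultrametric_lubin_tate nrm ?O \<pi> p ?q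
    by (rule ultrametric_lubin_tate_val_ring[OF K assms(3)])
  let ?E = "\<lambda>m. fps_value (dwork_series e \<pi> ?q \<omega> m) 1"
  have P: "L.lubin_tate P"
    using assms(5) by (simp add: lubin_tate_series_iff[OF K assms(3)])
  have e: "e $ 0 = 0" "e $ 1 = 1"
    using assms(8) by (auto simp: formal_group_exp_def)
  have Pe: "P oo e = e oo (fps_const \<pi> * fps_X)"
    using formal_group_exp_intertwines[OF assms(7,8)] P by (simp add: L.lubin_tate_def)
  have \<omega>: "nrm (\<omega> i) < 1" "\<omega> i \<in> Qp_bar" if "1 \<le> i" for i
    using assms(9) that by (auto simp: coherent_roots_def v_gt_0_iff)
  have \<omega>_1: "\<omega> 1 \<noteq> 0" "fps_value Q (\<omega> 1) = 0"
    and \<omega>_Suc: "\<And>i. 1 \<le> i \<Longrightarrow> fps_value Q (\<omega> (i + 1)) = \<omega> i"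
    using assms(9) by (auto simp: coherent_roots_def)
  show ?thesis
  proof (intro conjI impI allI, elim conjE)
    fix m assume cong: "\<pi> - \<pi>' \<in> max_ideal_power v K (n + 1)" and m: "0 < m" "m \<le> n"
    obtain Q' where Q': "lubin_tate_series v K \<pi> Q'"
        "\<And>i. 1 \<le> i \<Longrightarrow> i \<le> m \<Longrightarrow> fps_value Q' (\<omega> i) = fps_value Q (\<omega> i)"
      using change_uniformiser[OF K assms(3,4,6) cong m assms(9)] by blast
    have Q'_lt: "L.lubin_tate Q'"
      using Q'(1) by (simp add: lubin_tate_series_iff[OF K assms(3)])
    note lt = P Q'_lt e Pe
    have roots: "\<And>i. 1 \<le> i \<Longrightarrow> i \<le> m \<Longrightarrow> nrm (\<omega> i) < 1" "fps_value Q' (\<omega> 1) = 0"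
      "\<And>i. 1 \<le> i \<Longrightarrow> i < m \<Longrightarrow> fps_value Q' (\<omega> (i + 1)) = \<omega> i"
      using \<omega> \<omega>_1 \<omega>_Suc Q'(2) m by auto
    have E_value: "?E m = fps_value (L.intertwiner e Q') (\<omega> m)"
      by (rule L.dwork_series_value[OF lt roots m(1)])
    note iterate = L.fps_value_iterate_intertwiner[OF lt roots m(1), folded E_value]
    have "?E m \<in> {x. nrm x < 1}"
      using L.nrm_intertwiner_less[OF lt \<omega>(1)] m(1) by (simp add: E_value)
    moreover have "fps_value (L.intertwiner e Q') (\<omega> 1) \<noteq> 0"
      by (rule L.fps_value_intertwiner_neq_0[OF lt \<omega>(1) \<omega>_1(1)]) simp
    \<comment> \<open>The m-th iterate gives 0, and the (m-1)-th gives the value of the intertwiner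
      at \<open>\<omega> 1\<close>, which is nonzero.\<close>
    ultimately show "primitive_division_point v P m (?E m)"
      using iterate[of m] iterate[of "m - 1"] m(1) by (simp add: primitive_division_point_def v_gt_0_iff)
  next
    assume "\<pi>' = \<pi>"
    then have Q_lt: "L.lubin_tate Q"
      using assms(6) by (simp add: lubin_tate_series_iff[OF K assms(3)])
    note lt = P Q_lt e Pe
    have E_value: "?E i = fps_value (L.intertwiner e Q) (\<omega> i)" if "1 \<le> i" for i
      using that \<omega> \<omega>_1 \<omega>_Suc by (intro L.dwork_series_value[OF lt]) auto
    \<comment> \<open>Closedness of the valuation ring puts the coefficients of the intertwiner into
      it, and \<open>\<omega> i\<close> is algebraic.\<close>
    have Qp_bar: "fps_value (L.intertwiner e Q) (\<omega> i) \<in> Qp_bar" if "1 \<le> i" for i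
      using \<omega>[OF that] L.intertwiner_over[OF lt closed_val_ring[OF K]] by (intro fps_value_in_Qp_bar[OF K])
    show "coherent_roots v P ?E"
      unfolding coherent_roots_def
    proof (intro conjI allI impI)
      fix i :: nat assume i: "1 \<le> i"
      show "?E i \<in> Qp_bar" using Qp_bar[OF i] by (simp add: E_value[OF i])
      show "0 < v (?E i)"
        using L.nrm_intertwiner_less[OF lt \<omega>(1)[OF i]] by (simp add: E_value[OF i] v_gt_0_iff)
      show "fps_value P (?E (i + 1)) = ?E i"
        using L.fps_value_P_intertwiner[OF lt \<omega>(1)[of "i + 1"]] \<omega>_Suc[OF i] i by (simp add: E_value)
    next
      show "?E 1 \<noteq> 0"
        using L.fps_value_intertwiner_neq_0[OF lt \<omega>(1) \<omega>_1(1)] by (simp add: E_value)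
      show "fps_value P (?E 1) = 0"
        using L.fps_value_P_intertwiner[OF lt \<omega>(1)[of 1]] \<omega>_1(2) L.fps_value_at_0 L.intertwiner_nth_0[OF lt] by (simp add: E_value)
    qed
  qed
qed

end
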